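(* Let $\{S_n\}_{n\ge0}$ be the SRRW-RVM with zero mean, unit variance innovation sequence $\{\xi_n\}$, memory sequence $\{\mu_n\}$ and recollection probability $p$. If $p=p_c$ and $\{\mu_n\}$ satisfies Assumption A (see context, with parameters $\gamma,\alpha$ and slowly varying part $\ell$, $\ell_n=\ell(n)$) with $\alpha+\gamma+1<0$, then $$\left(\sqrt{\ell_n^{1/(\gamma+1)}}\;\frac{S_{\lfloor nt\rfloor}}{\sqrt n}:t\ge0\right)\to\left(\sqrt t\,K_\infty:t\ge0\right)\quad\text{almost surely and in }L^2\text{ in }D([0,\infty)),$$ where $K_\infty$ is a nonrandom multiple (possibly depending on $\{\mu_n\}$) of $M_\infty$, the almost sure and $L^2$ limit of the martingale $M_n$.
   Context: Model (SRRW-RVM). Fix $p\in[0,1]$ (recollection probability) and $\gamma>-1$. Let $\{\mu_n\}_{n\ge1}$ (memory sequence) be a sequence of positive reals, regularly varying of index $\gamma$: $\mu_{\lfloor\lambda n\rfloor}/\mu_n\to\lambda^\gamma$ for every $\lambda>0$. Put $\nu_n=\sum_{k=1}^n\mu_k$. Let $\{\xi_n\}_{n\ge1}$ (innovation sequence) be i.i.d. real random variables with mean $0$; $\{\alpha_n\}_{n\ge2}$ i.i.d. Bernoulli($p$); $\{\beta_n\}_{n\ge2}$ independent with $\mathbb{P}(\beta_n=k)=\mu_k/\nu_{n-1}$ for $1\le k\le n-1$; the three sequences are independent of each other. Set $X_1=\xi_1$ and, for $n\ge1$, $X_{n+1}=\alpha_{n+1}X_{\beta_{n+1}}+(1-\alpha_{n+1})\xi_{n+1}$.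 The walk is $S_0=0$, $S_n=\sum_{k=1}^nX_k$. Notation. $a_n=\prod_{i=1}^{n-1}\left(1+p\frac{\mu_{i+1}}{\nu_i}\right)^{-1}$ for $n\ge1$ (so $a_1=1$); $p_c=(\gamma+\frac12)/(\gamma+1)$; $M_n=a_n\sum_{k=1}^n\mu_kX_k$ is a martingale, which in the present situation converges almost surely and in $L^2$ to $M_\infty$. $D([0,\infty))$ is the space of r.c.l.l. functions on $[0,\infty)$ with the Skorohod topology. Convergence almost surely (resp. in $L^2$) in $D([0,\infty))$ of processes $Y_n$ to a process $Y$ with continuous paths means: for every $T>0$, $\sup_{0\le t\le T}|Y_n(t)-Y(t)|\to0$ almost surely (resp. in $L^2$). Assumption A. $\mu_n=\mu(n)$ for a function $\mu:[1,\infty)\to(0,\infty)$ that is eventually monotone and regularly varying of index $\gamma$, and $\mu(x)=x^\gamma\ell(x)$, where: (i) for some $B>1$, $\ell(x)=f(\log x)$ for $x>e^B$, where, for some $\alpha\in\mathbb{R}$, $f:(B,\infty)\to(0,\infty)$ is regularly varying of index $\alpha$ of the form $f(x)=x^\alpha\exp\left(\int_{\log B}^{\log x}\zeta(s)\,ds\right)$, with $\zeta$ integrable on $(\log B,x)$ for all finite $x$ and $\zeta(x)\to0$ as $x\to\infty$; (ii) $\zeta$ is of one of three types: (a) $\zeta\equiv0$; (b) $\zeta$ is nonincreasing (hence positive), regularly varying of index $-\rho$ with $\rho\in(0,1]$, $\int_{\log B}^\infty\zeta(x)\,dx=\infty$, and $\zeta$ is eventually differentiable with monotone derivative; (c) $\zeta=-\widetilde\zeta$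 with $\widetilde\zeta$ satisfying the conditions in (b). *)

theory Defs
  imports "HOL-Probability.Probability"
begin

section \<open>Regular variation\<close>

(* The usual definition asks for a positive measurable function on some half-line; only the
   behaviour near infinity matters, so the half-line is existentially quantified. *)
definition regularly_varying :: "(real \<Rightarrow> real) \<Rightarrow> real \<Rightarrow> bool" where
  "regularly_varying f r \<longleftrightarrow>
     (\<exists>x0. (\<forall>x\<ge>x0. f x > 0) \<and> set_borel_measurable borel {x0..} f) \<and>
     (\<forall>c>0. ((\<lambda>x. f (c * x) / f x) \<longlongrightarrow> c powr r) at_top)"

definition regularly_varying_seq :: "(nat \<Rightarrow> real) \<Rightarrow> real \<Rightarrow> bool" where
  "regularly_varying_seq u r \<longleftrightarrow>
     (\<forall>c>0. (\<lambda>n. u (nat \<lfloor>c * real n\<rfloor>) / u n) \<longlonglongrightarrow> c powr r)"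

definition eventually_monotone :: "(real \<Rightarrow> real) \<Rightarrow> bool" where
  "eventually_monotone f \<longleftrightarrow> (\<exists>x0. mono_on {x0..} f \<or> antimono_on {x0..} f)"


section \<open>The model\<close>

text \<open>All sequences are indexed by \<^typ>\<open>nat\<close>, but only the indices from the statement matter:
  \<open>\<mu>\<close>, \<open>\<xi>\<close>, \<open>X\<close> from 1 on and \<open>\<epsilon>\<close> (the Bernoulli variables), \<open>\<beta>\<close> from 2 on.\<close>

definition cum_memory :: "(nat \<Rightarrow> real) \<Rightarrow> nat \<Rightarrow> real" where
  "cum_memory \<mu> n = (\<Sum>k=1..n. \<mu> k)"

definition seq_sigma :: "'a measure \<Rightarrow> nat set \<Rightarrow> (nat \<Rightarrow> 'b measure) \<Rightarrow> (nat \<Rightarrow> 'a \<Rightarrow> 'b) \<Rightarrow> 'a set set" where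
  "seq_sigma M I N Y = sigma_sets (space M) (\<Union>n\<in>I. {Y n -` E \<inter> space M | E. E \<in> sets (N n)})"

locale srrw_rvm = prob_space M for M :: "'a measure" +
  fixes \<gamma> p :: real
    and \<mu> :: "nat \<Rightarrow> real"
    and \<xi> :: "nat \<Rightarrow> 'a \<Rightarrow> real"
    and \<epsilon> :: "nat \<Rightarrow> 'a \<Rightarrow> bool"
    and \<beta> :: "nat \<Rightarrow> 'a \<Rightarrow> nat"
    and X :: "nat \<Rightarrow> 'a \<Rightarrow> real"
  assumes p_range: "0 \<le> p" "p \<le> 1"
    and gamma_gt: "\<gamma> > -1"
    and memory_pos: "\<And>n. n \<ge> 1 \<Longrightarrow> \<mu> n > 0"
    and memory_rv: "regularly_varying_seq \<mu> \<gamma>"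
    and innovation_indep: "indep_vars (\<lambda>_. borel) \<xi> {1..}"
    and innovation_ident: "\<And>n. n \<ge> 1 \<Longrightarrow> distr M borel (\<xi> n) = distr M borel (\<xi> 1)"
    and innovation_integrable: "integrable M (\<xi> 1)"
    and innovation_mean: "expectation (\<xi> 1) = 0"
    and bernoulli_indep: "indep_vars (\<lambda>_. count_space UNIV) \<epsilon> {2..}"
    and bernoulli_distr:
      "\<And>n. n \<ge> 2 \<Longrightarrow> distr M (count_space UNIV) (\<epsilon> n) = measure_pmf (bernoulli_pmf p)"
    and recall_indep: "indep_vars (\<lambda>n. count_space {1..n-1}) \<beta> {2..}"
    and recall_distr: "\<And>n k. n \<ge> 2 \<Longrightarrow> 1 \<le> k \<Longrightarrow> k \<le> n - 1 \<Longrightarrow>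
           prob {\<omega> \<in> space M. \<beta> n \<omega> = k} = \<mu> k / cum_memory \<mu> (n - 1)"
    and sequences_indep:
      "indep_sets (\<lambda>i. [seq_sigma M {1..} (\<lambda>_. borel) \<xi>,
                        seq_sigma M {2..} (\<lambda>_. count_space UNIV) \<epsilon>,
                        seq_sigma M {2..} (\<lambda>n. count_space {1..n-1}) \<beta>] ! i) {..<3}"
    and step_one: "\<And>\<omega>. \<omega> \<in> space M \<Longrightarrow> X 1 \<omega> = \<xi> 1 \<omega>"
    and step_Suc: "\<And>n \<omega>. n \<ge> 1 \<Longrightarrow> \<omega> \<in> space M \<Longrightarrow>
           X (n + 1) \<omega> = of_bool (\<epsilon> (n + 1) \<omega>) * X (\<beta> (n + 1) \<omega>) \<omega>
                        + (1 - of_bool (\<epsilon> (n + 1) \<omega>)) * \<xi> (n + 1) \<omega>"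

definition walk :: "(nat \<Rightarrow> 'a \<Rightarrow> real) \<Rightarrow> nat \<Rightarrow> 'a \<Rightarrow> real" where
  "walk X n \<omega> = (\<Sum>k=1..n. X k \<omega>)"

definition norm_coeff :: "real \<Rightarrow> (nat \<Rightarrow> real) \<Rightarrow> nat \<Rightarrow> real" where
  "norm_coeff p \<mu> n = (\<Prod>i=1..n-1. inverse (1 + p * (\<mu> (i + 1) / cum_memory \<mu> i)))"

definition walk_martingale :: "real \<Rightarrow> (nat \<Rightarrow> real) \<Rightarrow> (nat \<Rightarrow> 'a \<Rightarrow> real) \<Rightarrow> nat \<Rightarrow> 'a \<Rightarrow> real" where
  "walk_martingale p \<mu> X n \<omega> = norm_coeff p \<mu> n * (\<Sum>k=1..n. \<mu> k * X k \<omega>)"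

definition p_crit :: "real \<Rightarrow> real" where
  "p_crit \<gamma> = (\<gamma> + 1/2) / (\<gamma> + 1)"


section \<open>Assumption A\<close>

(* Positivity of zeta on all of (ln B, oo) need not be demanded: it follows from monotonicity
   and the eventual positivity contained in regular variation. *)
definition zeta_type_b :: "real \<Rightarrow> (real \<Rightarrow> real) \<Rightarrow> bool" where
  "zeta_type_b B \<zeta> \<longleftrightarrow>
     antimono_on {ln B<..} \<zeta> \<and>
     (\<exists>\<rho>. 0 < \<rho> \<and> \<rho> \<le> 1 \<and> regularly_varying \<zeta> (-\<rho>)) \<and>
     (\<integral>\<^sup>+x\<in>{ln B<..}. ennreal (\<zeta> x) \<partial>lborel) = \<infinity> \<and>
     (\<exists>x0. \<forall>x\<ge>x0. \<zeta> differentiable (at x)) \<and> eventually_monotone (deriv \<zeta>)"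

(* m is the interpolating function of the memory sequence; m, l live on [1,oo), f on (B,oo) and
   zeta on (ln B,oo), and nothing is required of them elsewhere. *)
definition assumption_A :: "(nat \<Rightarrow> real) \<Rightarrow> real \<Rightarrow> real \<Rightarrow> (real \<Rightarrow> real) \<Rightarrow> bool" where
  "assumption_A \<mu> \<gamma> \<alpha> l \<longleftrightarrow>
     (\<exists>m. (\<forall>n\<ge>1. \<mu> n = m (real n)) \<and>
          (\<forall>x\<ge>1. m x > 0) \<and> eventually_monotone m \<and> regularly_varying m \<gamma> \<and>
          (\<forall>x\<ge>1. m x = x powr \<gamma> * l x)) \<and>
     (\<exists>B f \<zeta>. B > 1 \<and>
          (\<forall>x > exp B. l x = f (ln x)) \<and>
          (\<forall>x > B. f x > 0) \<and> regularly_varying f \<alpha> \<and>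
          (\<forall>x > B. f x = x powr \<alpha> * exp (LINT s:{ln B<..<ln x}|lborel. \<zeta> s)) \<and>
          (\<forall>x. set_integrable lborel {ln B<..<x} \<zeta>) \<and>
          (\<zeta> \<longlongrightarrow> 0) at_top \<and>
          ((\<forall>x > ln B. \<zeta> x = 0) \<or> zeta_type_b B \<zeta> \<or> zeta_type_b B (\<lambda>x. - \<zeta> x)))"


section \<open>Modes of convergence\<close>

(* Extended nonnegative values make the supremum meaningful without a boundedness side condition. *)
definition sup_dist :: "real \<Rightarrow> (real \<Rightarrow> real) \<Rightarrow> (real \<Rightarrow> real) \<Rightarrow> ennreal" where
  "sup_dist T x y = (SUP t\<in>{0..T}. ennreal \<bar>x t - y t\<bar>)"

(* Measurability is part of the notion, since nn_integral of a non-measurable function is only a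
   lower integral. *)
definition L2_null :: "'a measure \<Rightarrow> (nat \<Rightarrow> 'a \<Rightarrow> ennreal) \<Rightarrow> bool" where
  "L2_null M U \<longleftrightarrow> (\<forall>n. U n \<in> borel_measurable M) \<and> (\<lambda>n. \<integral>\<^sup>+\<omega>. (U n \<omega>)\<^sup>2 \<partial>M) \<longlonglongrightarrow> 0"

(* Convergence in D([0,oo)) to a process with continuous paths, i.e. locally uniform convergence. *)
definition AS_convergent_D ::
  "'a measure \<Rightarrow> (nat \<Rightarrow> 'a \<Rightarrow> real \<Rightarrow> real) \<Rightarrow> ('a \<Rightarrow> real \<Rightarrow> real) \<Rightarrow> bool" where
  "AS_convergent_D M Y Z \<longleftrightarrow>
     (\<forall>T>0. AE \<omega> in M. (\<lambda>n. sup_dist T (Y n \<omega>) (Z \<omega>)) \<longlonglongrightarrow> 0)"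

definition L2_convergent_D ::
  "'a measure \<Rightarrow> (nat \<Rightarrow> 'a \<Rightarrow> real \<Rightarrow> real) \<Rightarrow> ('a \<Rightarrow> real \<Rightarrow> real) \<Rightarrow> bool" where
  "L2_convergent_D M Y Z \<longleftrightarrow> (\<forall>T>0. L2_null M (\<lambda>n \<omega>. sup_dist T (Y n \<omega>) (Z \<omega>)))"

end

theory Submission
  imports Defs "HOL-Real_Asymp.Real_Asymp"
begin

text \<open>The differences \<open>X\<^bsub>n+1\<^esub> - E[X\<^bsub>n+1\<^esub> | F\<^sub>n] = X\<^bsub>n+1\<^esub> - p T\<^sub>n / \<nu>\<^sub>n\<close>, where \<open>T\<^sub>n\<close> is the sum of
  the \<open>\<mu>\<^sub>k X\<^sub>k\<close> with \<open>k \<le> n\<close>, have second moment at most 1, and both \<open>M\<^sub>n = a\<^sub>n T\<^sub>n\<close> and the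
  martingale part of \<open>S\<^sub>n\<close> are transforms of them with deterministic coefficients. The compensator
  of \<open>S\<^sub>n\<close> is the sum of the \<open>w\<^sub>k M\<^sub>k\<close> with \<open>w\<^sub>k = p / (a\<^sub>k \<nu>\<^sub>k)\<close> and \<open>k < n\<close>. Let
  \<open>b\<^sub>n = n\<^bsup>1/2\<^esup> \<ell>\<^sub>n\<^bsup>-1/(2(\<gamma>+1))\<^esup>\<close>. For \<open>p = p\<^sub>c\<close>, Karamata's theorem makes \<open>w\<^sub>n\<close> asymptotically
  proportional to \<open>b\<^bsub>n+1\<^esub> - b\<^sub>n\<close> and \<open>a\<^sub>n \<mu>\<^sub>n\<close> to \<open>1 / b\<^sub>n\<close>, while \<open>\<alpha> + \<gamma> + 1 < 0\<close> makes the sum of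
  the \<open>1 / b\<^sub>n\<^sup>2\<close> finite. So \<open>M\<^sub>n\<close> converges, the compensator divided by \<open>b\<^sub>n\<close> tends to a multiple
  of \<open>M\<^sub>\<infinity>\<close> by the Stolz-Cesaro theorem, and the martingale part is negligible by Kronecker's lemma
  (almost surely) and Doob's inequality (in \<open>L\<^sup>2\<close>). Since \<open>b\<close> is regularly varying of index 1/2,
  convergence at integer times upgrades to locally uniform convergence of the paths.\<close>

section \<open>Weighted averages of sequences\<close>

lemma Stolz_Cesaro_sum:
  fixes v b :: "nat \<Rightarrow> real"
  assumes b: "filterlim b at_top sequentially"
    and mono: "eventually (\<lambda>n. b n < b (Suc n)) sequentially"
    and lim: "(\<lambda>n. v n / (b (Suc n) - b n)) \<longlonglongrightarrow> L"
  shows "(\<lambda>n. (\<Sum>k<n. v k) / b n) \<longlonglongrightarrow> L"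
proof (rule LIMSEQ_I)
  fix r :: real assume r: "0 < r"
  define e where "e = r / 3"
  have e: "e > 0" using r by (simp add: e_def)
  have "eventually (\<lambda>n. dist (v n / (b (Suc n) - b n)) L < e) sequentially"
    using tendstoD[OF lim e] .
  from eventually_conj[OF this mono]
  obtain N where N: "\<And>n. n \<ge> N \<Longrightarrow> dist (v n / (b (Suc n) - b n)) L < e \<and> b n < b (Suc n)"
    by (auto simp: eventually_sequentially)
  have step: "\<bar>v n - L * (b (Suc n) - b n)\<bar> \<le> e * (b (Suc n) - b n)" if "n \<ge> N" for n
  proof -
    have d: "b (Suc n) - b n > 0" using N[OF that] by simp
    have "v n - L * (b (Suc n) - b n) = (v n / (b (Suc n) - b n) - L) * (b (Suc n) - b n)"
      using d by (simp add: field_simps)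
    then have "\<bar>v n - L * (b (Suc n) - b n)\<bar> = \<bar>v n / (b (Suc n) - b n) - L\<bar> * (b (Suc n) - b n)"
      using d by (simp add: abs_mult)
    also have "\<dots> \<le> e * (b (Suc n) - b n)"
      using N[OF that] d by (intro mult_right_mono) (auto simp: dist_real_def)
    finally show ?thesis .
  qed
  define D where "D n = (\<Sum>k<n. v k) - L * b n" for n
  have D: "\<bar>D n - D N\<bar> \<le> e * (b n - b N)" if "n \<ge> N" for n
    using that
  proof (induction n rule: dec_induct)
    case (step n)
    have "D (Suc n) - D N = (D n - D N) + (v n - L * (b (Suc n) - b n))"
      by (simp add: D_def algebra_simps)
    then have "\<bar>D (Suc n) - D N\<bar> \<le> \<bar>D n - D N\<bar> + \<bar>v n - L * (b (Suc n) - b n)\<bar>"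
      by linarith
    also have "\<dots> \<le> e * (b n - b N) + e * (b (Suc n) - b n)"
      using step.IH \<open>\<And>n. n \<ge> N \<Longrightarrow> \<bar>v n - L * (b (Suc n) - b n)\<bar> \<le> _\<close>[OF step.hyps(1)] by linarith
    finally show ?case by (simp add: algebra_simps)
  qed simp
  define C where "C = \<bar>D N\<bar> + e * \<bar>b N\<bar>"
  have "eventually (\<lambda>n. b n > max 1 (C / e)) sequentially"
    using b unfolding filterlim_at_top_dense by blast
  from eventually_conj[OF this eventually_ge_at_top[of N]]
  obtain N' where N': "\<And>n. n \<ge> N' \<Longrightarrow> b n > max 1 (C / e) \<and> N \<le> n"
    by (auto simp: eventually_sequentially)
  show "\<exists>no. \<forall>n\<ge>no. norm ((\<Sum>k<n. v k) / b n - L) < r"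
  proof (intro exI[of _ N'] allI impI)
    fix n assume "n \<ge> N'"
    from N'[OF this] have bn: "b n > 1" "C / e < b n" "N \<le> n" by auto
    have "\<bar>D n\<bar> \<le> \<bar>D N\<bar> + e * (b n - b N)" using D[OF bn(3)] by linarith
    also have "\<dots> \<le> C + e * b n"
    proof -
      have "e * (- b N) \<le> e * \<bar>b N\<bar>" using e by (intro mult_left_mono) auto
      then show ?thesis by (simp add: C_def algebra_simps)
    qed
    also have "\<dots> \<le> 2 * e * b n" using bn e by (simp add: field_simps)
    finally have "\<bar>D n\<bar> \<le> 2 * e * b n" .
    moreover have "(\<Sum>k<n. v k) / b n - L = D n / b n" using bn by (simp add: D_def field_simps)
    ultimately have "norm ((\<Sum>k<n. v k) / b n - L) \<le> 2 * e" using bn by (simp add: field_simps)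
    also have "\<dots> < r" using r by (simp add: e_def)
    finally show "norm ((\<Sum>k<n. v k) / b n - L) < r" .
  qed
qed

lemma Kronecker_lemma:
  fixes y b :: "nat \<Rightarrow> real"
  assumes b: "filterlim b at_top sequentially"
    and mono: "eventually (\<lambda>n. b n < b (Suc n)) sequentially"
    and "convergent (\<lambda>n. \<Sum>k<n. y k)"
  shows "(\<lambda>n. (\<Sum>k<n. b (Suc k) * y k) / b n) \<longlonglongrightarrow> 0"
proof -
  define T where "T n = (\<Sum>k<n. y k)" for n
  obtain t where t: "T \<longlonglongrightarrow> t" using assms(3) unfolding T_def convergent_def by blast
  have "(\<lambda>n. (\<Sum>k<n. T k * (b (Suc k) - b k)) / b n) \<longlonglongrightarrow> t"
  proof (rule Stolz_Cesaro_sum[OF b mono])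
    show "(\<lambda>n. T n * (b (Suc n) - b n) / (b (Suc n) - b n)) \<longlonglongrightarrow> t"
      by (rule Lim_transform_eventually[OF t]) (use mono in eventually_elim, auto)
  qed
  from tendsto_diff[OF t this]
  have lim: "(\<lambda>n. T n - (\<Sum>k<n. T k * (b (Suc k) - b k)) / b n) \<longlonglongrightarrow> 0" by simp
  have parts: "(\<Sum>k<n. b (Suc k) * y k) = b n * T n - (\<Sum>k<n. T k * (b (Suc k) - b k))" for n
    by (induction n) (simp_all add: T_def algebra_simps)
  have "eventually (\<lambda>n. b n > 0) sequentially"
    using b by (auto simp: filterlim_at_top_dense)
  then show ?thesis
    by (intro Lim_transform_eventually[OF lim], eventually_elim) (simp add: parts diff_divide_distrib)
qed

lemma max_abs_over_tendsto_zero: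
  fixes x b :: "nat \<Rightarrow> real"
  assumes b: "filterlim b at_top sequentially"
    and mono: "eventually (\<lambda>n. b n < b (Suc n)) sequentially"
    and lim: "(\<lambda>n. x n / b n) \<longlonglongrightarrow> 0"
  shows "(\<lambda>n. Max ((\<lambda>k. \<bar>x k\<bar>) ` {..n}) / b n) \<longlonglongrightarrow> 0"
proof (rule LIMSEQ_I)
  fix r :: real assume r: "0 < r"
  have "eventually (\<lambda>n. dist (x n / b n) 0 < r / 2) sequentially"
    using r by (intro tendstoD[OF lim]) auto
  moreover have "eventually (\<lambda>n. b n > 0) sequentially"
    using b by (auto simp: filterlim_at_top_dense)
  ultimately have "eventually (\<lambda>n. \<bar>x n\<bar> \<le> r / 2 * b n \<and> b n > 0 \<and> b n < b (Suc n)) sequentially"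
    using mono by eventually_elim (auto simp: dist_real_def field_simps)
  then obtain N where N: "\<And>n. n \<ge> N \<Longrightarrow> \<bar>x n\<bar> \<le> r / 2 * b n"
      "\<And>n. n \<ge> N \<Longrightarrow> b n > 0" "\<And>n. n \<ge> N \<Longrightarrow> b n < b (Suc n)"
    by (auto simp: eventually_sequentially)
  have bm: "b k \<le> b n" if "N \<le> k" "k \<le> n" for k n
    using that(2)
  proof (induction n rule: dec_induct)
    case (step n)
    then show ?case using N(3)[of n] that(1) by simp
  qed simp
  define C where "C = Max ((\<lambda>k. \<bar>x k\<bar>) ` {..N})"
  have "eventually (\<lambda>n. b n > 2 * C / r) sequentially"
    using b by (auto simp: filterlim_at_top_dense)
  then obtain N' where N': "\<And>n. n \<ge> N' \<Longrightarrow> b n > 2 * C / r"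
    by (auto simp: eventually_sequentially)
  show "\<exists>no. \<forall>n\<ge>no. norm (Max ((\<lambda>k. \<bar>x k\<bar>) ` {..n}) / b n - 0) < r"
  proof (intro exI[of _ "max N N'"] allI impI)
    fix n assume n: "n \<ge> max N N'"
    have bn: "b n > 0" "2 * C / r < b n" using n N N' by auto
    have nonneg: "0 \<le> Max ((\<lambda>k. \<bar>x k\<bar>) ` {..n})"
      by (rule order.trans[OF _ Max_ge[of _ "\<bar>x 0\<bar>"]]) auto
    have "Max ((\<lambda>k. \<bar>x k\<bar>) ` {..n}) \<le> r / 2 * b n"
    proof (rule Max.boundedI, goal_cases)
      case (3 a)
      then obtain k where k: "k \<le> n" "a = \<bar>x k\<bar>" by auto
      show ?case
      proof (cases "k \<le> N")
        case True
        then have "a \<le> C" unfolding C_def k by (intro Max_ge) auto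
        also have "\<dots> \<le> r / 2 * b n" using bn r by (simp add: field_simps)
        finally show ?thesis .
      next
        case False
        then have "a \<le> r / 2 * b k" using N(1) k by auto
        also have "\<dots> \<le> r / 2 * b n" using bm[of k n] False k r by (intro mult_left_mono) auto
        finally show ?thesis .
      qed
    qed auto
    also have "\<dots> < r * b n" using r bn by simp
    finally show "norm (Max ((\<lambda>k. \<bar>x k\<bar>) ` {..n}) / b n - 0) < r"
      using nonneg bn by (simp add: field_simps)
  qed
qed

section \<open>Consequences of Assumption A\<close>

lemma assumption_A_log_increment:
  assumes A: "assumption_A \<mu> \<gamma> \<alpha> l" and "0 < \<eta>"
  obtains x0 where "x0 > exp 1"
    and "\<And>x y. x0 \<le> x \<Longrightarrow> x \<le> y \<Longrightarrow>
           \<bar>ln (l y) - ln (l x) - \<alpha> * (ln (ln y) - ln (ln x))\<bar> \<le> \<eta> * (ln (ln y) - ln (ln x))"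
proof -
  from A obtain B f \<zeta> where B: "B > 1"
    and l: "\<And>x. x > exp B \<Longrightarrow> l x = f (ln x)"
    and f: "\<And>x. x > B \<Longrightarrow> f x = x powr \<alpha> * exp (LINT s:{ln B<..<ln x}|lborel. \<zeta> s)"
    and int: "\<And>x. set_integrable lborel {ln B<..<x} \<zeta>"
    and lim: "(\<zeta> \<longlongrightarrow> 0) at_top"
    unfolding assumption_A_def by blast
  define I where "I u = (LINT s:{ln B<..<u}|lborel. \<zeta> s)" for u
  from tendstoD[OF lim \<open>0 < \<eta>\<close>] obtain u0 where u0: "\<And>s. s \<ge> u0 \<Longrightarrow> \<bar>\<zeta> s\<bar> \<le> \<eta>"
    by (fastforce simp: eventually_at_top_linorder dist_real_def)
  define u1 where "u1 = max u0 (ln B + 1)"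
  have incr: "\<bar>I v - I u\<bar> \<le> \<eta> * (v - u)" if "u1 \<le> u" "u \<le> v" for u v
  proof -
    have u: "u > ln B" "u \<ge> u0" using that by (auto simp: u1_def)
    have eq: "{ln B<..<v} = {ln B<..<u} \<union> {u..<v}" using u that by auto
    have i2: "set_integrable lborel {u..<v} \<zeta>"
      by (rule set_integrable_subset[OF int[of v]]) (use eq in auto)
    have "I v = I u + (LINT s:{u..<v}|lborel. \<zeta> s)"
      unfolding I_def eq by (rule set_integral_Un[OF _ int i2]) auto
    then have "\<bar>I v - I u\<bar> = \<bar>LINT s:{u..<v}|lborel. \<zeta> s\<bar>" by simp
    also have "\<dots> \<le> (LINT s:{u..<v}|lborel. \<bar>\<zeta> s\<bar>)"
      using set_integral_norm_bound[OF i2] by simp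
    also have "\<dots> \<le> (LINT s:{u..<v}|lborel. \<eta>)"
    proof (rule set_integral_mono)
      show "set_integrable lborel {u..<v} (\<lambda>s. \<bar>\<zeta> s\<bar>)" using i2 by (rule set_integrable_abs)
      show "set_integrable lborel {u..<v} (\<lambda>s. \<eta>)"
        using that by (auto simp: set_integrable_def)
    qed (use u0 u in auto)
    also have "\<dots> = \<eta> * (v - u)" using that by (simp add: set_lebesgue_integral_def)
    finally show ?thesis .
  qed
  define x0 where "x0 = max (exp 2) (exp (max (B + 1) (exp u1)))"
  have "x0 \<ge> exp 2" "x0 \<ge> exp (max (B + 1) (exp u1))"
    unfolding x0_def by (rule max.cobounded1, rule max.cobounded2)
  moreover from this(1) have "x0 > 0" using less_le_trans[OF exp_gt_zero] by blast
  ultimately have x0: "x0 \<ge> exp 2" "ln x0 \<ge> max (B + 1) (exp u1)"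
    by (auto simp only: ln_ge_iff)
  have big: "ln x > B" "x > exp B" "ln (ln x) \<ge> u1" "x > 0" "ln x > 0" if "x \<ge> x0" for x
  proof -
    have "x0 > 0" using x0(1) less_le_trans[OF exp_gt_zero] by blast
    with that show "x > 0" by simp
    have ge: "ln x \<ge> ln x0" using \<open>x0 > 0\<close> that by simp
    show "ln x > B" using ge x0(2) by simp
    then show "x > exp B" using \<open>x > 0\<close> by (metis exp_less_cancel_iff exp_ln)
    show "ln x > 0" using \<open>ln x > B\<close> B by simp
    then show "ln (ln x) \<ge> u1" using ge x0(2) by (subst ln_ge_iff) auto
  qed
  have lnl: "ln (l x) = \<alpha> * ln (ln x) + I (ln (ln x))" if "x \<ge> x0" for x
    using big[OF that] by (simp add: l f ln_mult I_def ln_powr)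
  show thesis
  proof (rule that[of x0])
    have "exp 1 < (exp 2 :: real)" by simp
    then show "x0 > exp 1" using x0(1) by linarith
    fix x y assume xy: "x0 \<le> x" "x \<le> y"
    then have y: "x0 \<le> y" by simp
    have "ln (ln x) \<le> ln (ln y)" using big[OF xy(1)] big[OF y] xy by simp
    then have "\<bar>I (ln (ln y)) - I (ln (ln x))\<bar> \<le> \<eta> * (ln (ln y) - ln (ln x))"
      using big[OF xy(1)] by (intro incr) auto
    then show "\<bar>ln (l y) - ln (l x) - \<alpha> * (ln (ln y) - ln (ln x))\<bar> \<le> \<eta> * (ln (ln y) - ln (ln x))"
      by (simp add: lnl[OF xy(1)] lnl[OF y] algebra_simps)
  qed
qed

lemma assumption_A_Potter:
  assumes A: "assumption_A \<mu> \<gamma> \<alpha> l" and "0 < \<eta>"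
  obtains x0 where "x0 \<ge> 1"
    and "\<And>x y. x0 \<le> x \<Longrightarrow> x \<le> y \<Longrightarrow> \<bar>ln (l y) - ln (l x)\<bar> \<le> \<eta> * (ln y - ln x)"
proof -
  from assumption_A_log_increment[OF A zero_less_one] obtain x1 where x1: "x1 > exp 1"
    and incr: "\<And>x y. x1 \<le> x \<Longrightarrow> x \<le> y \<Longrightarrow>
           \<bar>ln (l y) - ln (l x) - \<alpha> * (ln (ln y) - ln (ln x))\<bar> \<le> 1 * (ln (ln y) - ln (ln x))"
    by blast
  define x0 where "x0 = max x1 (exp ((\<bar>\<alpha>\<bar> + 1) / \<eta>))"
  show thesis
  proof (rule that[of x0])
    have "(1::real) \<le> exp 1" by simp
    then have "x1 \<ge> 1" using x1 by linarith
    then show "x0 \<ge> 1" by (simp add: x0_def)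
    fix x y assume xy: "x0 \<le> x" "x \<le> y"
    have x: "x1 \<le> x" "exp ((\<bar>\<alpha>\<bar> + 1) / \<eta>) \<le> x" "x > exp 1" using xy x1 by (auto simp: x0_def)
    have pos: "x > 0" using less_trans[OF exp_gt_zero x(3)] .
    have lnx: "ln x \<ge> 1" "ln x \<ge> (\<bar>\<alpha>\<bar> + 1) / \<eta>" using x pos by (auto simp: ln_ge_iff)
    have lny: "ln y \<ge> ln x" using pos xy by simp
    define d where "d = ln (ln y) - ln (ln x)"
    have d0: "d \<ge> 0" using lnx lny by (simp add: d_def)
    have "d = ln (ln y / ln x)" using lnx lny by (simp add: d_def ln_div)
    also have "\<dots> \<le> ln y / ln x - 1" using lnx lny by (intro ln_le_minus_one) auto
    also have "\<dots> = (ln y - ln x) / ln x" using lnx by (simp add: field_simps)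
    finally have d1: "d * ln x \<le> ln y - ln x" using lnx by (simp add: field_simps)
    have "\<bar>ln (l y) - ln (l x) - \<alpha> * d\<bar> \<le> d" using incr[OF x(1) xy(2)] by (simp add: d_def)
    then have "\<bar>ln (l y) - ln (l x)\<bar> \<le> \<bar>\<alpha> * d\<bar> + d" by linarith
    also have "\<dots> = (\<bar>\<alpha>\<bar> + 1) * d" using d0 by (simp add: abs_mult algebra_simps)
    also have "\<dots> \<le> (\<eta> * ln x) * d" using lnx(2) \<open>0 < \<eta>\<close> d0
      by (intro mult_right_mono) (auto simp: field_simps)
    also have "\<dots> \<le> \<eta> * (ln y - ln x)" using d1 \<open>0 < \<eta>\<close>
      by (simp add: mult.assoc mult.commute[of d])
    finally show "\<bar>ln (l y) - ln (l x)\<bar> \<le> \<eta> * (ln y - ln x)" .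
  qed
qed

lemma assumption_A_log_bound:
  assumes A: "assumption_A \<mu> \<gamma> \<alpha> l" and "0 < \<eta>"
  obtains C x0 where "x0 > exp 1" "\<And>x. x0 \<le> x \<Longrightarrow> ln (l x) \<le> C + (\<alpha> + \<eta>) * ln (ln x)"
proof -
  from assumption_A_log_increment[OF assms] obtain x0 where x0: "x0 > exp 1"
    and incr: "\<And>x y. x0 \<le> x \<Longrightarrow> x \<le> y \<Longrightarrow>
           \<bar>ln (l y) - ln (l x) - \<alpha> * (ln (ln y) - ln (ln x))\<bar> \<le> \<eta> * (ln (ln y) - ln (ln x))"
    by blast
  show thesis
  proof (rule that[OF x0])
    fix x assume "x0 \<le> x"
    from incr[OF order.refl this]
    show "ln (l x) \<le> (ln (l x0) - (\<alpha> + \<eta>) * ln (ln x0)) + (\<alpha> + \<eta>) * ln (ln x)"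
      by (simp add: algebra_simps abs_le_iff)
  qed
qed

lemma summable_inverse_log_powr:
  fixes s :: real
  assumes "s < -1"
  shows "summable (\<lambda>n. (1 + ln (real n)) powr s / real n)"
proof -
  define f where "f n = (1 + ln (real n)) powr s / real n" for n
  have "summable f \<longleftrightarrow> summable (\<lambda>n. 2^n * f (2^n))"
  proof (rule condensation_test)
    fix m :: nat assume m: "0 < m"
    have "(1 + ln (real (Suc m))) powr s \<le> (1 + ln (real m)) powr s"
      using m assms by (intro powr_mono2') (auto simp: add_pos_nonneg)
    then show "f (Suc m) \<le> f m" unfolding f_def using m by (intro frac_le) auto
  qed (simp add: f_def)
  also have "(\<lambda>n. 2^n * f (2^n)) = (\<lambda>n. (1 + real n * ln 2) powr s)"
    by (simp add: f_def ln_realpow)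
  also have "summable \<dots>"
  proof (rule summable_comparison_test')
    show "summable (\<lambda>n. (ln 2) powr s * real n powr s)"
      using assms by (intro summable_mult) (simp add: summable_real_powr_iff)
    fix n :: nat assume "n \<ge> 1"
    then show "norm ((1 + real n * ln 2) powr s) \<le> ln 2 powr s * real n powr s"
      using assms by (subst powr_mult[symmetric]) (auto intro!: powr_mono2' simp: mult.commute)
  qed
  finally show ?thesis by (simp add: f_def)
qed

section \<open>Asymptotics of the memory sequence\<close>

lemma tendsto_mult_exp_minus_one:
  fixes y :: "nat \<Rightarrow> real"
  assumes "(\<lambda>n. real n * y n) \<longlonglongrightarrow> s"
  shows "(\<lambda>n. real n * (exp (y n) - 1)) \<longlonglongrightarrow> s"
proof -
  have "(\<lambda>n. (real n * y n) * inverse (real n)) \<longlonglongrightarrow> s * 0"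
    by (intro tendsto_mult assms lim_inverse_n)
  then have "(\<lambda>n. (real n * y n) * inverse (real n)) \<longlonglongrightarrow> 0" by simp
  then have "y \<longlonglongrightarrow> 0"
    by (rule Lim_transform_eventually)
      (use eventually_gt_at_top[of 0] in \<open>eventually_elim, simp add: field_simps\<close>)
  then have "(\<lambda>n. (real n * y n) * exp (y n)) \<longlonglongrightarrow> s * exp 0"
    by (intro tendsto_mult assms tendsto_exp)
  then have upper: "(\<lambda>n. (real n * y n) * exp (y n)) \<longlonglongrightarrow> s" by simp
  show ?thesis
  proof (rule tendsto_sandwich[OF _ _ assms upper]; rule always_eventually; rule allI)
    fix n
    have "y n \<le> exp (y n) - 1" using exp_ge_add_one_self[of "y n"] by linarith
    then show "real n * y n \<le> real n * (exp (y n) - 1)" by (rule mult_left_mono) simp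
    have "(1 - y n) * exp (y n) \<le> exp (- y n) * exp (y n)"
      using exp_ge_add_one_self[of "- y n"] by (intro mult_right_mono) auto
    then have "exp (y n) - 1 \<le> y n * exp (y n)" by (simp add: exp_minus algebra_simps)
    then show "real n * (exp (y n) - 1) \<le> real n * y n * exp (y n)"
      by (simp add: mult.assoc mult_left_mono)
  qed
qed

locale memory_asymptotics =
  fixes \<mu> :: "nat \<Rightarrow> real" and \<gamma> \<alpha> :: real and l :: "real \<Rightarrow> real"
  assumes A: "assumption_A \<mu> \<gamma> \<alpha> l" and gamma: "\<gamma> > -1"
begin

lemma l_pos: "1 \<le> x \<Longrightarrow> 0 < l x"
  and memory_eq: "1 \<le> n \<Longrightarrow> \<mu> n = real n powr \<gamma> * l (real n)"
proof -
  from A obtain m where m: "\<And>n. n \<ge> 1 \<Longrightarrow> \<mu> n = m (real n)" "\<And>x. x \<ge> 1 \<Longrightarrow> m x > 0"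
    "\<And>x. x \<ge> 1 \<Longrightarrow> m x = x powr \<gamma> * l x"
    unfolding assumption_A_def by blast
  show "0 < l x" if "1 \<le> x" using m(2)[OF that] m(3)[OF that] that by (simp add: zero_less_mult_iff)
  show "\<mu> n = real n powr \<gamma> * l (real n)" if "1 \<le> n" using m(1)[OF that] m(3)[of "real n"] that by simp
qed

lemma memory_positive: "1 \<le> n \<Longrightarrow> 0 < \<mu> n"
  using l_pos[of "real n"] by (simp add: memory_eq)

lemma l_log_increment: "(\<lambda>n. real n * (ln (l (real (Suc n))) - ln (l (real n)))) \<longlonglongrightarrow> 0"
proof (rule LIMSEQ_I)
  fix r :: real assume r: "0 < r"
  from assumption_A_Potter[OF A, of "r / 2"] r obtain x0 where x0: "x0 \<ge> 1"
    and P: "\<And>x y. x0 \<le> x \<Longrightarrow> x \<le> y \<Longrightarrow> \<bar>ln (l y) - ln (l x)\<bar> \<le> r / 2 * (ln y - ln x)"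
    by auto
  show "\<exists>no. \<forall>n\<ge>no. norm (real n * (ln (l (real (Suc n))) - ln (l (real n))) - 0) < r"
  proof (intro exI[of _ "nat \<lceil>x0\<rceil>"] allI impI)
    fix n assume "nat \<lceil>x0\<rceil> \<le> n"
    then have n: "x0 \<le> real n" "real n \<ge> 1" using x0 by linarith+
    have "1 + 1 / real n = real (Suc n) / real n" using n by (simp add: field_simps)
    then have "ln (real (Suc n)) - ln (real n) = ln (1 + 1 / real n)"
      using n by (simp add: ln_div)
    also have "\<dots> \<le> 1 / real n" using n by (intro ln_add_one_self_le_self) auto
    finally have d: "real n * (ln (real (Suc n)) - ln (real n)) \<le> 1" using n by (simp add: field_simps)
    have "\<bar>real n * (ln (l (real (Suc n))) - ln (l (real n)))\<bar>
        \<le> real n * (r / 2 * (ln (real (Suc n)) - ln (real n)))"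
      unfolding abs_mult using P[of "real n" "real (Suc n)"] n by (intro mult_mono) auto
    also have "\<dots> \<le> r / 2" using d r mult_left_mono[OF d, of "r / 2"] by (simp add: mult_ac)
    finally show "norm (real n * (ln (l (real (Suc n))) - ln (l (real n))) - 0) < r" using r by simp
  qed
qed

definition regular :: "real \<Rightarrow> real \<Rightarrow> nat \<Rightarrow> real" where
  "regular s t n = real n powr s * l (real n) powr t"

lemma regular_pos: "1 \<le> n \<Longrightarrow> 0 < regular s t n"
  using l_pos[of "real n"] by (simp add: regular_def)

lemma regular_exp: "1 \<le> n \<Longrightarrow> regular s t n = exp (s * ln (real n) + t * ln (l (real n)))"
  using l_pos[of "real n"] by (simp add: regular_def powr_def exp_add)

lemma regular_ratio: "(\<lambda>n. real n * (regular s t (Suc n) / regular s t n - 1)) \<longlonglongrightarrow> s"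
proof -
  define y where "y n = s * (ln (real (Suc n)) - ln (real n)) + t * (ln (l (real (Suc n))) - ln (l (real n)))" for n
  have "(\<lambda>n. real n * (ln (real (Suc n)) - ln (real n))) \<longlonglongrightarrow> 1" by real_asymp
  then have "(\<lambda>n. s * (real n * (ln (real (Suc n)) - ln (real n)))
      + t * (real n * (ln (l (real (Suc n))) - ln (l (real n))))) \<longlonglongrightarrow> s * 1 + t * 0"
    by (intro tendsto_add tendsto_mult tendsto_const l_log_increment)
  then have "(\<lambda>n. real n * y n) \<longlonglongrightarrow> s" by (simp add: y_def algebra_simps)
  from tendsto_mult_exp_minus_one[OF this] show ?thesis
  proof (rule Lim_transform_eventually)
    show "eventually (\<lambda>n. real n * (exp (y n) - 1) = real n * (regular s t (Suc n) / regular s t n - 1)) sequentially"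
      using eventually_ge_at_top[of 1]
    proof eventually_elim
      case (elim n)
      then show ?case by (simp add: regular_exp y_def exp_diff[symmetric] algebra_simps)
    qed
  qed
qed

lemma regular_ratio_one: "(\<lambda>n. regular s t (Suc n) / regular s t n) \<longlonglongrightarrow> 1"
proof -
  have "(\<lambda>n. (real n * (regular s t (Suc n) / regular s t n - 1)) * inverse (real n) + 1) \<longlonglongrightarrow> s * 0 + 1"
    by (intro tendsto_add tendsto_mult regular_ratio lim_inverse_n tendsto_const)
  then have "(\<lambda>n. (real n * (regular s t (Suc n) / regular s t n - 1)) * inverse (real n) + 1) \<longlonglongrightarrow> 1" by simp
  moreover have "eventually (\<lambda>n. (real n * (regular s t (Suc n) / regular s t n - 1)) * inverse (real n) + 1
      = regular s t (Suc n) / regular s t n) sequentially"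
    using eventually_gt_at_top[of 0]
  proof eventually_elim
    case (elim n)
    then have "real n * y * inverse (real n) = y" for y by (simp add: field_simps)
    then show ?case by (simp only:)
  qed
  ultimately show ?thesis by (rule Lim_transform_eventually)
qed

lemma regular_at_top:
  assumes "0 < s"
  shows "filterlim (regular s t) at_top sequentially"
proof -
  define \<eta> where "\<eta> = s / (2 * (\<bar>t\<bar> + 1))"
  have eta: "\<eta> > 0" "\<bar>t\<bar> * \<eta> \<le> s / 2" using assms by (auto simp: \<eta>_def field_simps)
  from assumption_A_Potter[OF A eta(1)] obtain x0 where x0: "x0 \<ge> 1"
    and P: "\<And>x y. x0 \<le> x \<Longrightarrow> x \<le> y \<Longrightarrow> \<bar>ln (l y) - ln (l x)\<bar> \<le> \<eta> * (ln y - ln x)"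
    by blast
  define C where "C = \<bar>t * ln (l x0)\<bar>"
  have "filterlim (\<lambda>n. exp (s / 2 * ln (real n) - C)) at_top sequentially"
    using assms by real_asymp
  then show ?thesis
  proof (rule filterlim_at_top_mono)
    show "eventually (\<lambda>n. exp (s / 2 * ln (real n) - C) \<le> regular s t n) sequentially"
      using eventually_ge_at_top[of "nat \<lceil>x0\<rceil>"]
    proof eventually_elim
      case (elim n)
      then have n: "x0 \<le> real n" "real n \<ge> 1" using x0 by linarith+
      have "\<bar>t * ln (l (real n)) - t * ln (l x0)\<bar> = \<bar>t\<bar> * \<bar>ln (l (real n)) - ln (l x0)\<bar>"
        by (simp add: abs_mult[symmetric] algebra_simps)
      also have "\<dots> \<le> \<bar>t\<bar> * (\<eta> * (ln (real n) - ln x0))"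
        using P[OF order.refl n(1)] by (intro mult_left_mono) auto
      also have "\<dots> \<le> (\<bar>t\<bar> * \<eta>) * ln (real n)"
        unfolding mult.assoc[symmetric] using eta x0 by (intro mult_left_mono) auto
      also have "\<dots> \<le> s / 2 * ln (real n)" using eta n by (intro mult_right_mono) auto
      finally have "s / 2 * ln (real n) - C \<le> s * ln (real n) + t * ln (l (real n))"
        unfolding C_def by linarith
      then show ?case using n by (simp add: regular_exp)
    qed
  qed
qed

lemma regular_strict_mono:
  assumes "0 < s"
  shows "eventually (\<lambda>n. regular s t n < regular s t (Suc n)) sequentially"
proof -
  have "eventually (\<lambda>n. 0 < real n * (regular s t (Suc n) / regular s t n - 1)) sequentially"
    using order_tendstoD(1)[OF regular_ratio assms] .
  then show ?thesis using eventually_ge_at_top[of 1]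
  proof eventually_elim
    case (elim n)
    then show ?case using regular_pos[of n s t] by (auto simp: zero_less_mult_iff field_simps)
  qed
qed

lemma regular_increment:
  assumes "0 < s"
  shows "(\<lambda>n. regular s t n / (real n * (regular s t (Suc n) - regular s t n))) \<longlonglongrightarrow> 1 / s"
proof -
  have "(\<lambda>n. 1 / (real n * (regular s t (Suc n) / regular s t n - 1))) \<longlonglongrightarrow> 1 / s"
    using assms by (intro tendsto_divide tendsto_const regular_ratio) auto
  then show ?thesis
  proof (rule Lim_transform_eventually)
    show "eventually (\<lambda>n. 1 / (real n * (regular s t (Suc n) / regular s t n - 1))
        = regular s t n / (real n * (regular s t (Suc n) - regular s t n))) sequentially"
      using eventually_ge_at_top[of 1]
    proof eventually_elim
      case (elim n)
      then have "regular s t n > 0" using regular_pos by simp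
      then have "real n * (regular s t (Suc n) / regular s t n - 1)
          = real n * (regular s t (Suc n) - regular s t n) / regular s t n" by (simp add: field_simps)
      then show ?case by simp
    qed
  qed
qed

lemma memory_regular: "1 \<le> n \<Longrightarrow> \<mu> n = regular \<gamma> 1 n"
  using l_pos[of "real n"] by (simp add: memory_eq regular_def)

lemma mult_memory_regular: "1 \<le> n \<Longrightarrow> real n * \<mu> n = regular (\<gamma> + 1) 1 n"
  using l_pos[of "real n"] by (simp add: memory_eq regular_def powr_add)

lemma cum_memory_positive: "1 \<le> n \<Longrightarrow> 0 < cum_memory \<mu> n"
  unfolding cum_memory_def by (intro sum_pos memory_positive) auto

lemma memory_ratio: "(\<lambda>n. \<mu> (Suc n) / \<mu> n) \<longlonglongrightarrow> 1"
  by (rule Lim_transform_eventually[OF regular_ratio_one[of \<gamma> 1]])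
    (use eventually_ge_at_top[of 1] in \<open>eventually_elim, simp add: memory_regular\<close>)

lemma Karamata_cum_memory: "(\<lambda>n. cum_memory \<mu> n / regular (\<gamma> + 1) 1 n) \<longlonglongrightarrow> 1 / (\<gamma> + 1)"
proof -
  let ?b = "regular (\<gamma> + 1) 1"
  have s: "0 < \<gamma> + 1" using gamma by simp
  have "(\<lambda>n. (\<mu> (Suc n) / \<mu> n) * (?b n / (real n * (?b (Suc n) - ?b n)))) \<longlonglongrightarrow> 1 * (1 / (\<gamma> + 1))"
    by (intro tendsto_mult memory_ratio regular_increment s)
  from this[unfolded mult_1] have "(\<lambda>n. \<mu> (Suc n) / (?b (Suc n) - ?b n)) \<longlonglongrightarrow> 1 / (\<gamma> + 1)"
  proof (rule Lim_transform_eventually)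
    show "eventually (\<lambda>n. (\<mu> (Suc n) / \<mu> n) * (?b n / (real n * (?b (Suc n) - ?b n)))
        = \<mu> (Suc n) / (?b (Suc n) - ?b n)) sequentially"
      using eventually_ge_at_top[of 1]
    proof eventually_elim
      case (elim n)
      then show ?case using memory_positive[of n] by (simp add: mult_memory_regular[symmetric])
    qed
  qed
  from Stolz_Cesaro_sum[OF regular_at_top[OF s] regular_strict_mono[OF s] this]
  show ?thesis by (simp add: cum_memory_def sum.atLeast1_atMost_eq)
qed

lemma memory_over_cum: "(\<lambda>n. real n * \<mu> n / cum_memory \<mu> n) \<longlonglongrightarrow> \<gamma> + 1"
proof -
  have "(\<lambda>n. 1 / (cum_memory \<mu> n / regular (\<gamma> + 1) 1 n)) \<longlonglongrightarrow> 1 / (1 / (\<gamma> + 1))"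
    using gamma by (intro tendsto_divide tendsto_const Karamata_cum_memory) auto
  then have "(\<lambda>n. 1 / (cum_memory \<mu> n / regular (\<gamma> + 1) 1 n)) \<longlonglongrightarrow> \<gamma> + 1" by simp
  then show ?thesis
    by (rule Lim_transform_eventually)
      (use eventually_ge_at_top[of 1] in \<open>eventually_elim, simp add: mult_memory_regular\<close>)
qed

lemma norm_coeff_Suc:
  "1 \<le> n \<Longrightarrow> norm_coeff p \<mu> (Suc n) = norm_coeff p \<mu> n / (1 + p * (\<mu> (Suc n) / cum_memory \<mu> n))"
  by (cases n) (simp_all add: norm_coeff_def divide_inverse)

lemma norm_coeff_pos: "0 \<le> p \<Longrightarrow> 0 < norm_coeff p \<mu> n"
  unfolding norm_coeff_def
proof (rule prod_pos)
  fix i assume "0 \<le> p" "i \<in> {1..n - 1}"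
  then have "0 \<le> p * (\<mu> (i + 1) / cum_memory \<mu> i)"
    using memory_positive[of "i + 1"] cum_memory_positive[of i] by simp
  then show "0 < inverse (1 + p * (\<mu> (i + 1) / cum_memory \<mu> i))" by (simp add: add_pos_nonneg)
qed

lemma norm_coeff_asymptotics:
  assumes p: "0 \<le> p" "p \<le> 1"
  obtains C where "0 < C" "(\<lambda>n. norm_coeff p \<mu> n * cum_memory \<mu> n powr p) \<longlonglongrightarrow> C"
proof -
  define x where "x n = \<mu> (Suc n) / cum_memory \<mu> n" for n
  define q where "q n = ln (norm_coeff p \<mu> n) + p * ln (cum_memory \<mu> n)" for n
  have x_pos: "0 < x n" if "1 \<le> n" for n
    using that memory_positive[of "Suc n"] cum_memory_positive[of n] by (simp add: x_def)
  have "(\<lambda>n. (\<mu> (Suc n) / \<mu> n) * (real n * \<mu> n / cum_memory \<mu> n)) \<longlonglongrightarrow> 1 * (\<gamma> + 1)"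
    by (intro tendsto_mult memory_ratio memory_over_cum)
  from this[unfolded mult_1] have nx: "(\<lambda>n. real n * x n) \<longlonglongrightarrow> \<gamma> + 1"
  proof (rule Lim_transform_eventually)
    show "eventually (\<lambda>n. (\<mu> (Suc n) / \<mu> n) * (real n * \<mu> n / cum_memory \<mu> n) = real n * x n) sequentially"
      using eventually_ge_at_top[of 1]
    proof eventually_elim
      case (elim n)
      then show ?case using memory_positive[of n] by (simp add: x_def)
    qed
  qed
  have q_step: "q (Suc n) - q n = p * ln (1 + x n) - ln (1 + p * x n)" if n: "1 \<le> n" for n
  proof -
    have c: "cum_memory \<mu> (Suc n) = cum_memory \<mu> n * (1 + x n)"
      using cum_memory_positive[OF n] by (simp add: x_def cum_memory_def field_simps)
    have "1 + p * x n > 0" using p x_pos[OF n] by (intro add_pos_nonneg) auto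
    then have "ln (norm_coeff p \<mu> (Suc n)) = ln (norm_coeff p \<mu> n) - ln (1 + p * x n)"
      using norm_coeff_pos[OF p(1), of n] norm_coeff_Suc[OF n, of p] by (simp add: x_def ln_div)
    moreover have "ln (cum_memory \<mu> (Suc n)) = ln (cum_memory \<mu> n) + ln (1 + x n)"
      unfolding c using cum_memory_positive[OF n] x_pos[OF n] by (intro ln_mult_pos) auto
    ultimately show ?thesis by (simp add: q_def algebra_simps)
  qed
  have "summable (\<lambda>n. q (Suc n) - q n)"
  proof (rule summable_comparison_test_ev)
    have "eventually (\<lambda>n. real n * x n < \<gamma> + 2) sequentially"
      using order_tendstoD(2)[OF nx, of "\<gamma> + 2"] by simp
    moreover have "eventually (\<lambda>n. real n \<ge> \<gamma> + 2 \<and> n \<ge> 1) sequentially"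
      using eventually_ge_at_top[of "nat \<lceil>\<gamma> + 2\<rceil> + 1"] by eventually_elim linarith
    ultimately show "eventually (\<lambda>n. norm (q (Suc n) - q n) \<le> 2 * (\<gamma> + 2)\<^sup>2 * (1 / real n ^ 2)) sequentially"
    proof eventually_elim
      case (elim n)
      then have n: "1 \<le> n" by simp
      note x0 = x_pos[OF n]
      have x_le: "x n \<le> (\<gamma> + 2) / real n" using elim n by (simp add: field_simps)
      also have "\<dots> \<le> 1" using elim n by (simp add: field_simps)
      finally have x1: "x n \<le> 1" .
      have px: "0 \<le> p * x n" "p * x n \<le> x n" using p x0 by (auto simp: mult_left_le_one_le)
      have "\<bar>ln (1 + x n) - x n\<bar> \<le> (x n)\<^sup>2"
        using x0 x1 by (intro abs_ln_one_plus_x_minus_x_bound_nonneg) auto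
      then have "p * \<bar>ln (1 + x n) - x n\<bar> \<le> 1 * (x n)\<^sup>2" using p by (intro mult_mono) auto
      moreover have "\<bar>ln (1 + p * x n) - p * x n\<bar> \<le> (p * x n)\<^sup>2"
        using px x1 by (intro abs_ln_one_plus_x_minus_x_bound_nonneg) auto
      moreover have "(p * x n)\<^sup>2 \<le> (x n)\<^sup>2" using px by (intro power_mono) auto
      moreover have "q (Suc n) - q n = p * (ln (1 + x n) - x n) - (ln (1 + p * x n) - p * x n)"
        unfolding q_step[OF n] by (simp add: algebra_simps)
      moreover have "\<bar>p * (ln (1 + x n) - x n)\<bar> = p * \<bar>ln (1 + x n) - x n\<bar>"
        using p by (simp add: abs_mult)
      ultimately have "\<bar>q (Suc n) - q n\<bar> \<le> 2 * (x n)\<^sup>2" by linarith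
      also have "\<dots> \<le> 2 * ((\<gamma> + 2) / real n)\<^sup>2"
        using x_le x0 by (intro mult_left_mono power_mono) auto
      finally show ?case by (simp add: power_divide)
    qed
    show "summable (\<lambda>n. 2 * (\<gamma> + 2)\<^sup>2 * (1 / real n ^ 2))"
      using inverse_power_summable[of 2, where 'a = real] by (intro summable_mult) (simp add: divide_inverse)
  qed
  then have "(\<lambda>n. \<Sum>k<n. q (Suc k) - q k) \<longlonglongrightarrow> suminf (\<lambda>n. q (Suc n) - q n)" by (rule summable_LIMSEQ)
  then have "(\<lambda>n. (q n - q 0) + q 0) \<longlonglongrightarrow> suminf (\<lambda>n. q (Suc n) - q n) + q 0"
    unfolding sum_lessThan_telescope by (intro tendsto_add tendsto_const)
  then have "(\<lambda>n. exp (q n)) \<longlonglongrightarrow> exp (suminf (\<lambda>n. q (Suc n) - q n) + q 0)"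
    by (intro tendsto_exp) simp
  then have "(\<lambda>n. norm_coeff p \<mu> n * cum_memory \<mu> n powr p) \<longlonglongrightarrow> exp (suminf (\<lambda>n. q (Suc n) - q n) + q 0)"
  proof (rule Lim_transform_eventually)
    show "eventually (\<lambda>n. exp (q n) = norm_coeff p \<mu> n * cum_memory \<mu> n powr p) sequentially"
      using eventually_ge_at_top[of 1]
    proof eventually_elim
      case (elim n)
      then show ?case
        using norm_coeff_pos[OF p(1), of n] cum_memory_positive[of n] by (simp add: q_def exp_add powr_def)
    qed
  qed
  then show thesis by (intro that) auto
qed

definition scale :: "nat \<Rightarrow> real" where
  "scale n = sqrt (real n) / sqrt (l (real n) powr (1 / (\<gamma> + 1)))"

lemma scale_regular: "scale n = regular (1 / 2) (- (1 / (2 * (\<gamma> + 1)))) n"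
proof (cases "n = 0")
  case False
  then have "0 < l (real n)" using l_pos by simp
  then have "sqrt (l (real n) powr (1 / (\<gamma> + 1))) = l (real n) powr (1 / (\<gamma> + 1) * (1 / 2))"
    by (subst powr_half_sqrt[symmetric]) (auto simp: powr_powr)
  also have "1 / (\<gamma> + 1) * (1 / 2) = 1 / (2 * (\<gamma> + 1))" by simp
  finally have "sqrt (l (real n) powr (1 / (\<gamma> + 1))) = l (real n) powr (1 / (2 * (\<gamma> + 1)))" .
  then show ?thesis
    by (simp only: scale_def regular_def powr_half_sqrt powr_minus_divide of_nat_0_le_iff
        times_divide_eq_right mult_1_right)
qed (simp add: scale_def regular_def)

lemma scale_pos: "1 \<le> n \<Longrightarrow> 0 < scale n"
  by (simp add: scale_regular regular_pos)

lemma scale_nonneg: "0 \<le> scale n"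
  using scale_pos[of n] by (cases "n = 0") (auto simp: scale_def)

lemma scale_at_top: "filterlim scale at_top sequentially"
  unfolding scale_regular by (rule regular_at_top) simp

lemma scale_strict_mono: "eventually (\<lambda>n. scale n < scale (Suc n)) sequentially"
  unfolding scale_regular by (rule regular_strict_mono) simp

lemma cum_memory_scale:
  defines "\<kappa> \<equiv> 1 / (2 * (\<gamma> + 1))"
  shows "(\<lambda>n. cum_memory \<mu> n powr \<kappa> * scale n / real n) \<longlonglongrightarrow> (1 / (\<gamma> + 1)) powr \<kappa>"
proof -
  have "(\<lambda>n. (cum_memory \<mu> n / regular (\<gamma> + 1) 1 n) powr \<kappa>) \<longlonglongrightarrow> (1 / (\<gamma> + 1)) powr \<kappa>"
    using gamma by (intro tendsto_powr Karamata_cum_memory tendsto_const) auto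
  then show ?thesis
  proof (rule Lim_transform_eventually)
    show "eventually (\<lambda>n. (cum_memory \<mu> n / regular (\<gamma> + 1) 1 n) powr \<kappa>
        = cum_memory \<mu> n powr \<kappa> * scale n / real n) sequentially"
      using eventually_ge_at_top[of 1]
    proof eventually_elim
      case (elim n)
      have k: "(\<gamma> + 1) * \<kappa> = 1 / 2" using gamma by (simp add: \<kappa>_def)
      have "regular (\<gamma> + 1) 1 n powr \<kappa> * scale n
          = exp ((\<gamma> + 1) * \<kappa> * ln (real n) + 1 / 2 * ln (real n))"
        using elim unfolding scale_regular \<kappa>_def[symmetric]
        by (simp add: regular_exp powr_def exp_add[symmetric] algebra_simps)
      also have "\<dots> = real n" unfolding k using elim by (simp add: field_simps)
      finally have "regular (\<gamma> + 1) 1 n powr \<kappa> * scale n = real n" .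
      moreover have "1 / regular (\<gamma> + 1) 1 n powr \<kappa> = scale n / (regular (\<gamma> + 1) 1 n powr \<kappa> * scale n)"
        using scale_pos[OF elim] by simp
      ultimately have "1 / regular (\<gamma> + 1) 1 n powr \<kappa> = scale n / real n" by simp
      then show ?case
        using cum_memory_positive[OF elim] regular_pos[OF elim, of "\<gamma> + 1" 1]
        by (simp add: powr_divide) (metis times_divide_eq_right mult.right_neutral)
    qed
  qed
qed

context
  fixes p :: real
  assumes p: "p = p_crit \<gamma>" "0 \<le> p" "p \<le> 1"
begin

lemma one_minus_p: "1 - p = 1 / (2 * (\<gamma> + 1))"
  using gamma by (simp add: p p_crit_def field_simps)

lemma drift_weight_asymptotics:
  obtains c where "(\<lambda>n. (p / (norm_coeff p \<mu> n * cum_memory \<mu> n)) / (scale (Suc n) - scale n)) \<longlonglongrightarrow> c"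
proof -
  define \<kappa> where "\<kappa> = 1 / (2 * (\<gamma> + 1))"
  have p_kappa: "p + \<kappa> = 1" using one_minus_p unfolding \<kappa>_def by linarith
  from norm_coeff_asymptotics[OF p(2,3)] obtain C where C: "0 < C"
    "(\<lambda>n. norm_coeff p \<mu> n * cum_memory \<mu> n powr p) \<longlonglongrightarrow> C" by blast
  have incr: "(\<lambda>n. scale n / (real n * (scale (Suc n) - scale n))) \<longlonglongrightarrow> 1 / (1 / 2)"
    unfolding scale_regular by (rule regular_increment) simp
  have "(\<lambda>n. p / (norm_coeff p \<mu> n * cum_memory \<mu> n powr p)
      / (cum_memory \<mu> n powr \<kappa> * scale n / real n) * (scale n / (real n * (scale (Suc n) - scale n))))
    \<longlonglongrightarrow> p / C / (1 / (\<gamma> + 1)) powr \<kappa> * (1 / (1 / 2))"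
    unfolding \<kappa>_def
    by (rule tendsto_mult[OF tendsto_divide[OF tendsto_divide[OF tendsto_const C(2)] cum_memory_scale] incr])
      (use C(1) gamma in auto)
  then have "(\<lambda>n. (p / (norm_coeff p \<mu> n * cum_memory \<mu> n)) / (scale (Suc n) - scale n))
      \<longlonglongrightarrow> p / C / (1 / (\<gamma> + 1)) powr \<kappa> * (1 / (1 / 2))"
  proof (rule Lim_transform_eventually)
    show "eventually (\<lambda>n. p / (norm_coeff p \<mu> n * cum_memory \<mu> n powr p)
      / (cum_memory \<mu> n powr \<kappa> * scale n / real n) * (scale n / (real n * (scale (Suc n) - scale n)))
      = (p / (norm_coeff p \<mu> n * cum_memory \<mu> n)) / (scale (Suc n) - scale n)) sequentially"
      using eventually_ge_at_top[of 1]
    proof eventually_elim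
      case (elim n)
      have "cum_memory \<mu> n powr p * cum_memory \<mu> n powr \<kappa> = cum_memory \<mu> n"
        using cum_memory_positive[OF elim] by (simp add: powr_add[symmetric] p_kappa)
      then have "p / (norm_coeff p \<mu> n * cum_memory \<mu> n)
          = p / (norm_coeff p \<mu> n * cum_memory \<mu> n powr p) / cum_memory \<mu> n powr \<kappa>"
        by (simp add: mult.assoc)
      then show ?case using elim scale_pos[OF elim] by auto
    qed
  qed
  then show thesis by (rule that)
qed

lemma scale_square: "(scale n)\<^sup>2 = real n / l (real n) powr (1 / (\<gamma> + 1))"
  by (simp add: scale_def power_divide)

context
  assumes crit: "\<alpha> + \<gamma> + 1 < 0"
begin

lemma l_powr_bound:
  obtains s K where "s < -1" "0 < K"
    "eventually (\<lambda>n. l (real n) powr (1 / (\<gamma> + 1)) \<le> K * (1 + ln (real n)) powr s) sequentially"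
proof -
  define \<eta> where "\<eta> = - (\<alpha> + \<gamma> + 1) / 2"
  define s where "s = (\<alpha> + \<eta>) / (\<gamma> + 1)"
  have eta: "0 < \<eta>" using crit by (simp add: \<eta>_def)
  have s: "s < -1" using crit gamma by (simp add: s_def \<eta>_def field_simps)
  from assumption_A_log_bound[OF A eta] obtain C x0 where x0: "x0 > exp 1"
    and le: "\<And>x. x0 \<le> x \<Longrightarrow> ln (l x) \<le> C + (\<alpha> + \<eta>) * ln (ln x)" by blast
  have "eventually (\<lambda>n. l (real n) powr (1 / (\<gamma> + 1)) \<le>
      (exp (C / (\<gamma> + 1)) * (1 / 2) powr s) * (1 + ln (real n)) powr s) sequentially"
    using eventually_ge_at_top[of "nat \<lceil>x0\<rceil>"]
  proof eventually_elim
    case (elim n)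
    then have n: "x0 \<le> real n" by linarith
    then have "exp 1 \<le> real n" using x0 by simp
    moreover from this have "0 < real n" using less_le_trans[OF exp_gt_zero] by blast
    ultimately have ln1: "1 \<le> ln (real n)" by (simp add: ln_ge_iff)
    have "real n \<ge> 1" using \<open>0 < real n\<close> by simp
    then have "l (real n) powr (1 / (\<gamma> + 1)) = exp (ln (l (real n)) / (\<gamma> + 1))"
      using l_pos[of "real n"] by (simp add: powr_def)
    also have "\<dots> \<le> exp ((C + (\<alpha> + \<eta>) * ln (ln (real n))) / (\<gamma> + 1))"
      using le[OF n] gamma by (simp add: divide_right_mono)
    also have "(C + (\<alpha> + \<eta>) * ln (ln (real n))) / (\<gamma> + 1) = C / (\<gamma> + 1) + s * ln (ln (real n))"
      by (simp add: s_def divide_inverse algebra_simps)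
    also have "exp \<dots> = exp (C / (\<gamma> + 1)) * ln (real n) powr s"
      using ln1 by (simp add: powr_def exp_add)
    also have "ln (real n) powr s \<le> ((1 / 2) * (1 + ln (real n))) powr s"
      using s ln1 by (intro powr_mono2') auto
    also have "\<dots> = (1 / 2) powr s * (1 + ln (real n)) powr s"
      by (rule powr_mult)
    finally show ?case by (simp add: mult_ac)
  qed
  from that[OF s _ this] show thesis by simp
qed

lemma summable_inverse_scale_square: "summable (\<lambda>n. 1 / (scale n)\<^sup>2)"
proof -
  from l_powr_bound obtain s K where s: "s < -1" "0 < K"
    and le: "eventually (\<lambda>n. l (real n) powr (1 / (\<gamma> + 1)) \<le> K * (1 + ln (real n)) powr s) sequentially" .
  show ?thesis
  proof (rule summable_comparison_test_ev)
    show "summable (\<lambda>n. K * ((1 + ln (real n)) powr s / real n))"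
      by (intro summable_mult summable_inverse_log_powr s)
    show "eventually (\<lambda>n. norm (1 / (scale n)\<^sup>2) \<le> K * ((1 + ln (real n)) powr s / real n)) sequentially"
      using le by eventually_elim (simp add: scale_square divide_right_mono)
  qed
qed

lemma scale_square_dominates: "(\<lambda>n. real n / (scale n)\<^sup>2) \<longlonglongrightarrow> 0"
proof -
  from l_powr_bound obtain s K where s: "s < -1" "0 < K"
    and le: "eventually (\<lambda>n. l (real n) powr (1 / (\<gamma> + 1)) \<le> K * (1 + ln (real n)) powr s) sequentially" .
  have upper: "(\<lambda>n. K * (1 + ln (real n)) powr s) \<longlonglongrightarrow> 0" using s by real_asymp
  show ?thesis
  proof (rule tendsto_sandwich[OF _ _ tendsto_const upper])
    show "eventually (\<lambda>n. 0 \<le> real n / (scale n)\<^sup>2) sequentially" by simp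
    show "eventually (\<lambda>n. real n / (scale n)\<^sup>2 \<le> K * (1 + ln (real n)) powr s) sequentially"
      using le eventually_ge_at_top[of 1] by eventually_elim (simp add: scale_square)
  qed
qed

lemma summable_martingale_coeff: "summable (\<lambda>n. (norm_coeff p \<mu> (Suc n) * \<mu> (Suc n))\<^sup>2)"
proof -
  define \<kappa> where "\<kappa> = 1 / (2 * (\<gamma> + 1))"
  have p_kappa: "p + \<kappa> = 1" using one_minus_p unfolding \<kappa>_def by linarith
  from norm_coeff_asymptotics[OF p(2,3)] obtain C where C: "0 < C"
    "(\<lambda>n. norm_coeff p \<mu> n * cum_memory \<mu> n powr p) \<longlonglongrightarrow> C" by blast
  have "(\<lambda>n. (norm_coeff p \<mu> n * cum_memory \<mu> n powr p) * (real n * \<mu> n / cum_memory \<mu> n)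
      * (cum_memory \<mu> n powr \<kappa> * scale n / real n)) \<longlonglongrightarrow> C * (\<gamma> + 1) * (1 / (\<gamma> + 1)) powr \<kappa>"
    unfolding \<kappa>_def by (rule tendsto_mult[OF tendsto_mult[OF C(2) memory_over_cum] cum_memory_scale])
  then have "(\<lambda>n. norm_coeff p \<mu> n * \<mu> n * scale n) \<longlonglongrightarrow> C * (\<gamma> + 1) * (1 / (\<gamma> + 1)) powr \<kappa>"
  proof (rule Lim_transform_eventually)
    show "eventually (\<lambda>n. (norm_coeff p \<mu> n * cum_memory \<mu> n powr p) * (real n * \<mu> n / cum_memory \<mu> n)
      * (cum_memory \<mu> n powr \<kappa> * scale n / real n) = norm_coeff p \<mu> n * \<mu> n * scale n) sequentially"
      using eventually_ge_at_top[of 1]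
    proof eventually_elim
      case (elim n)
      have "cum_memory \<mu> n powr p * cum_memory \<mu> n powr \<kappa> = cum_memory \<mu> n"
        using cum_memory_positive[OF elim] by (simp add: powr_add[symmetric] p_kappa)
      then show ?case using elim cum_memory_positive[OF elim] by (simp add: field_simps)
    qed
  qed
  then obtain K where K: "\<And>n. norm (norm_coeff p \<mu> n * \<mu> n * scale n) \<le> K"
    using convergentI convergent_imp_Bseq BseqE by (metis (no_types, lifting))
  have "summable (\<lambda>n. (norm_coeff p \<mu> n * \<mu> n)\<^sup>2)"
  proof (rule summable_comparison_test_ev)
    show "summable (\<lambda>n. K\<^sup>2 * (1 / (scale n)\<^sup>2))"
      by (intro summable_mult summable_inverse_scale_square)
    show "eventually (\<lambda>n. norm ((norm_coeff p \<mu> n * \<mu> n)\<^sup>2) \<le> K\<^sup>2 * (1 / (scale n)\<^sup>2)) sequentially"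
      using eventually_ge_at_top[of 1]
    proof eventually_elim
      case (elim n)
      have "(norm_coeff p \<mu> n * \<mu> n * scale n)\<^sup>2 \<le> K\<^sup>2"
        using power_mono[OF K[of n], of 2] by simp
      then show ?case using scale_pos[OF elim] by (simp add: field_simps power_mult_distrib)
    qed
  qed
  then show ?thesis by (subst summable_Suc_iff)
qed

end
end

lemma sqrt_mult_exp_bound:
  fixes r \<theta> z T :: real
  assumes r: "0 < r" "r \<le> T" and T: "1 \<le> T" and \<theta>: "0 \<le> \<theta>" "\<theta> \<le> 1 / 4" and z: "\<bar>z\<bar> \<le> \<theta> * \<bar>ln r\<bar>"
  shows "\<bar>sqrt r * exp z - sqrt r\<bar> \<le> \<theta> * (4 + T ^ 3)"
proof -
  have "\<bar>exp z - 1\<bar> \<le> \<bar>z\<bar> * exp \<bar>z\<bar>"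
  proof -
    have *: "exp y - 1 \<le> y * exp y" for y :: real
    proof -
      have "(1 - y) * exp y \<le> exp (- y) * exp y"
        using exp_ge_add_one_self[of "- y"] by (intro mult_right_mono) auto
      then show ?thesis by (simp add: exp_minus algebra_simps)
    qed
    show ?thesis
    proof (cases "0 \<le> z")
      case True
      then show ?thesis using *[of z] by simp
    next
      case False
      have "1 - exp z \<le> - z" using exp_ge_add_one_self[of z] by linarith
      also have "\<dots> \<le> - z * exp (- z)" using False by simp
      finally show ?thesis using False by simp
    qed
  qed
  also have "\<dots> \<le> (\<theta> * \<bar>ln r\<bar>) * exp (\<theta> * \<bar>ln r\<bar>)"
    using z by (intro mult_mono) auto
  finally have ez: "\<bar>exp z - 1\<bar> \<le> (\<theta> * \<bar>ln r\<bar>) * exp (\<theta> * \<bar>ln r\<bar>)" .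
  have "sqrt r * exp z - sqrt r = sqrt r * (exp z - 1)" by (simp add: algebra_simps)
  then have "\<bar>sqrt r * exp z - sqrt r\<bar> = sqrt r * \<bar>exp z - 1\<bar>" using r by (simp add: abs_mult)
  also have "\<dots> \<le> sqrt r * ((\<theta> * \<bar>ln r\<bar>) * exp (\<theta> * \<bar>ln r\<bar>))"
    using ez r by (intro mult_left_mono) auto
  finally have *: "\<bar>sqrt r * exp z - sqrt r\<bar> \<le> sqrt r * ((\<theta> * \<bar>ln r\<bar>) * exp (\<theta> * \<bar>ln r\<bar>))" .
  have sq: "sqrt r = exp (ln r / 2)"
    using r by (simp add: powr_half_sqrt[symmetric] powr_def)
  show ?thesis
  proof (cases "r \<le> 1")
    case True
    define v where "v = - ln r"
    have v: "0 \<le> v" using True r by (simp add: v_def)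
    have lnr: "\<bar>ln r\<bar> = v" "ln r / 2 = - (v / 2)" using v by (simp_all add: v_def)
    have ee: "exp (\<theta> * v) * exp (- (v / 2)) = exp (\<theta> * v - v / 2)"
      by (simp only: exp_add[symmetric] diff_conv_add_uminus)
    have "sqrt r * ((\<theta> * \<bar>ln r\<bar>) * exp (\<theta> * \<bar>ln r\<bar>)) = \<theta> * (v * exp (\<theta> * v - v / 2))"
      unfolding sq lnr ee[symmetric] by (simp only: mult_ac)
    also have "\<dots> \<le> \<theta> * 4"
    proof (rule mult_left_mono)
      have "\<theta> * v \<le> 1 / 4 * v" using \<theta> v by (intro mult_right_mono)
      then have "v * exp (\<theta> * v - v / 2) \<le> v * exp (- (v / 4))"
        using v by (intro mult_left_mono) auto
      also have "\<dots> \<le> 4"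
      proof -
        have "v / 4 \<le> exp (v / 4)" using exp_ge_add_one_self[of "v / 4"] by linarith
        then show ?thesis by (simp add: exp_minus field_simps)
      qed
      finally show "v * exp (\<theta> * v - v / 2) \<le> 4" .
    qed fact
    also have "\<dots> \<le> \<theta> * (4 + T ^ 3)" using \<theta> T by (intro mult_left_mono) auto
    finally show ?thesis using * by linarith
  next
    case False
    have ln: "0 \<le> ln r" "ln r \<le> T" using False r ln_le_minus_one[of r] by auto
    have sqrt: "sqrt r \<le> T"
    proof -
      have "sqrt r \<le> r" using False by (simp add: real_le_lsqrt self_le_power power2_eq_square)
      then show ?thesis using r by simp
    qed
    have "exp (\<theta> * ln r) \<le> exp (1 * ln r)" using \<theta> ln by (subst exp_le_cancel_iff, intro mult_right_mono) auto
    then have ex: "exp (\<theta> * ln r) \<le> T" using r by simp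
    have "sqrt r * ((\<theta> * \<bar>ln r\<bar>) * exp (\<theta> * \<bar>ln r\<bar>)) = \<theta> * (sqrt r * ln r * exp (\<theta> * ln r))"
      using ln by simp
    also have "\<dots> \<le> \<theta> * (T * T * T)"
      using \<theta> ln sqrt ex T by (intro mult_left_mono mult_mono) auto
    also have "\<dots> \<le> \<theta> * (4 + T ^ 3)" using \<theta> by (intro mult_left_mono) (auto simp: power3_eq_cube)
    finally show ?thesis using * by linarith
  qed
qed

lemma scale_uniform:
  assumes T: "0 < T" and e: "0 < e"
  shows "eventually (\<lambda>n. \<forall>t\<in>{0..T}. \<bar>scale (nat \<lfloor>real n * t\<rfloor>) / scale n - sqrt t\<bar> \<le> e) sequentially"
proof -
  define T' where "T' = max T 1"
  define \<theta> where "\<theta> = min (1 / 4) (e / (2 * (4 + T' ^ 3)))"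
  define \<kappa> where "\<kappa> = 1 / (2 * (\<gamma> + 1))"
  have kappa: "0 < \<kappa>" using gamma by (simp add: \<kappa>_def)
  have T': "1 \<le> T'" "T \<le> T'" by (auto simp: T'_def)
  have T3: "0 < 4 + T' ^ 3" using T' by (intro add_pos_nonneg) auto
  have theta: "0 < \<theta>" "\<theta> \<le> 1 / 4"
  proof -
    show "0 < \<theta>" using e T3 by (simp add: \<theta>_def)
    show "\<theta> \<le> 1 / 4" unfolding \<theta>_def by (rule min.cobounded1)
  qed
  have half: "e / (2 * q) * q = e / 2" if "q \<noteq> 0" for q using that by simp
  have "\<theta> * (4 + T' ^ 3) \<le> e / (2 * (4 + T' ^ 3)) * (4 + T' ^ 3)"
    using T3 by (intro mult_right_mono) (auto simp: \<theta>_def)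
  also have "e / (2 * (4 + T' ^ 3)) * (4 + T' ^ 3) = e / 2"
    by (rule half) (use T3 in simp)
  finally have theta': "\<theta> * (4 + T' ^ 3) \<le> e / 2" .
  have "0 < \<theta> / \<kappa>" using theta kappa by simp
  from assumption_A_Potter[OF A this] obtain x0 where x0: "x0 \<ge> 1"
    and P: "\<And>x y. x0 \<le> x \<Longrightarrow> x \<le> y \<Longrightarrow> \<bar>ln (l y) - ln (l x)\<bar> \<le> \<theta> / \<kappa> * (ln y - ln x)"
    by blast
  have P': "\<bar>ln (l y) - ln (l x)\<bar> \<le> \<theta> / \<kappa> * \<bar>ln (x / y)\<bar>" if "x0 \<le> x" "x0 \<le> y" for x y
  proof (cases "x \<le> y")
    case True
    then have "ln x \<le> ln y" using that x0 by simp
    then show ?thesis using P[OF that(1) True] that x0 by (simp add: ln_div)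
  next
    case False
    then have "ln y \<le> ln x" using that x0 by simp
    then show ?thesis using P[OF that(2), of x] False that x0 by (simp add: ln_div abs_minus_commute)
  qed
  define N where "N = nat \<lceil>x0\<rceil>"
  define C where "C = Max (scale ` {..N})"
  have C: "scale k \<le> C" if "k \<le> N" for k unfolding C_def using that by (intro Max_ge) auto
  have "(\<lambda>n. sqrt (real (Suc N) / real n)) \<longlonglongrightarrow> 0" by real_asymp
  then have "eventually (\<lambda>n. sqrt (real (Suc N) / real n) < e / 2) sequentially"
    using e by (intro order_tendstoD(2)[of _ 0]) auto
  moreover have "(\<lambda>n. C / scale n) \<longlonglongrightarrow> 0"
    by (rule real_tendsto_divide_at_top[OF tendsto_const scale_at_top])
  then have "eventually (\<lambda>n. C / scale n < e / 2) sequentially"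
    using e by (intro order_tendstoD(2)[of _ 0]) auto
  ultimately show ?thesis using eventually_ge_at_top[of N]
  proof eventually_elim
    case (elim n)
    have n: "x0 \<le> real n" "1 \<le> n" using elim(3) x0 unfolding N_def by linarith+
    have sn: "0 < scale n" using scale_pos[OF n(2)] .
    show ?case
    proof
      fix t assume t: "t \<in> {0..T}"
      define k where "k = nat \<lfloor>real n * t\<rfloor>"
      have k: "real k \<le> real n * t" "real n * t < real k + 1"
        using t by (auto simp: k_def)
      show "\<bar>scale (nat \<lfloor>real n * t\<rfloor>) / scale n - sqrt t\<bar> \<le> e"
        unfolding k_def[symmetric]
      proof (cases "k \<le> N")
        case True
        have upper: "scale k / scale n \<le> C / scale n" using C[OF True] sn by (simp add: divide_right_mono)
        have lower: "0 \<le> scale k / scale n" using scale_nonneg sn by simp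
        have "t \<le> real (Suc N) / real n" using k True n by (simp add: field_simps)
        then have "sqrt t \<le> sqrt (real (Suc N) / real n)" by (rule real_sqrt_le_mono)
        moreover have "0 \<le> sqrt t" using t by simp
        ultimately show "\<bar>scale k / scale n - sqrt t\<bar> \<le> e"
          using elim(1,2) upper lower unfolding abs_le_iff by linarith
      next
        case False
        then have kx: "x0 \<le> real k" "1 \<le> k" using x0 unfolding N_def by linarith+
        define r where "r = real k / real n"
        define z where "z = \<kappa> * (ln (l (real n)) - ln (l (real k)))"
        have r: "0 < r" "r \<le> t" "r \<le> T'" "t \<le> r + real (Suc N) / real n"
        proof -
          show "0 < r" using kx n by (simp add: r_def)
          show "r \<le> t" using k n by (simp add: r_def field_simps)
          then show "r \<le> T'" using t T' by simp
          have "t \<le> (real k + 1) / real n" using k n by (simp add: field_simps)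
          also have "\<dots> \<le> r + real (Suc N) / real n"
            unfolding r_def add_divide_distrib[symmetric] using n by (intro divide_right_mono) auto
          finally show "t \<le> r + real (Suc N) / real n" .
        qed
        have "\<bar>z\<bar> = \<kappa> * \<bar>ln (l (real n)) - ln (l (real k))\<bar>" using kappa by (simp add: z_def abs_mult)
        also have "\<dots> \<le> \<kappa> * (\<theta> / \<kappa> * \<bar>ln r\<bar>)"
          unfolding r_def using P'[OF kx(1) n(1)] kappa by (intro mult_left_mono) auto
        also have "\<dots> = \<theta> * \<bar>ln r\<bar>" using kappa by simp
        finally have z: "\<bar>z\<bar> \<le> \<theta> * \<bar>ln r\<bar>" .
        have "scale k / scale n = sqrt r * exp z"
        proof -
          have "sqrt r = exp ((ln (real k) - ln (real n)) / 2)"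
            using r(1) kx n by (simp add: powr_half_sqrt[symmetric] powr_def r_def ln_div)
          then show ?thesis using kx n unfolding scale_regular \<kappa>_def[symmetric]
            by (simp add: regular_exp z_def exp_diff[symmetric] exp_add[symmetric] algebra_simps
                diff_divide_distrib)
        qed
        then have "\<bar>scale k / scale n - sqrt r\<bar> \<le> e / 2"
          using sqrt_mult_exp_bound[OF r(1,3) T'(1) _ theta(2) z] theta theta' by linarith
        moreover have "sqrt t \<le> sqrt r + sqrt (real (Suc N) / real n)"
          by (rule order.trans[OF real_sqrt_le_mono[OF r(4)] sqrt_add_le_add_sqrt]) (use r in auto)
        moreover have "sqrt r \<le> sqrt t" using r by simp
        ultimately show "\<bar>scale k / scale n - sqrt t\<bar> \<le> e"
          using elim(1) by linarith
      qed
    qed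
  qed
qed

lemma scale_uniform_sequence:
  assumes T: "0 < T"
  obtains \<delta> where "\<delta> \<longlonglongrightarrow> 0"
    "\<And>n t. 0 \<le> t \<Longrightarrow> t \<le> T \<Longrightarrow> \<bar>scale (nat \<lfloor>real n * t\<rfloor>) / scale n - sqrt t\<bar> \<le> \<delta> n"
proof -
  define g where "g n t = \<bar>scale (nat \<lfloor>real n * t\<rfloor>) / scale n - sqrt t\<bar>" for n t
  define \<delta> where "\<delta> n = (SUP t\<in>{0..T}. g n t)" for n
  have bdd: "bdd_above (g n ` {0..T})" for n
  proof (rule bdd_aboveI2)
    fix t assume t: "t \<in> {0..T}"
    define C where "C = Max (scale ` {..nat \<lfloor>real n * T\<rfloor>})"
    have "real n * t \<le> real n * T" using t by (intro mult_left_mono) auto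
    then have "nat \<lfloor>real n * t\<rfloor> \<le> nat \<lfloor>real n * T\<rfloor>" by (intro nat_mono floor_mono)
    then have "scale (nat \<lfloor>real n * t\<rfloor>) \<le> C" unfolding C_def by (intro Max_ge) auto
    then have "scale (nat \<lfloor>real n * t\<rfloor>) / scale n \<le> C / scale n"
      using scale_nonneg by (rule divide_right_mono)
    moreover have "0 \<le> scale (nat \<lfloor>real n * t\<rfloor>) / scale n" by (simp add: scale_nonneg)
    moreover have "0 \<le> sqrt t" "sqrt t \<le> sqrt T" using t by auto
    ultimately show "g n t \<le> C / scale n + sqrt T" unfolding g_def by linarith
  qed
  have upper: "g n t \<le> \<delta> n" if "0 \<le> t" "t \<le> T" for n t
    unfolding \<delta>_def using that by (intro cSUP_upper bdd) auto
  have "\<delta> \<longlonglongrightarrow> 0"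
  proof (rule tendstoI)
    fix e :: real assume "0 < e"
    then have "eventually (\<lambda>n. \<forall>t\<in>{0..T}. g n t \<le> e / 2) sequentially"
      unfolding g_def by (intro scale_uniform T) simp
    then show "eventually (\<lambda>n. dist (\<delta> n) 0 < e) sequentially"
    proof eventually_elim
      case (elim n)
      have "\<delta> n \<le> e / 2" unfolding \<delta>_def using elim T by (intro cSUP_least) auto
      moreover have "0 \<le> g n 0" by (simp add: g_def)
      then have "0 \<le> \<delta> n" using upper[of 0 n] T by simp
      ultimately show ?case using \<open>0 < e\<close> by (simp add: dist_real_def)
    qed
  qed
  from that[OF this upper[unfolded g_def]] show thesis .
qed

end

section \<open>Square-integrable martingales\<close>

definition square_integrable :: "'a measure \<Rightarrow> ('a \<Rightarrow> real) \<Rightarrow> bool" where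
  "square_integrable M f \<longleftrightarrow> f \<in> borel_measurable M \<and> integrable M (\<lambda>x. (f x)\<^sup>2)"

lemma square_integrable_measurable: "square_integrable M f \<Longrightarrow> f \<in> borel_measurable M"
  and square_integrable_square: "square_integrable M f \<Longrightarrow> integrable M (\<lambda>x. (f x)\<^sup>2)"
  by (auto simp: square_integrable_def)

lemma square_integrable_bound:
  assumes "square_integrable M g" "f \<in> borel_measurable M" "\<And>x. x \<in> space M \<Longrightarrow> \<bar>f x\<bar> \<le> \<bar>g x\<bar>"
  shows "square_integrable M f"
  unfolding square_integrable_def
proof
  show "integrable M (\<lambda>x. (f x)\<^sup>2)"
    by (rule Bochner_Integration.integrable_bound[OF square_integrable_square[OF assms(1)]])
      (use assms in \<open>auto simp: abs_le_square_iff[symmetric] intro!: AE_I2\<close>)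
qed fact

lemma square_integrable_mult_integrable:
  assumes "square_integrable M f" "square_integrable M g"
  shows "integrable M (\<lambda>x. f x * g x)"
proof (rule Bochner_Integration.integrable_bound)
  show "integrable M (\<lambda>x. (f x)\<^sup>2 + (g x)\<^sup>2)"
    using assms by (auto simp: square_integrable_def)
  show "(\<lambda>x. f x * g x) \<in> borel_measurable M"
    using assms by (auto simp: square_integrable_def)
  show "AE x in M. norm (f x * g x) \<le> norm ((f x)\<^sup>2 + (g x)\<^sup>2)"
  proof (rule AE_I2)
    fix x
    have "2 * (\<bar>f x\<bar> * \<bar>g x\<bar>) \<le> \<bar>f x\<bar>\<^sup>2 + \<bar>g x\<bar>\<^sup>2"
      using sum_squares_bound[of "\<bar>f x\<bar>" "\<bar>g x\<bar>"] by simp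
    moreover have "0 \<le> \<bar>f x\<bar> * \<bar>g x\<bar>" by simp
    moreover have "norm (f x * g x) = \<bar>f x\<bar> * \<bar>g x\<bar>" "norm ((f x)\<^sup>2 + (g x)\<^sup>2) = \<bar>f x\<bar>\<^sup>2 + \<bar>g x\<bar>\<^sup>2"
      by (simp_all add: abs_mult)
    ultimately show "norm (f x * g x) \<le> norm ((f x)\<^sup>2 + (g x)\<^sup>2)"
      by linarith
  qed
qed

lemma square_integrable_cmult:
  "square_integrable M f \<Longrightarrow> square_integrable M (\<lambda>x. c * f x)"
  by (auto simp: square_integrable_def power_mult_distrib)

lemma square_integrable_add:
  assumes "square_integrable M f" "square_integrable M g"
  shows "square_integrable M (\<lambda>x. f x + g x)"
proof -
  have "integrable M (\<lambda>x. (f x)\<^sup>2 + (g x)\<^sup>2 + 2 * (f x * g x))"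
    using assms square_integrable_mult_integrable[OF assms] by (auto simp: square_integrable_def)
  then show ?thesis using assms
    by (auto simp: square_integrable_def power2_sum mult.assoc)
qed

lemma square_integrable_diff:
  assumes "square_integrable M f" "square_integrable M g"
  shows "square_integrable M (\<lambda>x. f x - g x)"
  using square_integrable_add[OF assms(1) square_integrable_cmult[OF assms(2), of "-1"]] by simp

lemma square_integrable_zero: "square_integrable M (\<lambda>x. 0)"
  by (auto simp: square_integrable_def)

lemma square_integrable_sum:
  "(\<And>i. i \<in> I \<Longrightarrow> square_integrable M (f i)) \<Longrightarrow> square_integrable M (\<lambda>x. \<Sum>i\<in>I. f i x)"
  by (induction I rule: infinite_finite_induct)
    (auto intro: square_integrable_add square_integrable_zero)

lemma square_integrable_abs: "square_integrable M f \<Longrightarrow> square_integrable M (\<lambda>x. \<bar>f x\<bar>)"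
  by (auto simp: square_integrable_def)

lemma expectation_add_square:
  assumes "square_integrable M f" "square_integrable M g"
  shows "(\<integral>x. (f x + g x)\<^sup>2 \<partial>M) = (\<integral>x. (f x)\<^sup>2 \<partial>M) + (\<integral>x. (g x)\<^sup>2 \<partial>M) + 2 * (\<integral>x. f x * g x \<partial>M)"
proof -
  have "(\<integral>x. (f x + g x)\<^sup>2 \<partial>M) = (\<integral>x. (f x)\<^sup>2 + (g x)\<^sup>2 + 2 * (f x * g x) \<partial>M)"
    by (simp add: power2_sum mult.assoc)
  then show ?thesis
    using assms square_integrable_mult_integrable[OF assms] by (simp add: square_integrable_def)
qed

locale martingale_differences = prob_space M for M :: "'a measure" +
  fixes F :: "nat \<Rightarrow> 'a measure" and D :: "nat \<Rightarrow> 'a \<Rightarrow> real"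
  assumes subalg: "\<And>n. subalgebra M (F n)"
    and F_mono: "\<And>n. sets (F n) \<subseteq> sets (F (Suc n))"
    and adapted: "\<And>n. D n \<in> borel_measurable (F (Suc n))"
    and square_integrable: "\<And>n. square_integrable M (D n)"
    and second_moment: "\<And>n. expectation (\<lambda>\<omega>. (D n \<omega>)\<^sup>2) \<le> 1"
    and orthogonal: "\<And>n G. G \<in> borel_measurable (F n) \<Longrightarrow> square_integrable M G \<Longrightarrow>
           expectation (\<lambda>\<omega>. G \<omega> * D n \<omega>) = 0"
begin

definition transform :: "(nat \<Rightarrow> real) \<Rightarrow> nat \<Rightarrow> 'a \<Rightarrow> real" where
  "transform c n \<omega> = (\<Sum>k<n. c k * D k \<omega>)"

lemma F_mono': "m \<le> n \<Longrightarrow> sets (F m) \<subseteq> sets (F n)"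
  by (rule lift_Suc_mono_le[of "\<lambda>n. sets (F n)"]) (use F_mono in auto)

lemma space_F: "space (F n) = space M"
  using subalg by (auto simp: subalgebra_def)

lemma measurable_F_mono: "f \<in> borel_measurable (F m) \<Longrightarrow> m \<le> n \<Longrightarrow> f \<in> borel_measurable (F n)"
  using F_mono'[of m n] by (auto simp: measurable_def space_F)

lemma measurable_F_M: "f \<in> borel_measurable (F m) \<Longrightarrow> f \<in> borel_measurable M"
  using subalg[of m] by (auto simp: measurable_def subalgebra_def)

lemma transform_measurable_F: "transform c n \<in> borel_measurable (F n)"
  unfolding transform_def
  by (intro borel_measurable_sum borel_measurable_times borel_measurable_const
      measurable_F_mono[OF adapted]) auto

lemma transform_measurable [measurable]: "transform c n \<in> borel_measurable M"
  by (rule measurable_F_M[OF transform_measurable_F])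

lemma transform_square_integrable: "square_integrable M (transform c n)"
  unfolding transform_def
  by (intro square_integrable_sum square_integrable_cmult square_integrable)

lemma transform_second_moment: "expectation (\<lambda>\<omega>. (transform c n \<omega>)\<^sup>2) \<le> (\<Sum>k<n. (c k)\<^sup>2)"
proof (induction n)
  case (Suc n)
  have "expectation (\<lambda>\<omega>. (transform c (Suc n) \<omega>)\<^sup>2)
      = expectation (\<lambda>\<omega>. (transform c n \<omega> + c n * D n \<omega>)\<^sup>2)"
    by (simp add: transform_def)
  also have "\<dots> = expectation (\<lambda>\<omega>. (transform c n \<omega>)\<^sup>2) + expectation (\<lambda>\<omega>. (c n * D n \<omega>)\<^sup>2)
      + 2 * expectation (\<lambda>\<omega>. transform c n \<omega> * (c n * D n \<omega>))"
    by (intro expectation_add_square transform_square_integrable square_integrable_cmult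
        square_integrable)
  also have "expectation (\<lambda>\<omega>. transform c n \<omega> * (c n * D n \<omega>))
      = expectation (\<lambda>\<omega>. (c n * transform c n \<omega>) * D n \<omega>)"
    by (simp add: mult_ac)
  also have "\<dots> = 0"
    by (intro orthogonal borel_measurable_times borel_measurable_const transform_measurable_F
        square_integrable_cmult transform_square_integrable)
  also have "expectation (\<lambda>\<omega>. (c n * D n \<omega>)\<^sup>2) = (c n)\<^sup>2 * expectation (\<lambda>\<omega>. (D n \<omega>)\<^sup>2)"
    by (simp add: power_mult_distrib)
  also have "\<dots> \<le> (c n)\<^sup>2" using second_moment[of n] by (simp add: mult_left_le)
  finally show ?case using Suc by simp
qed (simp add: transform_def)

definition max_transform :: "(nat \<Rightarrow> real) \<Rightarrow> nat \<Rightarrow> 'a \<Rightarrow> real" where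
  "max_transform c n \<omega> = Max ((\<lambda>k. \<bar>transform c k \<omega>\<bar>) ` {..n})"

lemma max_transform_Suc:
  "max_transform c (Suc n) \<omega> = max (max_transform c n \<omega>) \<bar>transform c (Suc n) \<omega>\<bar>"
  by (simp add: max_transform_def atMost_Suc max.commute)

lemma max_transform_ge: "k \<le> n \<Longrightarrow> \<bar>transform c k \<omega>\<bar> \<le> max_transform c n \<omega>"
  unfolding max_transform_def by (intro Max_ge) auto

lemma max_transform_nonneg: "0 \<le> max_transform c n \<omega>"
  using max_transform_ge[of 0 n c \<omega>] by simp

lemma max_transform_measurable_F: "max_transform c n \<in> borel_measurable (F n)"
proof (induction n)
  case 0
  have "max_transform c 0 = (\<lambda>\<omega>. \<bar>transform c 0 \<omega>\<bar>)" by (auto simp: max_transform_def)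
  then show ?case by (simp add: transform_def)
next
  case (Suc n)
  have "max_transform c (Suc n) = (\<lambda>\<omega>. max (max_transform c n \<omega>) \<bar>transform c (Suc n) \<omega>\<bar>)"
    by (auto simp: max_transform_Suc)
  moreover have "\<dots> \<in> borel_measurable (F (Suc n))"
    by (intro borel_measurable_max borel_measurable_abs transform_measurable_F
        measurable_F_mono[OF Suc]) auto
  ultimately show ?case by simp
qed

lemma max_transform_measurable [measurable]: "max_transform c n \<in> borel_measurable M"
  by (rule measurable_F_M[OF max_transform_measurable_F])

lemma max_transform_square_integrable: "square_integrable M (max_transform c n)"
proof (rule square_integrable_bound)
  show "square_integrable M (\<lambda>\<omega>. \<Sum>k\<le>n. \<bar>transform c k \<omega>\<bar>)"
    by (intro square_integrable_sum square_integrable_abs transform_square_integrable)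
  show "max_transform c n \<in> borel_measurable M" by simp
  fix \<omega>
  have "max_transform c n \<omega> \<le> (\<Sum>k\<le>n. \<bar>transform c k \<omega>\<bar>)"
    unfolding max_transform_def
    by (intro Max.boundedI) (auto intro: member_le_sum)
  then show "\<bar>max_transform c n \<omega>\<bar> \<le> \<bar>\<Sum>k\<le>n. \<bar>transform c k \<omega>\<bar>\<bar>"
    using max_transform_nonneg[of c n \<omega>] by linarith
qed

text \<open>The sum on the right-hand side is a martingale transform, so it vanishes on taking
  expectations.\<close>

lemma pathwise_Doob:
  "(max_transform c n \<omega>)\<^sup>2 \<le> 4 * (transform c n \<omega>)\<^sup>2
     - 4 * (\<Sum>k<n. (c k * max_transform c k \<omega> * sgn (transform c k \<omega>)) * D k \<omega>)"
proof -
  define h s A where "h n = max_transform c n \<omega>" and "s n = \<bar>transform c n \<omega>\<bar>"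
    and "A n = (\<Sum>k<n. (c k * max_transform c k \<omega> * sgn (transform c k \<omega>)) * D k \<omega>)" for n
  have A: "A n \<le> h n * s n - (h n)\<^sup>2 / 2"
  proof (induction n)
    case 0
    then show ?case by (simp add: A_def h_def max_transform_def transform_def)
  next
    case (Suc n)
    have h0: "0 \<le> h n" by (simp add: h_def max_transform_nonneg)
    have "transform c (Suc n) \<omega> = transform c n \<omega> + c n * D n \<omega>" by (simp add: transform_def)
    then have sg: "sgn (transform c n \<omega>) * (c n * D n \<omega>) \<le> s (Suc n) - s n"
      unfolding s_def by (auto simp: sgn_if)
    have "A (Suc n) = A n + h n * (sgn (transform c n \<omega>) * (c n * D n \<omega>))"
      by (simp add: A_def h_def mult_ac)
    also have "\<dots> \<le> h n * s n - (h n)\<^sup>2 / 2 + h n * (s (Suc n) - s n)"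
      using Suc sg h0 by (intro add_mono mult_left_mono)
    also have "\<dots> = h n * s (Suc n) - (h n)\<^sup>2 / 2" by (simp add: algebra_simps)
    also have "\<dots> \<le> h (Suc n) * s (Suc n) - (h (Suc n))\<^sup>2 / 2"
    proof (cases "s (Suc n) \<le> h n")
      case True
      then have "h (Suc n) = h n" by (simp add: h_def s_def max_transform_Suc)
      then show ?thesis by simp
    next
      case False
      then have eq: "h (Suc n) = s (Suc n)" by (simp add: h_def s_def max_transform_Suc)
      have "0 \<le> (s (Suc n) - h n)\<^sup>2" by simp
      then show ?thesis unfolding eq by (simp add: power2_eq_square algebra_simps)
    qed
    finally show ?case .
  qed
  have "0 \<le> (h n - 2 * s n)\<^sup>2" by simp
  then have "4 * (h n * s n) \<le> (h n)\<^sup>2 + 4 * (s n)\<^sup>2" by (simp add: power2_eq_square algebra_simps)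
  with A have "(h n)\<^sup>2 \<le> 4 * (s n)\<^sup>2 - 4 * A n" by linarith
  then show ?thesis by (simp add: h_def s_def A_def)
qed

theorem Doob_maximal_inequality:
  "expectation (\<lambda>\<omega>. (max_transform c n \<omega>)\<^sup>2) \<le> 4 * (\<Sum>k<n. (c k)\<^sup>2)"
proof -
  define G where "G k \<omega> = c k * max_transform c k \<omega> * sgn (transform c k \<omega>)" for k \<omega>
  have GF: "G k \<in> borel_measurable (F k)" for k
  proof -
    note [measurable] = max_transform_measurable_F transform_measurable_F
    have "sgn \<in> borel_measurable (borel :: real measure)"
      unfolding sgn_if by measurable
    from measurable_compose[OF transform_measurable_F this]
    have [measurable]: "(\<lambda>\<omega>. sgn (transform c k \<omega>)) \<in> borel_measurable (F k)" .
    show ?thesis unfolding G_def by measurable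
  qed
  have G2: "square_integrable M (G k)" for k
  proof (rule square_integrable_bound)
    show "square_integrable M (\<lambda>\<omega>. c k * max_transform c k \<omega>)"
      by (intro square_integrable_cmult max_transform_square_integrable)
    show "G k \<in> borel_measurable M" using measurable_F_M[OF GF] .
    show "\<bar>G k \<omega>\<bar> \<le> \<bar>c k * max_transform c k \<omega>\<bar>" for \<omega>
      by (auto simp: G_def abs_mult abs_sgn_eq)
  qed
  have int: "integrable M (\<lambda>\<omega>. G k \<omega> * D k \<omega>)" for k
    by (intro square_integrable_mult_integrable G2 square_integrable)
  have "expectation (\<lambda>\<omega>. (max_transform c n \<omega>)\<^sup>2)
      \<le> expectation (\<lambda>\<omega>. 4 * (transform c n \<omega>)\<^sup>2 - 4 * (\<Sum>k<n. G k \<omega> * D k \<omega>))"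
  proof (rule integral_mono)
    show "integrable M (\<lambda>\<omega>. 4 * (transform c n \<omega>)\<^sup>2 - 4 * (\<Sum>k<n. G k \<omega> * D k \<omega>))"
      using square_integrable_square[OF transform_square_integrable] int by auto
  qed (use square_integrable_square[OF max_transform_square_integrable] pathwise_Doob
        in \<open>auto simp: G_def\<close>)
  also have "\<dots> = 4 * expectation (\<lambda>\<omega>. (transform c n \<omega>)\<^sup>2)
      - 4 * (\<Sum>k<n. expectation (\<lambda>\<omega>. G k \<omega> * D k \<omega>))"
    using square_integrable_square[OF transform_square_integrable] int by simp
  also have "\<dots> = 4 * expectation (\<lambda>\<omega>. (transform c n \<omega>)\<^sup>2)"
    by (simp add: orthogonal[OF GF G2])
  finally show ?thesis using transform_second_moment[of c n] by simp
qed

lemma transform_tail: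
  assumes "m \<le> n"
  shows "transform (\<lambda>k. if k < m then 0 else c k) n \<omega> = transform c n \<omega> - transform c m \<omega>"
  using assms by (induction n rule: dec_induct) (simp_all add: transform_def)

lemma AE_convergent_transform:
  assumes "summable (\<lambda>k. (c k)\<^sup>2)"
  shows "AE \<omega> in M. convergent (\<lambda>n. transform c n \<omega>)"
proof -
  define c' where "c' m k = (if k < m then 0 else c k)" for m k
  define r where "r m = (\<Sum>k. (c (k + m))\<^sup>2)" for m
  define U where "U m \<omega> = (SUP n. ennreal ((max_transform (c' m) n \<omega>)\<^sup>2))" for m \<omega>
  have U_meas [measurable]: "U m \<in> borel_measurable M" for m
    unfolding U_def by measurable
  have c'_sum: "(\<Sum>k<n. (c' m k)\<^sup>2) \<le> r m" for m n
  proof -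
    have "(\<Sum>k<n. (c' m k)\<^sup>2) \<le> (\<Sum>k<n + m. (c' m k)\<^sup>2)"
      by (intro sum_mono2) auto
    also have "\<dots> = (\<Sum>k<m. (c' m k)\<^sup>2) + (\<Sum>k<n. (c' m (k + m))\<^sup>2)"
      by (induction n) (auto simp: add.commute)
    also have "\<dots> = (\<Sum>k<n. (c (k + m))\<^sup>2)"
      by (simp add: c'_def)
    also have "\<dots> \<le> r m"
      unfolding r_def by (intro sum_le_suminf summable_ignore_initial_segment assms) auto
    finally show ?thesis .
  qed
  have U_le: "(\<integral>\<^sup>+\<omega>. U m \<omega> \<partial>M) \<le> ennreal (4 * r m)" for m
  proof -
    have "incseq (\<lambda>n \<omega>. ennreal ((max_transform (c' m) n \<omega>)\<^sup>2))"
    proof (rule incseq_SucI, rule le_funI)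
      fix n \<omega>
      show "ennreal ((max_transform (c' m) n \<omega>)\<^sup>2) \<le> ennreal ((max_transform (c' m) (Suc n) \<omega>)\<^sup>2)"
        by (intro ennreal_leI power_mono max_transform_nonneg) (simp add: max_transform_Suc)
    qed
    then have "(\<integral>\<^sup>+\<omega>. U m \<omega> \<partial>M) = (SUP n. \<integral>\<^sup>+\<omega>. ennreal ((max_transform (c' m) n \<omega>)\<^sup>2) \<partial>M)"
      unfolding U_def by (intro nn_integral_monotone_convergence_SUP) auto
    also have "\<dots> \<le> ennreal (4 * r m)"
    proof (rule SUP_least)
      fix n
      have "(\<integral>\<^sup>+\<omega>. ennreal ((max_transform (c' m) n \<omega>)\<^sup>2) \<partial>M)
          = ennreal (expectation (\<lambda>\<omega>. (max_transform (c' m) n \<omega>)\<^sup>2))"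
        by (intro nn_integral_eq_integral square_integrable_square max_transform_square_integrable) auto
      also have "\<dots> \<le> ennreal (4 * r m)"
        by (intro ennreal_leI order.trans[OF Doob_maximal_inequality] mult_left_mono c'_sum) simp
      finally show "(\<integral>\<^sup>+\<omega>. ennreal ((max_transform (c' m) n \<omega>)\<^sup>2) \<partial>M) \<le> ennreal (4 * r m)" .
    qed
    finally show ?thesis .
  qed
  have r0: "r \<longlonglongrightarrow> 0"
    unfolding r_def using suminf_exist_split2[OF assms] .
  have "(\<integral>\<^sup>+\<omega>. (INF m. U m \<omega>) \<partial>M) \<le> ennreal (4 * r m)" for m
    by (rule order.trans[OF nn_integral_mono U_le[of m]]) (auto intro: INF_lower)
  then have "(\<integral>\<^sup>+\<omega>. (INF m. U m \<omega>) \<partial>M) \<le> ennreal (4 * 0)"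
    by (intro tendsto_lowerbound[OF tendsto_ennrealI[OF tendsto_mult_left[OF r0, of 4]]]) auto
  then have "AE \<omega> in M. (INF m. U m \<omega>) = 0"
    by (subst nn_integral_0_iff_AE[symmetric]) auto
  then show ?thesis
  proof eventually_elim
    case (elim \<omega>)
    have "Cauchy (\<lambda>n. transform c n \<omega>)"
    proof (rule metric_CauchyI)
      fix e :: real assume e: "0 < e"
      have "(INF m. U m \<omega>) < ennreal ((e / 2)\<^sup>2)" using elim e by simp
      then obtain m where m: "U m \<omega> < ennreal ((e / 2)\<^sup>2)" by (auto simp: INF_less_iff)
      have close: "\<bar>transform c n \<omega> - transform c m \<omega>\<bar> < e / 2" if "m \<le> n" for n
      proof -
        have "ennreal ((max_transform (c' m) n \<omega>)\<^sup>2) < ennreal ((e / 2)\<^sup>2)"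
          using m by (rule le_less_trans[rotated]) (auto simp: U_def intro: SUP_upper)
        then have "(max_transform (c' m) n \<omega>)\<^sup>2 < (e / 2)\<^sup>2"
          by (simp add: ennreal_less_iff)
        then have "max_transform (c' m) n \<omega> < e / 2"
          by (rule power2_less_imp_less) (use e in simp)
        moreover have "\<bar>transform (c' m) n \<omega>\<bar> \<le> max_transform (c' m) n \<omega>"
          by (rule max_transform_ge) simp
        ultimately show ?thesis using transform_tail[OF that, of c \<omega>]
          unfolding c'_def by linarith
      qed
      show "\<exists>N. \<forall>i\<ge>N. \<forall>j\<ge>N. dist (transform c i \<omega>) (transform c j \<omega>) < e"
      proof (intro exI[of _ m] allI impI)
        fix i j assume "m \<le> i" "m \<le> j"
        from close[OF this(1)] close[OF this(2)]
        show "dist (transform c i \<omega>) (transform c j \<omega>) < e"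
          unfolding dist_real_def by linarith
      qed
    qed
    then show ?case by (simp add: Cauchy_convergent)
  qed
qed

theorem L2_convergence:
  assumes "summable (\<lambda>k. (c k)\<^sup>2)"
  obtains L where "square_integrable M L" "AE \<omega> in M. (\<lambda>n. transform c n \<omega>) \<longlonglongrightarrow> L \<omega>"
    "(\<lambda>n. expectation (\<lambda>\<omega>. (transform c n \<omega> - L \<omega>)\<^sup>2)) \<longlonglongrightarrow> 0"
proof -
  define L where "L \<omega> = lim (\<lambda>n. transform c n \<omega>)" for \<omega>
  define r where "r m = (\<Sum>k. (c (k + m))\<^sup>2)" for m
  have L_meas [measurable]: "L \<in> borel_measurable M"
    unfolding L_def by measurable
  have AE: "AE \<omega> in M. (\<lambda>n. transform c n \<omega>) \<longlonglongrightarrow> L \<omega>"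
    using AE_convergent_transform[OF assms]
    by eventually_elim (simp add: L_def convergent_LIMSEQ_iff)
  have r0: "r \<longlonglongrightarrow> 0"
    unfolding r_def using suminf_exist_split2[OF assms] .
  have rnn: "r n \<ge> 0" for n unfolding r_def
    by (intro suminf_nonneg summable_ignore_initial_segment assms) auto
  have diff: "expectation (\<lambda>\<omega>. (transform c (n + k) \<omega> - transform c n \<omega>)\<^sup>2) \<le> r n" for n k
  proof -
    let ?c = "\<lambda>k. if k < n then 0 else c k"
    have "expectation (\<lambda>\<omega>. (transform c (n + k) \<omega> - transform c n \<omega>)\<^sup>2)
        = expectation (\<lambda>\<omega>. (transform ?c (n + k) \<omega>)\<^sup>2)"
      by (simp add: transform_tail)
    also have "\<dots> \<le> (\<Sum>j<n + k. (?c j)\<^sup>2)" by (rule transform_second_moment)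
    also have "\<dots> = (\<Sum>j<k. (c (j + n))\<^sup>2)"
      by (induction k) (auto simp: add.commute)
    also have "\<dots> \<le> r n"
      unfolding r_def by (intro sum_le_suminf summable_ignore_initial_segment assms) auto
    finally show ?thesis .
  qed
  have nn: "(\<integral>\<^sup>+\<omega>. ennreal ((transform c n \<omega> - L \<omega>)\<^sup>2) \<partial>M) \<le> ennreal (r n)" for n
  proof -
    have "(\<integral>\<^sup>+\<omega>. ennreal ((transform c n \<omega> - L \<omega>)\<^sup>2) \<partial>M)
        = (\<integral>\<^sup>+\<omega>. liminf (\<lambda>k. ennreal ((transform c (n + k) \<omega> - transform c n \<omega>)\<^sup>2)) \<partial>M)"
    proof (rule nn_integral_cong_AE)
      show "AE \<omega> in M. ennreal ((transform c n \<omega> - L \<omega>)\<^sup>2)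
          = liminf (\<lambda>k. ennreal ((transform c (n + k) \<omega> - transform c n \<omega>)\<^sup>2))"
        using AE
      proof eventually_elim
        case (elim \<omega>)
        then have "(\<lambda>k. transform c (n + k) \<omega>) \<longlonglongrightarrow> L \<omega>"
          using LIMSEQ_ignore_initial_segment[of "\<lambda>k. transform c k \<omega>" "L \<omega>" n]
          by (simp add: add.commute)
        then have "(\<lambda>k. ennreal ((transform c (n + k) \<omega> - transform c n \<omega>)\<^sup>2))
            \<longlonglongrightarrow> ennreal ((L \<omega> - transform c n \<omega>)\<^sup>2)"
          by (intro tendsto_intros)
        from lim_imp_Liminf[OF _ this] show ?case
          by (simp add: power2_commute)
      qed
    qed
    also have "\<dots> \<le> liminf (\<lambda>k. \<integral>\<^sup>+\<omega>. ennreal ((transform c (n + k) \<omega> - transform c n \<omega>)\<^sup>2) \<partial>M)"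
      by (rule nn_integral_liminf) measurable
    also have "\<dots> \<le> ennreal (r n)"
    proof (rule Liminf_le)
      show "\<forall>\<^sub>F k in sequentially. (\<integral>\<^sup>+\<omega>. ennreal ((transform c (n + k) \<omega> - transform c n \<omega>)\<^sup>2) \<partial>M)
          \<le> ennreal (r n)"
      proof (rule always_eventually, rule allI)
        fix k
        have "square_integrable M (\<lambda>\<omega>. transform c (n + k) \<omega> - transform c n \<omega>)"
          by (intro square_integrable_diff transform_square_integrable)
        then have "(\<integral>\<^sup>+\<omega>. ennreal ((transform c (n + k) \<omega> - transform c n \<omega>)\<^sup>2) \<partial>M)
            = ennreal (expectation (\<lambda>\<omega>. (transform c (n + k) \<omega> - transform c n \<omega>)\<^sup>2))"
          by (intro nn_integral_eq_integral square_integrable_square) auto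
        then show "(\<integral>\<^sup>+\<omega>. ennreal ((transform c (n + k) \<omega> - transform c n \<omega>)\<^sup>2) \<partial>M) \<le> ennreal (r n)"
          using diff[of n k] by (simp add: ennreal_leI)
      qed
    qed simp
    finally show ?thesis .
  qed
  have sq: "square_integrable M (\<lambda>\<omega>. transform c n \<omega> - L \<omega>)" for n
    unfolding square_integrable_def
  proof
    show "integrable M (\<lambda>\<omega>. (transform c n \<omega> - L \<omega>)\<^sup>2)"
      by (rule integrableI_nonneg) (use nn[of n] in \<open>auto intro: le_less_trans\<close>)
  qed measurable
  have le: "expectation (\<lambda>\<omega>. (transform c n \<omega> - L \<omega>)\<^sup>2) \<le> r n" for n
    using nn[of n] nn_integral_eq_integral[OF square_integrable_square[OF sq[of n]]] rnn by simp
  show thesis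
  proof (rule that[OF _ AE])
    show "square_integrable M L"
      using square_integrable_cmult[OF sq[of 0], of "-1"] by (simp add: transform_def)
    show "(\<lambda>n. expectation (\<lambda>\<omega>. (transform c n \<omega> - L \<omega>)\<^sup>2)) \<longlonglongrightarrow> 0"
      by (rule tendsto_sandwich[OF _ _ tendsto_const r0]) (use le in auto)
  qed
qed

end

section \<open>Independence in the model\<close>

lemma (in prob_space) indep_sets_Sigma:
  assumes K: "finite K"
    and outer: "indep_sets (\<lambda>k. sigma_sets (space M) (\<Union>i\<in>I k. E k i)) K"
    and inner: "\<And>k. k \<in> K \<Longrightarrow> indep_sets (E k) (I k)"
  shows "indep_sets (\<lambda>(k, i). E k i) (Sigma K I)"
proof (rule indep_setsI)
  show "(case x of (k, i) \<Rightarrow> E k i) \<subseteq> events" if "x \<in> Sigma K I" for x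
    using that inner by (auto simp: indep_sets_def)
next
  fix A J
  assume J: "J \<noteq> {}" "J \<subseteq> Sigma K I" "finite J"
    and A: "\<forall>j\<in>J. A j \<in> (case j of (k, i) \<Rightarrow> E k i)"
  define J' where "J' k = {i. (k, i) \<in> J}" for k
  define B where "B k = space M \<inter> (\<Inter>i\<in>J' k. A (k, i))" for k
  have J_eq: "J = Sigma K J'" using J(2) by (auto simp: J'_def)
  have J'_sub: "J' k \<subseteq> I k" if "k \<in> K" for k using J(2) that by (auto simp: J'_def)
  have fin: "finite (J' k)" for k
    unfolding J'_def using J(3) by (rule finite_subset[rotated, OF finite_imageI[of _ snd]]) force
  have AE: "A (k, i) \<in> E k i" if "i \<in> J' k" for k i using A that by (auto simp: J'_def)
  have AE_ev: "A (k, i) \<in> events" if "k \<in> K" "i \<in> J' k" for k i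
    using AE[OF that(2)] inner[OF that(1)] J'_sub[OF that(1)] that(2)
    by (auto simp: indep_sets_def)
  have K_ne: "K \<noteq> {}" using J by auto
  have E_Pow: "(\<Union>i\<in>I k. E k i) \<subseteq> Pow (space M)" if "k \<in> K" for k
    proof (rule UN_least)
    fix i assume "i \<in> I k"
    then have "E k i \<subseteq> events" using inner[OF that] by (simp add: indep_sets_def)
    then show "E k i \<subseteq> Pow (space M)" using sets.space_closed[of M] by (rule order.trans)
  qed
  have B_in: "B k \<in> sigma_sets (space M) (\<Union>i\<in>I k. E k i)" if k: "k \<in> K" for k
  proof -
    interpret S: sigma_algebra "space M" "sigma_sets (space M) (\<Union>i\<in>I k. E k i)"
      by (rule sigma_algebra_sigma_sets[OF E_Pow[OF k]])
    show ?thesis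
    proof (cases "J' k = {}")
      case False
      have "(\<Inter>i\<in>J' k. A (k, i)) \<in> sigma_sets (space M) (\<Union>i\<in>I k. E k i)"
        by (rule S.finite_INT[OF fin False]) (use AE J'_sub[OF k] in \<open>blast intro: sigma_sets.Basic\<close>)
      then show ?thesis unfolding B_def by (rule S.Int[OF S.top])
    qed (simp add: B_def S.top)
  qed
  have prob_B: "prob (B k) = (\<Prod>i\<in>J' k. prob (A (k, i)))" if k: "k \<in> K" for k
  proof (cases "J' k = {}")
    case True
    then show ?thesis by (simp add: B_def prob_space)
  next
    case False
    have "B k = (\<Inter>i\<in>J' k. A (k, i))"
      using False AE_ev[OF k] sets.sets_into_space unfolding B_def by blast
    then show ?thesis
      using indep_setsD[OF inner[OF k] J'_sub[OF k] False fin, of "\<lambda>i. A (k, i)"] AE by simp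
  qed
  have "(\<Inter>j\<in>J. A j) = (\<Inter>k\<in>K. B k)"
  proof
    show "(\<Inter>j\<in>J. A j) \<subseteq> (\<Inter>k\<in>K. B k)"
    proof -
      obtain k i where "k \<in> K" "i \<in> J' k" using J(1) J_eq by auto
      then have "(\<Inter>j\<in>J. A j) \<subseteq> space M"
        using AE_ev[of k i] sets.sets_into_space[of "A (k, i)"] by (auto simp: J'_def)
      then show ?thesis by (auto simp: B_def J'_def)
    qed
    show "(\<Inter>k\<in>K. B k) \<subseteq> (\<Inter>j\<in>J. A j)"
      by (auto simp: J_eq B_def)
  qed
  then have "prob (\<Inter>j\<in>J. A j) = (\<Prod>k\<in>K. prob (B k))"
    using indep_setsD[OF outer order.refl K_ne K, of B] B_in by simp
  also have "\<dots> = (\<Prod>k\<in>K. \<Prod>i\<in>J' k. prob (A (k, i)))"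
    by (simp add: prob_B)
  also have "\<dots> = (\<Prod>j\<in>J. prob (A j))"
    unfolding J_eq by (subst prod.Sigma) (auto simp: K fin)
  finally show "prob (\<Inter>j\<in>J. A j) = (\<Prod>j\<in>J. prob (A j))" .
qed

lemma Int_stable_vimage: "Int_stable {Y -` A \<inter> S |A. A \<in> sets N}"
proof (unfold Int_stable_def, safe)
  fix A B assume "A \<in> sets N" "B \<in> sets N"
  then show "\<exists>C. Y -` A \<inter> S \<inter> (Y -` B \<inter> S) = Y -` C \<inter> S \<and> C \<in> sets N"
    by (intro exI[of _ "A \<inter> B"]) auto
qed

context srrw_rvm
begin

definition source_events :: "nat \<Rightarrow> nat \<Rightarrow> 'a set set" where
  "source_events j i = (if j = 0 then {\<xi> i -` A \<inter> space M | A. A \<in> sets borel}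
     else if j = 1 then {\<epsilon> i -` A \<inter> space M | A. A \<in> sets (count_space UNIV)}
     else {\<beta> i -` A \<inter> space M | A. A \<in> sets (count_space {1..i-1})})"

definition source_times :: "nat \<Rightarrow> nat set" where
  "source_times j = (if j = 0 then {1..} else {2..})"

definition past :: "nat \<Rightarrow> (nat \<times> nat) set" where
  "past n = Sigma {..<3} (\<lambda>j. {i\<in>source_times j. i \<le> n})"

definition filt :: "nat \<Rightarrow> 'a measure" where
  "filt n = sigma (space M) (\<Union>(j, i)\<in>past n. source_events j i)"

lemma less_3_cases: "j < 3 \<Longrightarrow> j = 0 \<or> j = 1 \<or> j = (2::nat)"
  by auto

lemma source_events_indep_each: "j < 3 \<Longrightarrow> indep_sets (source_events j) (source_times j)"
proof (drule less_3_cases, elim disjE)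
  show "indep_sets (source_events j) (source_times j)" if "j = 0"
    using innovation_indep
    by (simp only: that source_events_def[abs_def] source_times_def indep_vars_def2 if_True refl)
  show "indep_sets (source_events j) (source_times j)" if "j = 1"
    using bernoulli_indep
    by (simp only: that source_events_def[abs_def] source_times_def indep_vars_def2 if_True if_False refl
        one_neq_zero)
  show "indep_sets (source_events j) (source_times j)" if "j = 2"
  proof -
    have "j \<noteq> 0" "j \<noteq> 1" using that by auto
    then show ?thesis using recall_indep
      by (simp only: source_events_def[abs_def] source_times_def indep_vars_def2 if_False)
  qed
qed

lemma source_events_sets: "j < 3 \<Longrightarrow> i \<in> source_times j \<Longrightarrow> source_events j i \<subseteq> events"
  using source_events_indep_each[of j] by (simp add: indep_sets_def)

lemma source_events_Pow: "source_events j i \<subseteq> Pow (space M)"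
  by (auto simp: source_events_def)

lemma source_events_Int_stable: "Int_stable (source_events j i)"
  unfolding source_events_def by (simp only: Int_stable_vimage split: if_split) simp

lemma source_events_indep: "indep_sets (\<lambda>(j, i). source_events j i) (Sigma {..<3} source_times)"
proof (rule indep_sets_Sigma)
  have "seq_sigma M {1..} (\<lambda>_. borel) \<xi> = sigma_sets (space M) (\<Union>i\<in>source_times 0. source_events 0 i)"
    "seq_sigma M {2..} (\<lambda>_. count_space UNIV) \<epsilon> = sigma_sets (space M) (\<Union>i\<in>source_times 1. source_events 1 i)"
    "seq_sigma M {2..} (\<lambda>n. count_space {1..n-1}) \<beta> = sigma_sets (space M) (\<Union>i\<in>source_times 2. source_events 2 i)"
    by (simp_all add: seq_sigma_def source_events_def source_times_def)
  then have "[seq_sigma M {1..} (\<lambda>_. borel) \<xi>,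
                        seq_sigma M {2..} (\<lambda>_. count_space UNIV) \<epsilon>,
                        seq_sigma M {2..} (\<lambda>n. count_space {1..n-1}) \<beta>] ! j
      = sigma_sets (space M) (\<Union>i\<in>source_times j. source_events j i)" if "j < 3" for j
    using less_3_cases[OF that] by (elim disjE) (simp_all only: nth_Cons_0 nth_Cons_Suc One_nat_def numeral_2_eq_2)
  then show "indep_sets (\<lambda>j. sigma_sets (space M) (\<Union>i\<in>source_times j. source_events j i)) {..<3}"
    using sequences_indep by (subst indep_sets_cong[OF refl, symmetric]) auto
  show "indep_sets (source_events j) (source_times j)" if "j \<in> {..<3}" for j
    using source_events_indep_each that by simp
qed simp

lemma space_filt: "space (filt n) = space M"
  by (simp add: filt_def space_measure_of_conv)

lemma sets_filt: "sets (filt n) = sigma_sets (space M) (\<Union>(j, i)\<in>past n. source_events j i)"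
  unfolding filt_def using source_events_Pow by (intro sets_measure_of) blast

lemma filt_subalgebra: "subalgebra M (filt n)"
  unfolding subalgebra_def
proof
  show "sets (filt n) \<subseteq> events"
    unfolding sets_filt using source_events_sets
    by (intro sets.sigma_sets_subset) (fastforce simp: past_def)
qed (rule space_filt)

lemma filt_mono: "m \<le> n \<Longrightarrow> sets (filt m) \<subseteq> sets (filt n)"
  unfolding sets_filt by (intro sigma_sets_mono' UN_mono) (auto simp: past_def)

lemma measurable_filt_mono: "f \<in> measurable (filt m) N \<Longrightarrow> m \<le> n \<Longrightarrow> f \<in> measurable (filt n) N"
  using filt_mono[of m n] by (auto simp: measurable_def space_filt)

lemma measurable_filtD: "f \<in> measurable (filt n) N \<Longrightarrow> f \<in> measurable M N"
  using filt_subalgebra[of n] by (auto simp: measurable_def subalgebra_def)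

definition present :: "nat \<Rightarrow> nat \<Rightarrow> 'a measure" where
  "present n j = sigma (space M) (source_events j n)"

lemma
  shows xi_present: "\<xi> n \<in> borel_measurable (present n 0)"
    and eps_present: "\<epsilon> n \<in> measurable (present n 1) (count_space UNIV)"
    and beta_present: "2 \<le> n \<Longrightarrow> \<beta> n \<in> measurable (present n 2) (count_space {1..n-1})"
proof -
  have sp: "space (present n j) = space M" "source_events j n \<subseteq> sets (present n j)" for j
    using source_events_Pow by (auto simp: present_def)
  show "\<xi> n \<in> borel_measurable (present n 0)"
    by (rule measurableI) (use sp[of 0] in \<open>auto simp: source_events_def\<close>)
  show "\<epsilon> n \<in> measurable (present n 1) (count_space UNIV)"
    by (rule measurableI) (use sp[of 1] in \<open>auto simp: source_events_def\<close>)
  assume "2 \<le> n"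
  then have "\<beta> n \<in> measurable M (count_space {1..n-1})"
    using recall_indep by (auto simp: indep_vars_def2)
  note space = measurable_space[OF this]
  show "\<beta> n \<in> measurable (present n 2) (count_space {1..n-1})"
  proof (rule measurableI)
    fix A assume "A \<in> sets (count_space {1..n-1})"
    then have "\<beta> n -` A \<inter> space M \<in> source_events 2 n"
      unfolding source_events_def by auto
    then show "\<beta> n -` A \<inter> space (present n 2) \<in> sets (present n 2)" using sp[of 2] by auto
  qed (use space sp[of 2] in auto)
qed

lemma present_sub_filt:
  assumes "f \<in> measurable (present i j) N" "j < 3" "i \<in> source_times j" "i \<le> n"
  shows "f \<in> measurable (filt n) N"
proof -
  have "sets (present i j) = sigma_sets (space M) (source_events j i)"
    unfolding present_def using source_events_Pow by (intro sets_measure_of)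
  also have "\<dots> \<subseteq> sets (filt n)"
    unfolding sets_filt using assms by (intro sigma_sets_mono') (force simp: past_def)
  finally show ?thesis using assms(1)
    by (auto simp: measurable_def space_filt present_def space_measure_of_conv)
qed

lemma xi_filt: "1 \<le> i \<Longrightarrow> i \<le> n \<Longrightarrow> \<xi> i \<in> borel_measurable (filt n)"
  by (rule present_sub_filt[OF xi_present]) (auto simp: source_times_def)

lemma eps_filt: "2 \<le> i \<Longrightarrow> i \<le> n \<Longrightarrow> \<epsilon> i \<in> measurable (filt n) (count_space UNIV)"
  by (rule present_sub_filt[OF eps_present]) (auto simp: source_times_def)

lemma beta_filt: "2 \<le> i \<Longrightarrow> i \<le> n \<Longrightarrow> \<beta> i \<in> measurable (filt n) (count_space {1..i-1})"
  by (rule present_sub_filt[OF beta_present]) (auto simp: source_times_def)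

lemma beta_range: "1 \<le> n \<Longrightarrow> \<omega> \<in> space M \<Longrightarrow> \<beta> (Suc n) \<omega> \<in> {1..n}"
  using measurable_space[OF beta_filt[of "Suc n" "Suc n"]] by (simp add: space_filt)

text \<open>The past of time \<open>n\<close> has index 0; the sources \<open>\<xi>\<close>, \<open>\<epsilon>\<close>, \<open>\<beta>\<close> of time
  \<open>n + 1\<close> have the indices 1, 2, 3, of which the last two are absent if \<open>n = 0\<close>.\<close>

lemma indep_vars_past_present:
  assumes g0: "g 0 \<in> borel_measurable (filt n)"
    and g: "\<And>j. j < 3 \<Longrightarrow> Suc n \<in> source_times j \<Longrightarrow> g (Suc j) \<in> borel_measurable (present (Suc n) j)"
  shows "indep_vars (\<lambda>_. borel) g (insert 0 (Suc ` {j. j < 3 \<and> Suc n \<in> source_times j}))"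
proof -
  define L where "L j = (case j of 0 \<Rightarrow> past n | Suc j \<Rightarrow> {(j, Suc n)})" for j
  define K where "K = insert 0 (Suc ` {j. j < 3 \<and> Suc n \<in> source_times j})"
  define E where "E = (\<lambda>(j, i). source_events j i)"
  have "indep_sets (\<lambda>j. sigma_sets (space M) (\<Union>x\<in>L j. E x)) K"
  proof (rule indep_sets_collect_sigma)
    show "indep_sets E (\<Union>j\<in>K. L j)" unfolding E_def
      by (rule indep_sets_mono_index[OF _ source_events_indep]) (auto simp: K_def L_def past_def)
    show "Int_stable (E i)" for i by (cases i) (simp add: E_def source_events_Int_stable)
    show "disjoint_family_on L K"
      by (auto simp: disjoint_family_on_def L_def past_def split: nat.splits)
  qed
  moreover have "g j \<in> borel_measurable M \<and>
      {g j -` A \<inter> space M |A. A \<in> sets borel} \<subseteq> sigma_sets (space M) (\<Union>x\<in>L j. E x)" if "j \<in> K" for j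
  proof (cases j)
    case 0
    have "g 0 -` A \<inter> space M \<in> sets (filt n)" if "A \<in> sets borel" for A
      using measurable_sets[OF g0 that] by (simp add: space_filt)
    then show ?thesis using measurable_filtD[OF g0]
      by (auto simp: 0 L_def E_def sets_filt)
  next
    case (Suc i)
    then have i: "i < 3" "Suc n \<in> source_times i" using that by (auto simp: K_def)
    have "sets (present (Suc n) i) = sigma_sets (space M) (source_events i (Suc n))"
      unfolding present_def using source_events_Pow by (intro sets_measure_of)
    moreover have "g j -` A \<inter> space M \<in> sets (present (Suc n) i)" if "A \<in> sets borel" for A
      using measurable_sets[OF g[OF i] that] by (simp add: Suc present_def space_measure_of_conv)
    moreover have "g j \<in> borel_measurable M" unfolding Suc
      by (rule measurable_filtD[OF present_sub_filt[OF g[OF i] i order.refl]])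
    ultimately show ?thesis by (auto simp: Suc L_def E_def)
  qed
  ultimately show ?thesis unfolding indep_vars_def2 K_def[symmetric]
    by (blast intro: indep_sets_mono_sets)
qed

end

context srrw_rvm
begin

lemma xi_measurable: "1 \<le> n \<Longrightarrow> \<xi> n \<in> borel_measurable M"
  by (rule measurable_filtD[OF xi_filt[OF _ order.refl]])

lemma eps_measurable: "2 \<le> n \<Longrightarrow> \<epsilon> n \<in> measurable M (count_space UNIV)"
  by (rule measurable_filtD[OF eps_filt[OF _ order.refl]])

lemma beta_measurable: "2 \<le> n \<Longrightarrow> \<beta> n \<in> measurable M (count_space {1..n-1})"
  by (rule measurable_filtD[OF beta_filt[OF _ order.refl]])

lemma X_step:
  fixes \<phi> :: "real \<Rightarrow> real"
  assumes n: "1 \<le> n" and \<omega>: "\<omega> \<in> space M"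
  shows "\<phi> (X (Suc n) \<omega>) = (\<Sum>k=1..n. of_bool (\<epsilon> (Suc n) \<omega>) * of_bool (\<beta> (Suc n) \<omega> = k) * \<phi> (X k \<omega>))
           + of_bool (\<not> \<epsilon> (Suc n) \<omega>) * \<phi> (\<xi> (Suc n) \<omega>)"
proof -
  have "(\<Sum>k=1..n. of_bool (\<epsilon> (Suc n) \<omega>) * of_bool (\<beta> (Suc n) \<omega> = k) * \<phi> (X k \<omega>))
      = (\<Sum>k=1..n. if \<beta> (Suc n) \<omega> = k then of_bool (\<epsilon> (Suc n) \<omega>) * \<phi> (X k \<omega>) else 0)"
    by (intro sum.cong) auto
  also have "\<dots> = of_bool (\<epsilon> (Suc n) \<omega>) * \<phi> (X (\<beta> (Suc n) \<omega>) \<omega>)"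
    using beta_range[OF n \<omega>] by (simp add: sum.delta')
  finally show ?thesis using step_Suc[OF n \<omega>] by (cases "\<epsilon> (Suc n) \<omega>") auto
qed

lemma X_filt: "1 \<le> k \<Longrightarrow> k \<le> n \<Longrightarrow> X k \<in> borel_measurable (filt n)"
proof (induction k arbitrary: n rule: less_induct)
  case (less k)
  show ?case
  proof (cases "k = 1")
    case True
    have "X 1 \<in> borel_measurable (filt n) \<longleftrightarrow> \<xi> 1 \<in> borel_measurable (filt n)"
      by (rule measurable_cong) (simp only: space_filt step_one)
    then show ?thesis using True less.prems xi_filt[of 1 n] by simp
  next
    case False
    then obtain m where m: "k = Suc m" "1 \<le> m" using less.prems by (cases k) auto
    have [measurable]: "(\<lambda>\<omega>. of_bool (\<epsilon> k \<omega>) :: real) \<in> borel_measurable (filt n)"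
      "(\<lambda>\<omega>. of_bool (\<not> \<epsilon> k \<omega>) :: real) \<in> borel_measurable (filt n)"
      using measurable_compose[OF eps_filt[of k n], of "of_bool" borel]
        measurable_compose[OF eps_filt[of k n], of "\<lambda>b. of_bool (\<not> b)" borel] m less.prems by auto
    have [measurable]: "(\<lambda>\<omega>. of_bool (\<beta> k \<omega> = j) :: real) \<in> borel_measurable (filt n)" for j
      using measurable_compose[OF beta_filt[of k n], of "\<lambda>i. of_bool (i = j)" borel] m less.prems by auto
    have [measurable]: "\<xi> k \<in> borel_measurable (filt n)" using xi_filt less.prems by simp
    have IH: "X j \<in> borel_measurable (filt n)" if "j \<in> {1..m}" for j
      by (rule less.IH) (use that less.prems m in auto)
    have "X k \<in> borel_measurable (filt n) \<longleftrightarrow>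
      (\<lambda>\<omega>. (\<Sum>j=1..m. of_bool (\<epsilon> k \<omega>) * of_bool (\<beta> k \<omega> = j) * X j \<omega>)
           + of_bool (\<not> \<epsilon> k \<omega>) * \<xi> k \<omega>) \<in> borel_measurable (filt n)"
      by (rule measurable_cong)
        (use X_step[OF m(2), where \<phi> = "\<lambda>x. x"] m(1) in \<open>simp only: space_filt\<close>)
    also have "\<dots>"
      by (intro borel_measurable_add borel_measurable_sum borel_measurable_times IH) measurable
    finally show ?thesis .
  qed
qed

lemma X_measurable: "1 \<le> k \<Longrightarrow> X k \<in> borel_measurable M"
  by (rule measurable_filtD[OF X_filt[OF _ order.refl]])

lemma expectation_eps:
  fixes b :: "bool \<Rightarrow> real"
  assumes "2 \<le> n"
  shows "expectation (\<lambda>\<omega>. b (\<epsilon> n \<omega>)) = b True * p + b False * (1 - p)"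
proof -
  have "expectation (\<lambda>\<omega>. b (\<epsilon> n \<omega>)) = (\<integral>x. b x \<partial>distr M (count_space UNIV) (\<epsilon> n))"
    by (rule integral_distr[symmetric]) (use eps_measurable[OF assms] in auto)
  also have "\<dots> = b True * p + b False * (1 - p)"
    unfolding bernoulli_distr[OF assms] using p_range by (simp add: integral_bernoulli_pmf)
  finally show ?thesis .
qed

lemma expectation_beta:
  assumes "1 \<le> k" "k \<le> n"
  shows "expectation (\<lambda>\<omega>. of_bool (\<beta> (Suc n) \<omega> = k)) = \<mu> k / cum_memory \<mu> n"
proof -
  have "expectation (\<lambda>\<omega>. of_bool (\<beta> (Suc n) \<omega> = k))
      = expectation (indicator {\<omega> \<in> space M. \<beta> (Suc n) \<omega> = k})"
    by (intro Bochner_Integration.integral_cong) (auto simp: indicator_def)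
  also have "\<dots> = prob {\<omega> \<in> space M. \<beta> (Suc n) \<omega> = k}"
    by (simp add: Int_absorb2)
  finally show ?thesis using recall_distr[of "Suc n" k] assms by simp
qed

lemma
  fixes \<phi> :: "real \<Rightarrow> real"
  assumes "1 \<le> n" and \<phi>: "\<phi> \<in> borel_measurable borel"
  shows expectation_xi: "expectation (\<lambda>\<omega>. \<phi> (\<xi> n \<omega>)) = expectation (\<lambda>\<omega>. \<phi> (\<xi> 1 \<omega>))"
    and integrable_xi: "integrable M (\<lambda>\<omega>. \<phi> (\<xi> n \<omega>)) \<longleftrightarrow> integrable M (\<lambda>\<omega>. \<phi> (\<xi> 1 \<omega>))"
proof -
  note ident = innovation_ident[OF assms(1)]
  show "expectation (\<lambda>\<omega>. \<phi> (\<xi> n \<omega>)) = expectation (\<lambda>\<omega>. \<phi> (\<xi> 1 \<omega>))"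
    using integral_distr[OF xi_measurable[OF assms(1)] \<phi>] integral_distr[OF xi_measurable[of 1] \<phi>] ident
    by simp
  show "integrable M (\<lambda>\<omega>. \<phi> (\<xi> n \<omega>)) \<longleftrightarrow> integrable M (\<lambda>\<omega>. \<phi> (\<xi> 1 \<omega>))"
    using integrable_distr_eq[OF xi_measurable[OF assms(1)] \<phi>]
      integrable_distr_eq[OF xi_measurable[of 1] \<phi>] ident by simp
qed

lemma expectation_first:
  fixes a :: "real \<Rightarrow> real"
  assumes G: "G \<in> borel_measurable (filt 0)" "integrable M G"
    and a: "a \<in> borel_measurable borel" "integrable M (\<lambda>\<omega>. a (\<xi> 1 \<omega>))"
  shows "expectation (\<lambda>\<omega>. G \<omega> * a (\<xi> 1 \<omega>)) = expectation G * expectation (\<lambda>\<omega>. a (\<xi> 1 \<omega>))"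
proof -
  define g where "g j = (if j = (0::nat) then G else (\<lambda>\<omega>. a (\<xi> 1 \<omega>)))" for j
  have J: "insert 0 (Suc ` {j. j < 3 \<and> Suc 0 \<in> source_times j}) = {0, 1}"
    by (auto simp: source_times_def split: if_splits)
  have "indep_vars (\<lambda>_. borel) g {0, 1}"
    unfolding J[symmetric]
  proof (rule indep_vars_past_present[where n = 0])
    fix j assume "j < 3" "Suc 0 \<in> source_times j"
    then have "j = 0" by (auto simp: source_times_def split: if_splits)
    then show "g (Suc j) \<in> borel_measurable (present (Suc 0) j)"
      using measurable_compose[OF xi_present a(1)] by (simp add: g_def)
  qed (use G in \<open>simp add: g_def\<close>)
  from indep_vars_lebesgue_integral[OF _ this] show ?thesis
    using G a by (auto simp: g_def)
qed

lemma
  fixes a :: "real \<Rightarrow> real" and b :: "bool \<Rightarrow> real" and c :: "nat \<Rightarrow> real"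
  assumes n: "1 \<le> n"
    and G: "G \<in> borel_measurable (filt n)" "integrable M G"
    and a: "a \<in> borel_measurable borel" "integrable M (\<lambda>\<omega>. a (\<xi> 1 \<omega>))"
    and b: "\<And>x. \<bar>b x\<bar> \<le> 1" and c: "\<And>x. \<bar>c x\<bar> \<le> 1"
  shows expectation_past_present:
      "expectation (\<lambda>\<omega>. G \<omega> * a (\<xi> (Suc n) \<omega>) * b (\<epsilon> (Suc n) \<omega>) * c (\<beta> (Suc n) \<omega>))
       = expectation G * expectation (\<lambda>\<omega>. a (\<xi> 1 \<omega>)) * (b True * p + b False * (1 - p))
         * expectation (\<lambda>\<omega>. c (\<beta> (Suc n) \<omega>))" (is ?E)
    and integrable_past_present:
      "integrable M (\<lambda>\<omega>. G \<omega> * a (\<xi> (Suc n) \<omega>) * b (\<epsilon> (Suc n) \<omega>) * c (\<beta> (Suc n) \<omega>))" (is ?I)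
proof -
  define g where "g j = (if j = (0::nat) then G else if j = 1 then (\<lambda>\<omega>. a (\<xi> (Suc n) \<omega>))
     else if j = 2 then (\<lambda>\<omega>. b (\<epsilon> (Suc n) \<omega>)) else (\<lambda>\<omega>. c (\<beta> (Suc n) \<omega>)))" for j
  have g: "g 0 = G" "g 1 = (\<lambda>\<omega>. a (\<xi> (Suc n) \<omega>))" "g 2 = (\<lambda>\<omega>. b (\<epsilon> (Suc n) \<omega>))"
     "g 3 = (\<lambda>\<omega>. c (\<beta> (Suc n) \<omega>))" by (simp_all add: g_def)
  have times: "Suc n \<in> source_times j" for j using n by (auto simp: source_times_def)
  have J: "insert 0 (Suc ` {j. j < 3 \<and> Suc n \<in> source_times j}) = {0, 1, 2, 3}"
    by (auto simp: times image_iff)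
  have indep: "indep_vars (\<lambda>_. borel) g {0, 1, 2, 3}"
    unfolding J[symmetric]
  proof (rule indep_vars_past_present)
    fix j :: nat assume "j < 3" "Suc n \<in> source_times j"
    have "b \<in> borel_measurable (count_space UNIV)" "c \<in> borel_measurable (count_space {1..Suc n - 1})"
      by auto
    note m = measurable_compose[OF xi_present a(1)] measurable_compose[OF eps_present this(1)]
      measurable_compose[OF beta_present this(2)]
    from less_3_cases[OF \<open>j < 3\<close>] show "g (Suc j) \<in> borel_measurable (present (Suc n) j)"
      using m n by (elim disjE) (simp_all add: g_def)
  qed (use G in \<open>simp add: g_def\<close>)
  have int: "integrable M (g j)" if "j \<in> {0, 1, 2, 3}" for j
  proof -
    have "integrable M (\<lambda>\<omega>. b (\<epsilon> (Suc n) \<omega>))"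
      by (rule integrable_const_bound[of _ 1])
        (use b measurable_compose[OF eps_measurable[of "Suc n"], of b borel] n in auto)
    moreover have "integrable M (\<lambda>\<omega>. c (\<beta> (Suc n) \<omega>))"
      by (rule integrable_const_bound[of _ 1])
        (use c measurable_compose[OF beta_measurable[of "Suc n"], of c borel] n in auto)
    moreover have "integrable M (\<lambda>\<omega>. a (\<xi> (Suc n) \<omega>))"
      using integrable_xi[of "Suc n" a] a by simp
    ultimately show ?thesis using G that g by auto
  qed
  have prod: "(\<Prod>i\<in>{0, 1, 2, 3}. g i \<omega>)
      = G \<omega> * a (\<xi> (Suc n) \<omega>) * b (\<epsilon> (Suc n) \<omega>) * c (\<beta> (Suc n) \<omega>)" for \<omega>
    by (simp add: g_def mult.assoc)
  show ?I using indep_vars_integrable[OF _ indep int] by (simp only: prod finite.intros)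
  have "expectation (\<lambda>\<omega>. \<Prod>i\<in>{0, 1, 2, 3}. g i \<omega>) = (\<Prod>i\<in>{0, 1, 2, 3}. expectation (g i))"
    using indep_vars_lebesgue_integral[OF _ indep int] by simp
  also have "\<dots> = expectation (g 0) * expectation (g 1) * expectation (g 2) * expectation (g 3)"
    by (simp add: mult.assoc)
  finally show ?E unfolding prod g
    using expectation_xi[of "Suc n" a] a(1) expectation_eps[of "Suc n" b] n by simp
qed

lemma
  fixes \<phi> :: "real \<Rightarrow> real"
  assumes n: "1 \<le> n"
    and G: "G \<in> borel_measurable (filt n)" "integrable M G"
    and GX: "\<And>k. k \<in> {1..n} \<Longrightarrow> integrable M (\<lambda>\<omega>. G \<omega> * \<phi> (X k \<omega>))"
    and \<phi>: "\<phi> \<in> borel_measurable borel" "integrable M (\<lambda>\<omega>. \<phi> (\<xi> 1 \<omega>))"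
  shows expectation_step:
      "expectation (\<lambda>\<omega>. G \<omega> * \<phi> (X (Suc n) \<omega>))
       = p * (\<Sum>k=1..n. \<mu> k / cum_memory \<mu> n * expectation (\<lambda>\<omega>. G \<omega> * \<phi> (X k \<omega>)))
         + (1 - p) * (expectation G * expectation (\<lambda>\<omega>. \<phi> (\<xi> 1 \<omega>)))" (is ?E)
    and integrable_step: "integrable M (\<lambda>\<omega>. G \<omega> * \<phi> (X (Suc n) \<omega>))" (is ?I)
proof -
  define u where "u k \<omega> = (G \<omega> * \<phi> (X k \<omega>)) * 1 * of_bool (\<epsilon> (Suc n) \<omega>) * of_bool (\<beta> (Suc n) \<omega> = k)" for k \<omega>
  define v where "v \<omega> = G \<omega> * \<phi> (\<xi> (Suc n) \<omega>) * of_bool (\<not> \<epsilon> (Suc n) \<omega>) * 1" for \<omega>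
  have eq: "G \<omega> * \<phi> (X (Suc n) \<omega>) = (\<Sum>k=1..n. u k \<omega>) + v \<omega>" if "\<omega> \<in> space M" for \<omega>
    unfolding X_step[OF n that] u_def v_def
    by (simp only: distrib_left sum_distrib_left mult_1_right) (simp only: mult_ac)
  have GXm: "(\<lambda>\<omega>. G \<omega> * \<phi> (X k \<omega>)) \<in> borel_measurable (filt n)" if "k \<in> {1..n}" for k
    using that by (intro borel_measurable_times G measurable_compose[OF X_filt \<phi>(1)]) auto
  have u: "integrable M (u k)"
    "expectation (u k) = expectation (\<lambda>\<omega>. G \<omega> * \<phi> (X k \<omega>)) * p * (\<mu> k / cum_memory \<mu> n)" if "k \<in> {1..n}" for k
  proof -
    show "integrable M (u k)" unfolding u_def
      by (rule integrable_past_present[OF n GXm[OF that] GX[OF that], where a = "\<lambda>_. 1"]) auto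
    have "expectation (u k) = expectation (\<lambda>\<omega>. G \<omega> * \<phi> (X k \<omega>)) * expectation (\<lambda>\<omega>. 1)
        * (of_bool True * p + of_bool False * (1 - p)) * expectation (\<lambda>\<omega>. of_bool (\<beta> (Suc n) \<omega> = k))"
      unfolding u_def
      by (rule expectation_past_present[OF n GXm[OF that] GX[OF that], where a = "\<lambda>_. 1"]) auto
    then show "expectation (u k) = expectation (\<lambda>\<omega>. G \<omega> * \<phi> (X k \<omega>)) * p * (\<mu> k / cum_memory \<mu> n)"
      using expectation_beta[of k n] that by (simp add: prob_space)
  qed
  have v: "integrable M v" "expectation v = expectation G * expectation (\<lambda>\<omega>. \<phi> (\<xi> 1 \<omega>)) * (1 - p)"
  proof -
    show "integrable M v" unfolding v_def
      by (rule integrable_past_present[OF n G \<phi>, where b = "\<lambda>b. of_bool (\<not> b)" and c = "\<lambda>_. 1"]) auto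
    have "expectation v = expectation G * expectation (\<lambda>\<omega>. \<phi> (\<xi> 1 \<omega>))
        * (of_bool (\<not> True) * p + of_bool (\<not> False) * (1 - p)) * expectation (\<lambda>\<omega>. 1)"
      unfolding v_def
      by (rule expectation_past_present[OF n G \<phi>, where b = "\<lambda>b. of_bool (\<not> b)" and c = "\<lambda>_. 1"]) auto
    then show "expectation v = expectation G * expectation (\<lambda>\<omega>. \<phi> (\<xi> 1 \<omega>)) * (1 - p)"
      by (simp add: prob_space)
  qed
  show ?I
    using u(1) v(1)
    by (subst Bochner_Integration.integrable_cong[OF refl eq])
      (auto intro!: Bochner_Integration.integrable_add Bochner_Integration.integrable_sum)
  have "expectation (\<lambda>\<omega>. G \<omega> * \<phi> (X (Suc n) \<omega>)) = expectation (\<lambda>\<omega>. (\<Sum>k=1..n. u k \<omega>) + v \<omega>)"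
    by (intro Bochner_Integration.integral_cong eq) auto
  also have "\<dots> = (\<Sum>k=1..n. expectation (u k)) + expectation v"
    using u(1) v(1)
    by (subst Bochner_Integration.integral_add)
      (auto intro!: Bochner_Integration.integral_sum Bochner_Integration.integrable_sum)
  finally show ?E
    by (simp add: u v sum_distrib_left mult_ac)
qed

lemma cum_memory_pos: "1 \<le> n \<Longrightarrow> cum_memory \<mu> n > 0"
  unfolding cum_memory_def by (intro sum_pos) (auto intro: memory_pos)

definition residual :: "nat \<Rightarrow> 'a \<Rightarrow> real" where
  "residual n \<omega> = X (Suc n) \<omega> - p * ((\<Sum>k=1..n. \<mu> k * X k \<omega>) / cum_memory \<mu> n)"

lemma X_second_moment:
  assumes sq: "integrable M (\<lambda>\<omega>. (\<xi> 1 \<omega>)\<^sup>2)" and one: "expectation (\<lambda>\<omega>. (\<xi> 1 \<omega>)\<^sup>2) = 1"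
    and "1 \<le> n"
  shows "integrable M (\<lambda>\<omega>. (X n \<omega>)\<^sup>2) \<and> expectation (\<lambda>\<omega>. (X n \<omega>)\<^sup>2) = 1"
  using \<open>1 \<le> n\<close>
proof (induction n rule: less_induct)
  case (less n)
  show ?case
  proof (cases "n = 1")
    case True
    have "integrable M (\<lambda>\<omega>. (X 1 \<omega>)\<^sup>2) \<longleftrightarrow> integrable M (\<lambda>\<omega>. (\<xi> 1 \<omega>)\<^sup>2)"
      "expectation (\<lambda>\<omega>. (X 1 \<omega>)\<^sup>2) = expectation (\<lambda>\<omega>. (\<xi> 1 \<omega>)\<^sup>2)"
      by (intro Bochner_Integration.integrable_cong Bochner_Integration.integral_cong; simp only: step_one)+
    then show ?thesis using assms True by simp
  next
    case False
    then obtain m where m: "n = Suc m" "1 \<le> m" using less.prems by (cases n) auto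
    have IH: "integrable M (\<lambda>\<omega>. (X k \<omega>)\<^sup>2)" "expectation (\<lambda>\<omega>. (X k \<omega>)\<^sup>2) = 1" if "k \<in> {1..m}" for k
      using less.IH[of k] that m by auto
    have "integrable M (\<lambda>\<omega>. 1 * (X (Suc m) \<omega>)\<^sup>2)"
      by (rule integrable_step[OF m(2)]) (use IH sq in auto)
    moreover have "expectation (\<lambda>\<omega>. 1 * (X (Suc m) \<omega>)\<^sup>2)
       = p * (\<Sum>k=1..m. \<mu> k / cum_memory \<mu> m * expectation (\<lambda>\<omega>. 1 * (X k \<omega>)\<^sup>2))
         + (1 - p) * (expectation (\<lambda>\<omega>. 1) * expectation (\<lambda>\<omega>. (\<xi> 1 \<omega>)\<^sup>2))"
      by (rule expectation_step[OF m(2)]) (use IH sq in auto)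
    moreover have "(\<Sum>k=1..m. \<mu> k / cum_memory \<mu> m) = 1"
      using cum_memory_pos[OF m(2)] by (simp add: sum_divide_distrib[symmetric] cum_memory_def)
    ultimately show ?thesis unfolding m(1) using IH one by (simp add: prob_space)
  qed
qed

theorem martingale_differences_residual:
  assumes sq: "integrable M (\<lambda>\<omega>. (\<xi> 1 \<omega>)\<^sup>2)" and one: "expectation (\<lambda>\<omega>. (\<xi> 1 \<omega>)\<^sup>2) = 1"
  shows "martingale_differences M filt residual"
proof
  have X2: "square_integrable M (X k)" if "1 \<le> k" for k
    unfolding square_integrable_def using X_measurable that X_second_moment[OF sq one] by simp
  define R where "R n \<omega> = p * ((\<Sum>k=1..n. \<mu> k * X k \<omega>) / cum_memory \<mu> n)" for n \<omega>
  have R2: "square_integrable M (R n)" for n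
  proof -
    have "square_integrable M (\<lambda>\<omega>. p / cum_memory \<mu> n * (\<Sum>k=1..n. \<mu> k * X k \<omega>))"
      by (intro square_integrable_cmult square_integrable_sum X2) auto
    then show ?thesis by (simp add: R_def[abs_def])
  qed
  have RF: "R n \<in> borel_measurable (filt n)" for n
    unfolding R_def
    by (intro borel_measurable_times borel_measurable_divide borel_measurable_sum
        borel_measurable_const X_filt) auto
  show sqD: "square_integrable M (residual n)" for n
    using square_integrable_diff[OF X2[of "Suc n"] R2[of n]] by (simp add: residual_def[abs_def] R_def)
  show "subalgebra M (filt n)" for n by (rule filt_subalgebra)
  show "sets (filt n) \<subseteq> sets (filt (Suc n))" for n by (rule filt_mono) simp
  show "residual n \<in> borel_measurable (filt (Suc n))" for n
    using borel_measurable_diff[OF X_filt[of "Suc n" "Suc n"] measurable_filt_mono[OF RF[of n]]]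
    by (simp add: residual_def[abs_def] R_def)
  show orth: "expectation (\<lambda>\<omega>. G \<omega> * residual n \<omega>) = 0"
    if G: "G \<in> borel_measurable (filt n)" and G2: "square_integrable M G" for n G
  proof -
    have "square_integrable M (\<lambda>_. 1)" by (simp add: square_integrable_def)
    from square_integrable_mult_integrable[OF G2 this] have G1: "integrable M G" by simp
    have GX: "integrable M (\<lambda>\<omega>. G \<omega> * X k \<omega>)" if "1 \<le> k" for k
      by (rule square_integrable_mult_integrable[OF G2 X2[OF that]])
    have "expectation (\<lambda>\<omega>. G \<omega> * X (Suc n) \<omega>) = expectation (\<lambda>\<omega>. G \<omega> * R n \<omega>)"
    proof (cases "n = 0")
      case True
      have "expectation (\<lambda>\<omega>. G \<omega> * X 1 \<omega>) = expectation (\<lambda>\<omega>. G \<omega> * \<xi> 1 \<omega>)"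
        by (intro Bochner_Integration.integral_cong) (simp_all only: step_one)
      also have "\<dots> = expectation G * expectation (\<xi> 1)"
        by (rule expectation_first[where a = "\<lambda>x. x"]) (use G G1 innovation_integrable True in auto)
      also have "\<dots> = 0" unfolding innovation_mean by simp
      finally show ?thesis using True by (simp add: R_def)
    next
      case False
      then have n: "1 \<le> n" by simp
      have "expectation (\<lambda>\<omega>. G \<omega> * X (Suc n) \<omega>)
          = p * (\<Sum>k=1..n. \<mu> k / cum_memory \<mu> n * expectation (\<lambda>\<omega>. G \<omega> * X k \<omega>))"
        using expectation_step[OF n G G1, of "\<lambda>x. x"] GX innovation_integrable innovation_mean by simp
      also have "\<dots> = expectation (\<lambda>\<omega>. \<Sum>k=1..n. p * (\<mu> k / cum_memory \<mu> n) * (G \<omega> * X k \<omega>))"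
        using GX by (subst Bochner_Integration.integral_sum) (auto simp: sum_distrib_left mult.assoc)
      also have "\<dots> = expectation (\<lambda>\<omega>. G \<omega> * R n \<omega>)"
        by (simp add: R_def sum_distrib_left sum_divide_distrib mult_ac)
      finally show ?thesis .
    qed
    moreover have "expectation (\<lambda>\<omega>. G \<omega> * residual n \<omega>)
        = expectation (\<lambda>\<omega>. G \<omega> * X (Suc n) \<omega>) - expectation (\<lambda>\<omega>. G \<omega> * R n \<omega>)"
      using GX[of "Suc n"] square_integrable_mult_integrable[OF G2 R2[of n]]
      by (subst Bochner_Integration.integral_diff[symmetric])
        (simp_all add: residual_def R_def right_diff_distrib)
    ultimately show ?thesis by simp
  qed
  show "expectation (\<lambda>\<omega>. (residual n \<omega>)\<^sup>2) \<le> 1" for n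
  proof -
    have "1 = expectation (\<lambda>\<omega>. (R n \<omega> + residual n \<omega>)\<^sup>2)"
      using X_second_moment[OF sq one, of "Suc n"] by (simp add: residual_def R_def)
    also have "\<dots> = expectation (\<lambda>\<omega>. (R n \<omega>)\<^sup>2) + expectation (\<lambda>\<omega>. (residual n \<omega>)\<^sup>2)"
      using expectation_add_square[OF R2[of n] sqD[of n]] orth[OF RF R2, of n] by simp
    finally have "1 = expectation (\<lambda>\<omega>. (R n \<omega>)\<^sup>2) + expectation (\<lambda>\<omega>. (residual n \<omega>)\<^sup>2)" .
    moreover have "0 \<le> expectation (\<lambda>\<omega>. (R n \<omega>)\<^sup>2)"
      by (rule Bochner_Integration.integral_nonneg) simp
    ultimately show ?thesis by linarith
  qed
qed

end

section \<open>Measurability of the uniform distance\<close>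

lemma borel_measurable_sup_dist:
  fixes Y Z :: "'a \<Rightarrow> real \<Rightarrow> real"
  assumes T: "0 < T"
    and Y: "\<And>t. (\<lambda>\<omega>. Y \<omega> t) \<in> borel_measurable M" and Z: "\<And>t. (\<lambda>\<omega>. Z \<omega> t) \<in> borel_measurable M"
    and cont: "\<And>\<omega> t. 0 \<le> t \<Longrightarrow> ((\<lambda>s. Y \<omega> s - Z \<omega> s) \<longlongrightarrow> Y \<omega> t - Z \<omega> t) (at_right t)"
  shows "(\<lambda>\<omega>. sup_dist T (Y \<omega>) (Z \<omega>)) \<in> borel_measurable M"
proof -
  define Q where "Q = insert T (\<rat> \<inter> {0..T})"
  have Q: "countable Q" "Q \<subseteq> {0..T}" using T countable_rat by (auto simp: Q_def)
  have "sup_dist T (Y \<omega>) (Z \<omega>) = (SUP t\<in>Q. ennreal \<bar>Y \<omega> t - Z \<omega> t\<bar>)" (is "_ = ?S") for \<omega>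
  proof (rule antisym)
    show "?S \<le> sup_dist T (Y \<omega>) (Z \<omega>)"
      unfolding sup_dist_def using Q(2) by (intro SUP_subset_mono) auto
    show "sup_dist T (Y \<omega>) (Z \<omega>) \<le> ?S"
      unfolding sup_dist_def
    proof (rule SUP_least, rule ccontr)
      fix t assume t: "t \<in> {0..T}" and "\<not> ennreal \<bar>Y \<omega> t - Z \<omega> t\<bar> \<le> ?S"
      then have less: "?S < ennreal \<bar>Y \<omega> t - Z \<omega> t\<bar>" by simp
      have upper: "ennreal \<bar>Y \<omega> s - Z \<omega> s\<bar> \<le> ?S" if "s \<in> Q" for s using that by (rule SUP_upper)
      have "T \<in> Q" by (simp add: Q_def)
      then have "t \<noteq> T" using leD[OF upper[of T]] less by blast
      then have tT: "t < T" using t by simp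
      have "((\<lambda>s. ennreal \<bar>Y \<omega> s - Z \<omega> s\<bar>) \<longlongrightarrow> ennreal \<bar>Y \<omega> t - Z \<omega> t\<bar>) (at_right t)"
        using t by (intro tendsto_ennrealI tendsto_rabs cont) auto
      from order_tendstoD(1)[OF this less]
      obtain b where b: "t < b" "\<And>s. t < s \<Longrightarrow> s < b \<Longrightarrow> ?S < ennreal \<bar>Y \<omega> s - Z \<omega> s\<bar>"
        by (auto simp: eventually_at_right_field)
      obtain s where s: "s \<in> \<rat>" "t < s" "s < min b T"
        using Rats_dense_in_real[of t "min b T"] b(1) tT by auto
      then have "s \<in> Q" using t by (auto simp: Q_def)
      from upper[OF this] b(2)[of s] s show False by auto
    qed
  qed
  moreover have "(\<lambda>\<omega>. SUP t\<in>Q. ennreal \<bar>Y \<omega> t - Z \<omega> t\<bar>) \<in> borel_measurable M"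
    by (intro borel_measurable_SUP Q(1) measurable_compose[OF _ measurable_ennreal]
        borel_measurable_abs borel_measurable_diff Y Z)
  ultimately show ?thesis by simp
qed

lemma tendsto_at_right_floor:
  fixes f :: "nat \<Rightarrow> real"
  shows "((\<lambda>s. f (nat \<lfloor>real n * s\<rfloor>)) \<longlongrightarrow> f (nat \<lfloor>real n * t\<rfloor>)) (at_right t)"
proof (rule tendsto_eventually)
  have "((\<lambda>s. real n * s) \<longlongrightarrow> real n * t) (at_right t)" by (intro tendsto_intros)
  moreover have "real n * t < of_int (\<lfloor>real n * t\<rfloor> + 1)" by linarith
  ultimately have "eventually (\<lambda>s. real n * s < of_int (\<lfloor>real n * t\<rfloor> + 1)) (at_right t)"
    by (rule order_tendstoD(2))
  moreover have "eventually (\<lambda>s. t < s) (at_right t)" by (rule eventually_at_right_less)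
  ultimately show "eventually (\<lambda>s. f (nat \<lfloor>real n * s\<rfloor>) = f (nat \<lfloor>real n * t\<rfloor>)) (at_right t)"
  proof eventually_elim
    case (elim s)
    have "real n * t \<le> real n * s" using elim by (intro mult_left_mono) auto
    then have "\<lfloor>real n * s\<rfloor> = \<lfloor>real n * t\<rfloor>" using elim by (simp add: floor_eq_iff) linarith
    then show ?case by simp
  qed
qed

section \<open>Convergence of the rescaled walk\<close>

lemma square_sum3_le: "(a + b + c)\<^sup>2 \<le> 3 * (a\<^sup>2 + b\<^sup>2 + c\<^sup>2)" for a b c :: real
proof -
  have "0 \<le> (a - b)\<^sup>2 + (b - c)\<^sup>2 + (a - c)\<^sup>2" by simp
  then show ?thesis by (simp add: power2_eq_square algebra_simps)
qed

lemma nn_integral_square_eq: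
  assumes "square_integrable M f"
  shows "(\<integral>\<^sup>+x. (ennreal \<bar>f x\<bar>)\<^sup>2 \<partial>M) = ennreal (\<integral>x. (f x)\<^sup>2 \<partial>M)"
  using nn_integral_eq_integral[OF square_integrable_square[OF assms]] by (simp add: ennreal_power)

locale critical_srrw = srrw_rvm M \<gamma> p \<mu> \<xi> \<epsilon> \<beta> X + memory_asymptotics \<mu> \<gamma> \<alpha> l
  for M :: "'a measure" and \<gamma> p \<mu> \<xi> \<epsilon> \<beta> X \<alpha> l +
  assumes critical: "p = p_crit \<gamma>" and light_memory: "\<alpha> + \<gamma> + 1 < 0"
    and innovation_square: "integrable M (\<lambda>\<omega>. (\<xi> 1 \<omega>)\<^sup>2)"
    and innovation_second_moment: "expectation (\<lambda>\<omega>. (\<xi> 1 \<omega>)\<^sup>2) = 1"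
begin

sublocale martingale_differences M filt residual
  by (rule martingale_differences_residual[OF innovation_square innovation_second_moment])

definition coeff :: "nat \<Rightarrow> real" where
  "coeff k = norm_coeff p \<mu> (Suc k) * \<mu> (Suc k)"

definition weight :: "nat \<Rightarrow> real" where
  "weight k = p / (norm_coeff p \<mu> k * cum_memory \<mu> k)"

lemma walk_martingale_eq: "walk_martingale p \<mu> X n \<omega> = transform coeff n \<omega>"
proof (induction n)
  case (Suc n)
  define S where "S = (\<Sum>k=Suc 0..n. \<mu> k * X k \<omega>)"
  have "norm_coeff p \<mu> n * S = norm_coeff p \<mu> (Suc n) * (1 + p * (\<mu> (Suc n) / cum_memory \<mu> n)) * S"
  proof (cases "n = 0")
    case False
    have "0 < 1 + p * (\<mu> (Suc n) / cum_memory \<mu> n)"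
      using p_range memory_positive[of "Suc n"] cum_memory_positive[of n] False
      by (intro add_pos_nonneg) auto
    then show ?thesis using norm_coeff_Suc[of n p] False by simp
  qed (simp add: S_def)
  then have "walk_martingale p \<mu> X n \<omega>
      = norm_coeff p \<mu> (Suc n) * (1 + p * (\<mu> (Suc n) / cum_memory \<mu> n)) * S"
    by (simp add: walk_martingale_def S_def)
  then have "walk_martingale p \<mu> X (Suc n) \<omega> = walk_martingale p \<mu> X n \<omega> + coeff n * residual n \<omega>"
    by (simp add: walk_martingale_def coeff_def residual_def S_def[symmetric] algebra_simps)
  then show ?case using Suc by (simp add: transform_def)
qed (simp add: walk_martingale_def transform_def)

lemma walk_decomposition:
  "walk X n \<omega> = transform (\<lambda>_. 1) n \<omega> + (\<Sum>k<n. weight k * walk_martingale p \<mu> X k \<omega>)"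
proof (induction n)
  case (Suc n)
  have "weight n * walk_martingale p \<mu> X n \<omega> = p * ((\<Sum>k=1..n. \<mu> k * X k \<omega>) / cum_memory \<mu> n)"
    using norm_coeff_pos[OF p_range(1), of n] by (simp add: weight_def walk_martingale_def)
  then have "X (Suc n) \<omega> = residual n \<omega> + weight n * walk_martingale p \<mu> X n \<omega>"
    by (simp add: residual_def)
  moreover have "walk X (Suc n) \<omega> = walk X n \<omega> + X (Suc n) \<omega>" by (simp add: walk_def)
  moreover have "transform (\<lambda>_. 1) (Suc n) \<omega> = transform (\<lambda>_. 1) n \<omega> + residual n \<omega>"
    by (simp add: transform_def)
  ultimately show ?case using Suc by simp
qed (simp add: walk_def transform_def)

lemma weight_nonneg: "0 \<le> weight k"
  unfolding weight_def using norm_coeff_pos[OF p_range(1), of k] p_range cum_memory_positive[of k]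
  by (cases "k = 0") (auto simp: cum_memory_def)

lemma summable_coeff: "summable (\<lambda>k. (coeff k)\<^sup>2)"
  unfolding coeff_def by (rule summable_martingale_coeff[OF critical p_range light_memory])

lemma AE_noise_negligible: "AE \<omega> in M. (\<lambda>n. transform (\<lambda>_. 1) n \<omega> / scale n) \<longlonglongrightarrow> 0"
proof -
  have "summable (\<lambda>k. 1 / (scale (Suc k))\<^sup>2)"
    using summable_inverse_scale_square[OF critical p_range light_memory]
    by (subst summable_Suc_iff)
  then have "summable (\<lambda>k. (1 / scale (Suc k))\<^sup>2)" by (simp add: power_divide)
  from AE_convergent_transform[OF this] show ?thesis
  proof eventually_elim
    case (elim \<omega>)
    then have "convergent (\<lambda>n. \<Sum>k<n. residual k \<omega> / scale (Suc k))"
      by (simp add: transform_def)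
    from Kronecker_lemma[OF scale_at_top scale_strict_mono this]
    show ?case using scale_pos by (simp add: transform_def less_imp_neq[symmetric])
  qed
qed

context
  fixes c :: real and L :: "'a \<Rightarrow> real"
  assumes weight_lim: "(\<lambda>n. weight n / (scale (Suc n) - scale n)) \<longlonglongrightarrow> c"
    and L_square: "square_integrable M L"
    and L_AE: "AE \<omega> in M. (\<lambda>n. walk_martingale p \<mu> X n \<omega>) \<longlonglongrightarrow> L \<omega>"
    and L_L2: "(\<lambda>n. expectation (\<lambda>\<omega>. (walk_martingale p \<mu> X n \<omega> - L \<omega>)\<^sup>2)) \<longlonglongrightarrow> 0"
begin

definition deviation :: "nat \<Rightarrow> 'a \<Rightarrow> real" where
  "deviation n \<omega> = Max ((\<lambda>k. \<bar>walk X k \<omega> - c * L \<omega> * scale k\<bar>) ` {..n})"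

lemma AE_deviation: "AE \<omega> in M. (\<lambda>n. deviation n \<omega> / scale n) \<longlonglongrightarrow> 0"
  using AE_noise_negligible L_AE
proof eventually_elim
  case (elim \<omega>)
  have "(\<lambda>n. walk_martingale p \<mu> X n \<omega> * (weight n / (scale (Suc n) - scale n))) \<longlonglongrightarrow> L \<omega> * c"
    by (intro tendsto_mult elim weight_lim)
  then have "(\<lambda>n. weight n * walk_martingale p \<mu> X n \<omega> / (scale (Suc n) - scale n)) \<longlonglongrightarrow> c * L \<omega>"
    by (simp add: mult.commute)
  from tendsto_add[OF elim(1) Stolz_Cesaro_sum[OF scale_at_top scale_strict_mono this]]
  have "(\<lambda>n. walk X n \<omega> / scale n) \<longlonglongrightarrow> c * L \<omega>"
    by (simp add: walk_decomposition add_divide_distrib)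
  from tendsto_diff[OF this tendsto_const[of "c * L \<omega>"]]
  have "(\<lambda>n. walk X n \<omega> / scale n - c * L \<omega>) \<longlonglongrightarrow> 0" by simp
  then have "(\<lambda>n. (walk X n \<omega> - c * L \<omega> * scale n) / scale n) \<longlonglongrightarrow> 0"
  proof (rule Lim_transform_eventually)
    show "eventually (\<lambda>n. walk X n \<omega> / scale n - c * L \<omega>
        = (walk X n \<omega> - c * L \<omega> * scale n) / scale n) sequentially"
      using eventually_ge_at_top[of 1]
    proof eventually_elim
      case (elim n)
      then show ?case using scale_pos[OF elim] by (simp add: field_simps)
    qed
  qed
  from max_abs_over_tendsto_zero[OF scale_at_top scale_strict_mono this]
  show ?case by (simp add: deviation_def)
qed

definition drift_error :: "nat \<Rightarrow> 'a \<Rightarrow> real" where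
  "drift_error n \<omega> = (\<Sum>k<n. weight k * \<bar>walk_martingale p \<mu> X k \<omega> - L \<omega>\<bar>)"

definition scale_error :: "nat \<Rightarrow> real" where
  "scale_error n = Max ((\<lambda>k. \<bar>(\<Sum>j<k. weight j) - c * scale k\<bar>) ` {..n})"

definition dominating :: "nat \<Rightarrow> 'a \<Rightarrow> real" where
  "dominating n \<omega> = max_transform (\<lambda>_. 1) n \<omega> + drift_error n \<omega> + scale_error n * \<bar>L \<omega>\<bar>"

lemma deviation_le_dominating: "deviation n \<omega> \<le> dominating n \<omega>"
  unfolding deviation_def
proof (rule Max.boundedI, goal_cases)
  case (3 a)
  then obtain k where k: "k \<le> n" "a = \<bar>walk X k \<omega> - c * L \<omega> * scale k\<bar>" by auto
  have "(\<Sum>j<k. weight j * walk_martingale p \<mu> X j \<omega>)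
      = (\<Sum>j<k. weight j * (walk_martingale p \<mu> X j \<omega> - L \<omega>)) + (\<Sum>j<k. weight j) * L \<omega>"
    by (simp add: right_diff_distrib sum_subtractf sum_distrib_right)
  then have "walk X k \<omega> - c * L \<omega> * scale k = transform (\<lambda>_. 1) k \<omega>
      + (\<Sum>j<k. weight j * (walk_martingale p \<mu> X j \<omega> - L \<omega>))
      + ((\<Sum>j<k. weight j) - c * scale k) * L \<omega>"
    by (simp add: walk_decomposition algebra_simps)
  then have "a \<le> \<bar>transform (\<lambda>_. 1) k \<omega>\<bar>
      + \<bar>\<Sum>j<k. weight j * (walk_martingale p \<mu> X j \<omega> - L \<omega>)\<bar>
      + \<bar>((\<Sum>j<k. weight j) - c * scale k) * L \<omega>\<bar>" using k by linarith
  also have "\<dots> \<le> dominating n \<omega>"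
    unfolding dominating_def
  proof (intro add_mono max_transform_ge k)
    have "\<bar>\<Sum>j<k. weight j * (walk_martingale p \<mu> X j \<omega> - L \<omega>)\<bar>
        \<le> (\<Sum>j<k. \<bar>weight j * (walk_martingale p \<mu> X j \<omega> - L \<omega>)\<bar>)" by (rule sum_abs)
    also have "\<dots> = (\<Sum>j<k. weight j * \<bar>walk_martingale p \<mu> X j \<omega> - L \<omega>\<bar>)"
      using weight_nonneg by (simp add: abs_mult)
    also have "\<dots> \<le> drift_error n \<omega>" unfolding drift_error_def
      using k weight_nonneg by (intro sum_mono2) auto
    finally show "\<bar>\<Sum>j<k. weight j * (walk_martingale p \<mu> X j \<omega> - L \<omega>)\<bar> \<le> drift_error n \<omega>" .
    have "\<bar>(\<Sum>j<k. weight j) - c * scale k\<bar> \<le> scale_error n"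
      unfolding scale_error_def using k by (intro Max_ge) auto
    then show "\<bar>((\<Sum>j<k. weight j) - c * scale k) * L \<omega>\<bar> \<le> scale_error n * \<bar>L \<omega>\<bar>"
      by (simp add: abs_mult mult_right_mono)
  qed
  finally show ?case .
qed auto

lemma walk_martingale_diff_square: "square_integrable M (\<lambda>\<omega>. walk_martingale p \<mu> X n \<omega> - L \<omega>)"
  unfolding walk_martingale_eq
  by (intro square_integrable_diff transform_square_integrable L_square)

lemma drift_error_square: "square_integrable M (drift_error n)"
  unfolding drift_error_def
  by (intro square_integrable_sum square_integrable_cmult square_integrable_abs
      walk_martingale_diff_square)

lemma dominating_square: "square_integrable M (dominating n)"
  unfolding dominating_def
  by (intro square_integrable_add drift_error_square max_transform_square_integrable
      square_integrable_cmult square_integrable_abs L_square)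

lemma dominating_second_moment: "(\<lambda>n. expectation (\<lambda>\<omega>. (dominating n \<omega>)\<^sup>2) / (scale n)\<^sup>2) \<longlonglongrightarrow> 0"
proof -
  define d where "d k = expectation (\<lambda>\<omega>. (walk_martingale p \<mu> X k \<omega> - L \<omega>)\<^sup>2)" for k
  define r where "r n = (\<Sum>k<n. weight k)" for n
  have r_lim: "(\<lambda>n. r n / scale n) \<longlonglongrightarrow> c"
    unfolding r_def by (rule Stolz_Cesaro_sum[OF scale_at_top scale_strict_mono weight_lim])
  have "(\<lambda>n. weight n / (scale (Suc n) - scale n) * d n) \<longlonglongrightarrow> c * 0"
    unfolding d_def by (intro tendsto_mult weight_lim L_L2)
  then have "(\<lambda>n. (weight n * d n) / (scale (Suc n) - scale n)) \<longlonglongrightarrow> 0" by simp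
  from Stolz_Cesaro_sum[OF scale_at_top scale_strict_mono this]
  have wd_lim: "(\<lambda>n. (\<Sum>k<n. weight k * d k) / scale n) \<longlonglongrightarrow> 0" .
  have "(\<lambda>n. r n / scale n - c) \<longlonglongrightarrow> c - c" by (intro tendsto_diff r_lim tendsto_const)
  then have "(\<lambda>n. r n / scale n - c) \<longlonglongrightarrow> 0" by simp
  then have "(\<lambda>n. (r n - c * scale n) / scale n) \<longlonglongrightarrow> 0"
  proof (rule Lim_transform_eventually)
    show "eventually (\<lambda>n. r n / scale n - c = (r n - c * scale n) / scale n) sequentially"
      using eventually_ge_at_top[of 1]
    proof eventually_elim
      case (elim n)
      then show ?case using scale_pos[OF elim] by (simp add: field_simps)
    qed
  qed
  from max_abs_over_tendsto_zero[OF scale_at_top scale_strict_mono this]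
  have e_lim: "(\<lambda>n. scale_error n / scale n) \<longlonglongrightarrow> 0" by (simp add: scale_error_def r_def)
  have drift: "expectation (\<lambda>\<omega>. (drift_error n \<omega>)\<^sup>2) \<le> r n * (\<Sum>k<n. weight k * d k)" for n
  proof -
    have "expectation (\<lambda>\<omega>. (drift_error n \<omega>)\<^sup>2)
        \<le> expectation (\<lambda>\<omega>. r n * (\<Sum>k<n. weight k * (walk_martingale p \<mu> X k \<omega> - L \<omega>)\<^sup>2))"
    proof (rule integral_mono)
      show "integrable M (\<lambda>\<omega>. (drift_error n \<omega>)\<^sup>2)" by (rule square_integrable_square[OF drift_error_square])
      show "integrable M (\<lambda>\<omega>. r n * (\<Sum>k<n. weight k * (walk_martingale p \<mu> X k \<omega> - L \<omega>)\<^sup>2))"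
        by (intro integrable_mult_right Bochner_Integration.integrable_sum
            square_integrable_square[OF walk_martingale_diff_square])
      fix \<omega>
      have "drift_error n \<omega> = (\<Sum>k<n. sqrt (weight k) * (sqrt (weight k) * \<bar>walk_martingale p \<mu> X k \<omega> - L \<omega>\<bar>))"
        unfolding drift_error_def using weight_nonneg by (simp add: mult.assoc[symmetric])
      then have "(drift_error n \<omega>)\<^sup>2 \<le> (\<Sum>k<n. (sqrt (weight k))\<^sup>2)
          * (\<Sum>k<n. (sqrt (weight k) * \<bar>walk_martingale p \<mu> X k \<omega> - L \<omega>\<bar>)\<^sup>2)"
        by (simp only: Cauchy_Schwarz_ineq_sum)
      then show "(drift_error n \<omega>)\<^sup>2 \<le> r n * (\<Sum>k<n. weight k * (walk_martingale p \<mu> X k \<omega> - L \<omega>)\<^sup>2)"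
        using weight_nonneg by (simp add: r_def power_mult_distrib)
    qed
    also have "\<dots> = r n * (\<Sum>k<n. weight k * d k)"
      unfolding d_def using square_integrable_square[OF walk_martingale_diff_square] by simp
    finally show ?thesis .
  qed
  have bound: "expectation (\<lambda>\<omega>. (dominating n \<omega>)\<^sup>2)
      \<le> 3 * (4 * real n + r n * (\<Sum>k<n. weight k * d k) + (scale_error n)\<^sup>2 * expectation (\<lambda>\<omega>. (L \<omega>)\<^sup>2))" for n
  proof -
    note int = square_integrable_square[OF max_transform_square_integrable]
      square_integrable_square[OF drift_error_square] square_integrable_square[OF L_square]
    have "expectation (\<lambda>\<omega>. (dominating n \<omega>)\<^sup>2) \<le> expectation (\<lambda>\<omega>. 3 * ((max_transform (\<lambda>_. 1) n \<omega>)\<^sup>2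
        + (drift_error n \<omega>)\<^sup>2 + (scale_error n)\<^sup>2 * (L \<omega>)\<^sup>2))"
    proof (rule integral_mono)
      show "integrable M (\<lambda>\<omega>. (dominating n \<omega>)\<^sup>2)" by (rule square_integrable_square[OF dominating_square])
      show "integrable M (\<lambda>\<omega>. 3 * ((max_transform (\<lambda>_. 1) n \<omega>)\<^sup>2
        + (drift_error n \<omega>)\<^sup>2 + (scale_error n)\<^sup>2 * (L \<omega>)\<^sup>2))"
        by (intro integrable_mult_right Bochner_Integration.integrable_add int)
      show "(dominating n \<omega>)\<^sup>2 \<le> 3 * ((max_transform (\<lambda>_. 1) n \<omega>)\<^sup>2
        + (drift_error n \<omega>)\<^sup>2 + (scale_error n)\<^sup>2 * (L \<omega>)\<^sup>2)" for \<omega>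
        using square_sum3_le[of "max_transform (\<lambda>_. 1) n \<omega>" "drift_error n \<omega>" "scale_error n * \<bar>L \<omega>\<bar>"]
        by (simp add: dominating_def power_mult_distrib)
    qed
    also have "\<dots> = 3 * (expectation (\<lambda>\<omega>. (max_transform (\<lambda>_. 1) n \<omega>)\<^sup>2)
        + expectation (\<lambda>\<omega>. (drift_error n \<omega>)\<^sup>2) + (scale_error n)\<^sup>2 * expectation (\<lambda>\<omega>. (L \<omega>)\<^sup>2))"
      using int by simp
    also have "\<dots> \<le> 3 * (4 * real n + r n * (\<Sum>k<n. weight k * d k)
        + (scale_error n)\<^sup>2 * expectation (\<lambda>\<omega>. (L \<omega>)\<^sup>2))"
      using Doob_maximal_inequality[of "\<lambda>_. 1" n] drift[of n] by (intro mult_left_mono add_mono) auto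
    finally show ?thesis .
  qed
  have "(\<lambda>n. 3 * (4 * (real n / (scale n)\<^sup>2) + (r n / scale n) * ((\<Sum>k<n. weight k * d k) / scale n)
      + (scale_error n / scale n)\<^sup>2 * expectation (\<lambda>\<omega>. (L \<omega>)\<^sup>2)))
      \<longlonglongrightarrow> 3 * (4 * 0 + c * 0 + 0\<^sup>2 * expectation (\<lambda>\<omega>. (L \<omega>)\<^sup>2))"
    by (intro tendsto_mult tendsto_add tendsto_const tendsto_power e_lim r_lim wd_lim
        scale_square_dominates[OF critical p_range light_memory])
  then have upper: "(\<lambda>n. 3 * (4 * (real n / (scale n)\<^sup>2) + (r n / scale n) * ((\<Sum>k<n. weight k * d k) / scale n)
      + (scale_error n / scale n)\<^sup>2 * expectation (\<lambda>\<omega>. (L \<omega>)\<^sup>2))) \<longlonglongrightarrow> 0" by simp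
  show ?thesis
  proof (rule tendsto_sandwich[OF _ _ tendsto_const upper]; rule always_eventually; rule allI)
    fix n
    show "0 \<le> expectation (\<lambda>\<omega>. (dominating n \<omega>)\<^sup>2) / (scale n)\<^sup>2" by simp
    have "expectation (\<lambda>\<omega>. (dominating n \<omega>)\<^sup>2) / (scale n)\<^sup>2 \<le>
      3 * (4 * real n + r n * (\<Sum>k<n. weight k * d k) + (scale_error n)\<^sup>2 * expectation (\<lambda>\<omega>. (L \<omega>)\<^sup>2)) / (scale n)\<^sup>2"
      using bound by (rule divide_right_mono) simp
    also have "\<dots> = 3 * (4 * (real n / (scale n)\<^sup>2) + (r n / scale n) * ((\<Sum>k<n. weight k * d k) / scale n)
      + (scale_error n / scale n)\<^sup>2 * expectation (\<lambda>\<omega>. (L \<omega>)\<^sup>2))"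
      by (simp add: add_divide_distrib distrib_left power_divide power2_eq_square)
    finally show "expectation (\<lambda>\<omega>. (dominating n \<omega>)\<^sup>2) / (scale n)\<^sup>2 \<le> \<dots>" .
  qed
qed

definition rescaled_walk :: "nat \<Rightarrow> 'a \<Rightarrow> real \<Rightarrow> real" where
  "rescaled_walk n \<omega> t = walk X (nat \<lfloor>real n * t\<rfloor>) \<omega> / scale n"

lemma sup_dist_rescaled_walk_le:
  assumes "0 < T" and \<delta>: "\<And>t. 0 \<le> t \<Longrightarrow> t \<le> T \<Longrightarrow> \<bar>scale (nat \<lfloor>real n * t\<rfloor>) / scale n - sqrt t\<bar> \<le> d"
  shows "sup_dist T (rescaled_walk n \<omega>) (\<lambda>t. sqrt t * (c * L \<omega>))
     \<le> ennreal (deviation (nat \<lfloor>real n * T\<rfloor>) \<omega> / scale n + d * \<bar>c * L \<omega>\<bar>)"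
  unfolding sup_dist_def
proof (rule SUP_least, rule ennreal_leI)
  fix t assume t: "t \<in> {0..T}"
  define k where "k = nat \<lfloor>real n * t\<rfloor>"
  have "real n * t \<le> real n * T" using t by (intro mult_left_mono) auto
  then have k: "k \<le> nat \<lfloor>real n * T\<rfloor>" unfolding k_def by (intro nat_mono floor_mono)
  have "rescaled_walk n \<omega> t - sqrt t * (c * L \<omega>)
      = (walk X k \<omega> - c * L \<omega> * scale k) / scale n + (scale k / scale n - sqrt t) * (c * L \<omega>)"
    by (simp add: rescaled_walk_def k_def diff_divide_distrib algebra_simps)
  also have "\<bar>\<dots>\<bar> \<le> \<bar>walk X k \<omega> - c * L \<omega> * scale k\<bar> / scale n + \<bar>scale k / scale n - sqrt t\<bar> * \<bar>c * L \<omega>\<bar>"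
    using scale_nonneg[of n] by (intro order.trans[OF abs_triangle_ineq]) (simp add: abs_mult)
  also have "\<dots> \<le> deviation (nat \<lfloor>real n * T\<rfloor>) \<omega> / scale n + d * \<bar>c * L \<omega>\<bar>"
  proof (intro add_mono divide_right_mono mult_right_mono scale_nonneg)
    show "\<bar>walk X k \<omega> - c * L \<omega> * scale k\<bar> \<le> deviation (nat \<lfloor>real n * T\<rfloor>) \<omega>"
      unfolding deviation_def using k by (intro Max_ge) auto
    show "\<bar>scale k / scale n - sqrt t\<bar> \<le> d" unfolding k_def using \<delta> t by simp
  qed simp
  finally show "\<bar>rescaled_walk n \<omega> t - sqrt t * (c * L \<omega>)\<bar>
      \<le> deviation (nat \<lfloor>real n * T\<rfloor>) \<omega> / scale n + d * \<bar>c * L \<omega>\<bar>" .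
qed

lemma scale_ratio:
  assumes "0 < T"
  shows "(\<lambda>n. scale (nat \<lfloor>real n * T\<rfloor>) / scale n) \<longlonglongrightarrow> sqrt T"
proof -
  from scale_uniform_sequence[OF assms] obtain \<delta> where \<delta>: "\<delta> \<longlonglongrightarrow> 0"
    "\<And>n t. 0 \<le> t \<Longrightarrow> t \<le> T \<Longrightarrow> \<bar>scale (nat \<lfloor>real n * t\<rfloor>) / scale n - sqrt t\<bar> \<le> \<delta> n" by blast
  have "(\<lambda>n. scale (nat \<lfloor>real n * T\<rfloor>) / scale n - sqrt T) \<longlonglongrightarrow> 0"
    by (rule Lim_null_comparison[OF _ \<delta>(1)]) (use \<delta>(2)[of T] assms in auto)
  then show ?thesis by (rule LIM_zero_cancel)
qed

lemma floor_mult_at_top: "0 < T \<Longrightarrow> filterlim (\<lambda>n. nat \<lfloor>real n * T\<rfloor>) at_top sequentially"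
  by real_asymp

lemma tendsto_rescale:
  assumes "0 < T" "(\<lambda>n. x n / scale n ^ m) \<longlonglongrightarrow> 0"
  shows "(\<lambda>n. x (nat \<lfloor>real n * T\<rfloor>) / scale n ^ m) \<longlonglongrightarrow> 0"
proof -
  have "(\<lambda>n. x (nat \<lfloor>real n * T\<rfloor>) / scale (nat \<lfloor>real n * T\<rfloor>) ^ m) \<longlonglongrightarrow> 0"
    using filterlim_compose[OF assms(2) floor_mult_at_top[OF assms(1)]] .
  from tendsto_mult[OF this tendsto_power[OF scale_ratio[OF assms(1)], of m]]
  have "(\<lambda>n. x (nat \<lfloor>real n * T\<rfloor>) / scale (nat \<lfloor>real n * T\<rfloor>) ^ m
      * (scale (nat \<lfloor>real n * T\<rfloor>) / scale n) ^ m) \<longlonglongrightarrow> 0" by simp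
  then show ?thesis
  proof (rule Lim_transform_eventually)
    have "eventually (\<lambda>n. 1 \<le> nat \<lfloor>real n * T\<rfloor>) sequentially"
      using floor_mult_at_top[OF assms(1)] unfolding filterlim_at_top by blast
    then show "eventually (\<lambda>n. x (nat \<lfloor>real n * T\<rfloor>) / scale (nat \<lfloor>real n * T\<rfloor>) ^ m
      * (scale (nat \<lfloor>real n * T\<rfloor>) / scale n) ^ m = x (nat \<lfloor>real n * T\<rfloor>) / scale n ^ m) sequentially"
    proof eventually_elim
      case (elim n)
      from scale_pos[OF this] show ?case by (simp add: power_divide)
    qed
  qed
qed

lemma AS_convergent_rescaled_walk: "AS_convergent_D M rescaled_walk (\<lambda>\<omega> t. sqrt t * (c * L \<omega>))"
  unfolding AS_convergent_D_def
proof (intro allI impI)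
  fix T :: real assume T: "0 < T"
  from scale_uniform_sequence[OF T] obtain \<delta> where \<delta>: "\<delta> \<longlonglongrightarrow> 0"
    "\<And>n t. 0 \<le> t \<Longrightarrow> t \<le> T \<Longrightarrow> \<bar>scale (nat \<lfloor>real n * t\<rfloor>) / scale n - sqrt t\<bar> \<le> \<delta> n" by blast
  show "AE \<omega> in M. (\<lambda>n. sup_dist T (rescaled_walk n \<omega>) (\<lambda>t. sqrt t * (c * L \<omega>))) \<longlonglongrightarrow> 0"
    using AE_deviation
  proof eventually_elim
    case (elim \<omega>)
    then have "(\<lambda>n. deviation (nat \<lfloor>real n * T\<rfloor>) \<omega> / scale n ^ 1) \<longlonglongrightarrow> 0"
      by (intro tendsto_rescale T) simp
    from tendsto_add[OF this tendsto_mult[OF \<delta>(1) tendsto_const[of "\<bar>c * L \<omega>\<bar>"]]]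
    have "(\<lambda>n. ennreal (deviation (nat \<lfloor>real n * T\<rfloor>) \<omega> / scale n + \<delta> n * \<bar>c * L \<omega>\<bar>)) \<longlonglongrightarrow> ennreal 0"
      by (intro tendsto_ennrealI) simp
    then have upper: "(\<lambda>n. ennreal (deviation (nat \<lfloor>real n * T\<rfloor>) \<omega> / scale n + \<delta> n * \<bar>c * L \<omega>\<bar>)) \<longlonglongrightarrow> 0"
      by simp
    show ?case
      by (rule tendsto_sandwich[OF _ _ tendsto_const upper])
        (use sup_dist_rescaled_walk_le[OF T \<delta>(2)] in auto)
  qed
qed

lemma L2_convergent_rescaled_walk: "L2_convergent_D M rescaled_walk (\<lambda>\<omega> t. sqrt t * (c * L \<omega>))"
  unfolding L2_convergent_D_def L2_null_def
proof (intro allI impI conjI)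
  fix T :: real assume T: "0 < T"
  have [measurable]: "L \<in> borel_measurable M" by (rule square_integrable_measurable[OF L_square])
  show "(\<lambda>\<omega>. sup_dist T (rescaled_walk n \<omega>) (\<lambda>t. sqrt t * (c * L \<omega>))) \<in> borel_measurable M" for n
  proof (rule borel_measurable_sup_dist[OF T])
    show "(\<lambda>\<omega>. rescaled_walk n \<omega> t) \<in> borel_measurable M" for t
      unfolding rescaled_walk_def walk_def
      by (intro borel_measurable_divide borel_measurable_sum X_measurable borel_measurable_const) auto
    show "((\<lambda>s. rescaled_walk n \<omega> s - sqrt s * (c * L \<omega>))
        \<longlongrightarrow> rescaled_walk n \<omega> t - sqrt t * (c * L \<omega>)) (at_right t)" for \<omega> t
      unfolding rescaled_walk_def
      by (intro tendsto_diff tendsto_mult tendsto_real_sqrt tendsto_const tendsto_ident_at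
          tendsto_at_right_floor[of "\<lambda>k. walk X k \<omega> / scale n"])
  qed simp
  from scale_uniform_sequence[OF T] obtain \<delta> where \<delta>: "\<delta> \<longlonglongrightarrow> 0"
    "\<And>n t. 0 \<le> t \<Longrightarrow> t \<le> T \<Longrightarrow> \<bar>scale (nat \<lfloor>real n * t\<rfloor>) / scale n - sqrt t\<bar> \<le> \<delta> n" by blast
  define m where "m n = nat \<lfloor>real n * T\<rfloor>" for n
  define E where "E n = 2 * (expectation (\<lambda>\<omega>. (dominating (m n) \<omega>)\<^sup>2) / (scale n)\<^sup>2)
      + 2 * ((\<delta> n)\<^sup>2 * expectation (\<lambda>\<omega>. (c * L \<omega>)\<^sup>2))" for n
  have cL: "square_integrable M (\<lambda>\<omega>. c * L \<omega>)" by (rule square_integrable_cmult[OF L_square])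
  have "(\<lambda>n. E n) \<longlonglongrightarrow> 2 * 0 + 2 * (0\<^sup>2 * expectation (\<lambda>\<omega>. (c * L \<omega>)\<^sup>2))"
    unfolding E_def m_def
    by (intro tendsto_add tendsto_mult tendsto_const tendsto_power \<delta>(1) tendsto_rescale[OF T]
        dominating_second_moment)
  then have "E \<longlonglongrightarrow> 0" by simp
  from tendsto_ennrealI[OF this] have E_lim: "(\<lambda>n. ennreal (E n)) \<longlonglongrightarrow> 0" by simp
  have "(\<integral>\<^sup>+\<omega>. (sup_dist T (rescaled_walk n \<omega>) (\<lambda>t. sqrt t * (c * L \<omega>)))\<^sup>2 \<partial>M) \<le> ennreal (E n)" for n
  proof -
    have "(sup_dist T (rescaled_walk n \<omega>) (\<lambda>t. sqrt t * (c * L \<omega>)))\<^sup>2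
        \<le> ennreal (2 * ((dominating (m n) \<omega>)\<^sup>2 / (scale n)\<^sup>2) + 2 * ((\<delta> n)\<^sup>2 * (c * L \<omega>)\<^sup>2))" for \<omega>
    proof -
      define a b where "a = deviation (m n) \<omega> / scale n" and "b = \<delta> n * \<bar>c * L \<omega>\<bar>"
      have dev0: "0 \<le> deviation (m n) \<omega>"
        unfolding deviation_def by (rule order.trans[OF abs_ge_zero Max_ge]) auto
      then have a0: "0 \<le> a" using scale_nonneg by (simp add: a_def)
      have b0: "0 \<le> b" unfolding b_def using order.trans[OF abs_ge_zero \<delta>(2)[of 0 n]] T
        by (intro mult_nonneg_nonneg) auto
      have "(sup_dist T (rescaled_walk n \<omega>) (\<lambda>t. sqrt t * (c * L \<omega>)))\<^sup>2 \<le> (ennreal (a + b))\<^sup>2"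
        unfolding a_def b_def m_def
        by (intro power_mono sup_dist_rescaled_walk_le T \<delta>(2)) auto
      also have "\<dots> = ennreal ((a + b)\<^sup>2)" using a0 b0 by (intro ennreal_power add_nonneg_nonneg)
      also have "\<dots> \<le> ennreal (2 * ((dominating (m n) \<omega>)\<^sup>2 / (scale n)\<^sup>2) + 2 * ((\<delta> n)\<^sup>2 * (c * L \<omega>)\<^sup>2))"
      proof (rule ennreal_leI)
        have "(a + b)\<^sup>2 \<le> 2 * a\<^sup>2 + 2 * b\<^sup>2"
          using sum_squares_bound[of a b] by (simp add: power2_sum)
        moreover have "a\<^sup>2 \<le> (dominating (m n) \<omega>)\<^sup>2 / (scale n)\<^sup>2"
          unfolding a_def power_divide
          by (intro divide_right_mono power_mono deviation_le_dominating dev0) simp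
        moreover have "b\<^sup>2 = (\<delta> n)\<^sup>2 * (c * L \<omega>)\<^sup>2" by (simp add: b_def power_mult_distrib)
        ultimately show "(a + b)\<^sup>2 \<le> 2 * ((dominating (m n) \<omega>)\<^sup>2 / (scale n)\<^sup>2) + 2 * ((\<delta> n)\<^sup>2 * (c * L \<omega>)\<^sup>2)"
          by linarith
      qed
      finally show ?thesis .
    qed
    then have "(\<integral>\<^sup>+\<omega>. (sup_dist T (rescaled_walk n \<omega>) (\<lambda>t. sqrt t * (c * L \<omega>)))\<^sup>2 \<partial>M)
        \<le> (\<integral>\<^sup>+\<omega>. ennreal (2 * ((dominating (m n) \<omega>)\<^sup>2 / (scale n)\<^sup>2) + 2 * ((\<delta> n)\<^sup>2 * (c * L \<omega>)\<^sup>2)) \<partial>M)"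
      by (intro nn_integral_mono)
    also have "\<dots> = ennreal (expectation (\<lambda>\<omega>. 2 * ((dominating (m n) \<omega>)\<^sup>2 / (scale n)\<^sup>2)
        + 2 * ((\<delta> n)\<^sup>2 * (c * L \<omega>)\<^sup>2)))"
      using square_integrable_square[OF dominating_square] square_integrable_square[OF cL]
      by (intro nn_integral_eq_integral Bochner_Integration.integrable_add integrable_mult_right
          integrable_divide) auto
    also have "\<dots> = ennreal (E n)"
      unfolding E_def using square_integrable_square[OF dominating_square] square_integrable_square[OF cL]
      by (subst Bochner_Integration.integral_add)
        (auto intro!: integrable_mult_right integrable_divide simp del: power_mult_distrib)
    finally show ?thesis .
  qed
  then show "(\<lambda>n. \<integral>\<^sup>+\<omega>. (sup_dist T (rescaled_walk n \<omega>) (\<lambda>t. sqrt t * (c * L \<omega>)))\<^sup>2 \<partial>M) \<longlonglongrightarrow> 0"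
    by (intro tendsto_sandwich[OF _ _ tendsto_const E_lim]) auto
qed

end

theorem convergence:
  assumes "(\<lambda>n. (p / (norm_coeff p \<mu> n * cum_memory \<mu> n)) / (scale (Suc n) - scale n)) \<longlonglongrightarrow> c"
  shows "\<exists>Minf \<in> borel_measurable M.
    (AE \<omega> in M. (\<lambda>n. walk_martingale p \<mu> X n \<omega>) \<longlonglongrightarrow> Minf \<omega>) \<and>
    L2_null M (\<lambda>n \<omega>. ennreal \<bar>walk_martingale p \<mu> X n \<omega> - Minf \<omega>\<bar>) \<and>
    AS_convergent_D M (\<lambda>n \<omega> t. walk X (nat \<lfloor>real n * t\<rfloor>) \<omega> / scale n) (\<lambda>\<omega> t. sqrt t * (c * Minf \<omega>)) \<and>
    L2_convergent_D M (\<lambda>n \<omega> t. walk X (nat \<lfloor>real n * t\<rfloor>) \<omega> / scale n) (\<lambda>\<omega> t. sqrt t * (c * Minf \<omega>))"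
proof -
  from L2_convergence[OF summable_coeff] obtain L where L: "square_integrable M L"
    "AE \<omega> in M. (\<lambda>n. transform coeff n \<omega>) \<longlonglongrightarrow> L \<omega>"
    "(\<lambda>n. expectation (\<lambda>\<omega>. (transform coeff n \<omega> - L \<omega>)\<^sup>2)) \<longlonglongrightarrow> 0" by blast
  note L' = assms[folded weight_def] L[folded walk_martingale_eq]
  have sq: "square_integrable M (\<lambda>\<omega>. walk_martingale p \<mu> X n \<omega> - L \<omega>)" for n
    unfolding walk_martingale_eq by (intro square_integrable_diff transform_square_integrable L)
  have "L2_null M (\<lambda>n \<omega>. ennreal \<bar>walk_martingale p \<mu> X n \<omega> - L \<omega>\<bar>)"
    unfolding L2_null_def nn_integral_square_eq[OF sq]
  proof
    show "\<forall>n. (\<lambda>\<omega>. ennreal \<bar>walk_martingale p \<mu> X n \<omega> - L \<omega>\<bar>) \<in> borel_measurable M"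
      using square_integrable_measurable[OF sq] by auto
    show "(\<lambda>n. ennreal (expectation (\<lambda>\<omega>. (walk_martingale p \<mu> X n \<omega> - L \<omega>)\<^sup>2))) \<longlonglongrightarrow> 0"
      using tendsto_ennrealI[OF L'(4)] by simp
  qed
  then show ?thesis
    using L'(3) square_integrable_measurable[OF L(1)]
      AS_convergent_rescaled_walk[OF L'(1,2,3,4), unfolded rescaled_walk_def[OF L'(1,2,3,4), abs_def]]
      L2_convergent_rescaled_walk[OF L'(1,2,3,4), unfolded rescaled_walk_def[OF L'(1,2,3,4), abs_def]]
    by blast
qed

end

theorem corollary4p15:
  fixes \<gamma> p \<alpha> :: real and \<mu> :: "nat \<Rightarrow> real" and l :: "real \<Rightarrow> real"
  assumes "assumption_A \<mu> \<gamma> \<alpha> l"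
    and "p = p_crit \<gamma>"
    and "\<alpha> + \<gamma> + 1 < 0"
  shows "\<exists>c::real. \<forall>(M::'a measure) \<xi> \<epsilon> \<beta> X.
           srrw_rvm M \<gamma> p \<mu> \<xi> \<epsilon> \<beta> X \<longrightarrow>
           integrable M (\<lambda>\<omega>. (\<xi> 1 \<omega>)\<^sup>2) \<longrightarrow> prob_space.variance M (\<xi> 1) = 1 \<longrightarrow>
           (\<exists>Minf \<in> borel_measurable M.
              (AE \<omega> in M. (\<lambda>n. walk_martingale p \<mu> X n \<omega>) \<longlonglongrightarrow> Minf \<omega>) \<and>
              L2_null M (\<lambda>n \<omega>. ennreal \<bar>walk_martingale p \<mu> X n \<omega> - Minf \<omega>\<bar>) \<and>
              (let Y = (\<lambda>n \<omega> t. sqrt (l (real n) powr (1 / (\<gamma> + 1)))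
                                 * (walk X (nat \<lfloor>real n * t\<rfloor>) \<omega> / sqrt (real n)));
                   Kinf = (\<lambda>\<omega>. c * Minf \<omega>);
                   Z = (\<lambda>\<omega> t. sqrt t * Kinf \<omega>)
               in AS_convergent_D M Y Z \<and> L2_convergent_D M Y Z))"
proof (cases "\<gamma> > -1 \<and> 0 \<le> p \<and> p \<le> 1")
  case True
  interpret memory_asymptotics \<mu> \<gamma> \<alpha> l using assms True by unfold_locales auto
  obtain c where c: "(\<lambda>n. (p / (norm_coeff p \<mu> n * cum_memory \<mu> n)) / (scale (Suc n) - scale n)) \<longlonglongrightarrow> c"
    using drift_weight_asymptotics[of p] assms(2) True by blast
  have Y: "sqrt (l (real n) powr (1 / (\<gamma> + 1))) * (x / sqrt (real n)) = x / scale n" for n x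
    by (simp add: scale_def)
  show ?thesis
  proof (intro exI[of _ c] allI impI)
    fix M :: "'a measure" and \<xi> \<epsilon> \<beta> X
    assume srrw: "srrw_rvm M \<gamma> p \<mu> \<xi> \<epsilon> \<beta> X" and sq: "integrable M (\<lambda>\<omega>. (\<xi> 1 \<omega>)\<^sup>2)"
      and var: "prob_space.variance M (\<xi> 1) = 1"
    interpret srrw_rvm M \<gamma> p \<mu> \<xi> \<epsilon> \<beta> X by (rule srrw)
    interpret critical_srrw M \<gamma> p \<mu> \<xi> \<epsilon> \<beta> X \<alpha> l
      using assms sq var unfolding innovation_mean by unfold_locales auto
    show "\<exists>Minf \<in> borel_measurable M.
              (AE \<omega> in M. (\<lambda>n. walk_martingale p \<mu> X n \<omega>) \<longlonglongrightarrow> Minf \<omega>) \<and>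
              L2_null M (\<lambda>n \<omega>. ennreal \<bar>walk_martingale p \<mu> X n \<omega> - Minf \<omega>\<bar>) \<and>
              (let Y = (\<lambda>n \<omega> t. sqrt (l (real n) powr (1 / (\<gamma> + 1)))
                                 * (walk X (nat \<lfloor>real n * t\<rfloor>) \<omega> / sqrt (real n)));
                   Kinf = (\<lambda>\<omega>. c * Minf \<omega>);
                   Z = (\<lambda>\<omega> t. sqrt t * Kinf \<omega>)
               in AS_convergent_D M Y Z \<and> L2_convergent_D M Y Z)"
      unfolding Let_def Y by (rule convergence[OF c])
  qed
next
  case False
  then show ?thesis
    by (intro exI[of _ 0] allI impI) (auto dest: srrw_rvm.gamma_gt srrw_rvm.p_range)
qed

end
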